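(* Let $n\ge 1$, let $J\subset S=K[x_1,\dots,x_r]$ be a homogeneous ideal, and let $A=S/J$ with Hilbert function $h_A$. Assume that $h_A(n)\ge\binom{n+2}{2}$ and that $h_A(n+1)=h_A(n)^{\langle n\rangle}-1$. Then the base locus of $[J]_n$ in $\mathbb P^{r-1}$ is a scheme of dimension either $MG(h_A(n),n)-1$ or $MG(h_A(n),n)$.
   Context: $K$ is an algebraically closed field of arbitrary characteristic, and $S=K[x_1,\dots,x_r]$ has the standard grading. For a homogeneous ideal $J\subset S$, $[J]_t$ is its degree $t$ component and the Hilbert function of $A=S/J$ is $h_A(t)=\dim_K[S/J]_t$. The base locus of $[J]_n$ is the closed subscheme of $\mathbb P^{r-1}=\operatorname{Proj} S$ defined by the ideal generated by $[J]_n$. For positive integers $k,i$, the $i$-binomial expansion of $k$ is the unique expression $k=\binom{k_i}{i}+\binom{k_{i-1}}{i-1}+\dots+\binom{k_j}{j}$ with $k_i>k_{i-1}>\dots>k_j\ge j\ge 1$. One sets $k^{\langle i\rangle}=\binom{k_i+1}{i+1}+\binom{k_{i-1}+1}{i}+\dots+\binom{k_j+1}{j+1}$. The MG-dimension of $k$ in degree $n$ is $MG(k,n)=k_n-n$, where $\binom{k_n}{n}$ is the first term of the $n$-binomial expansion of $k$. *)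

theory Defs
  imports
    "HOL-Analysis.Analysis"
    "HOL-Library.Poly_Mapping"
    "HOL-Computational_Algebra.Polynomial"
begin

section \<open>Binomial expansions\<close>

text \<open>
  The \<open>i\<close>-binomial expansion of \<open>k\<close> is recorded by its lower end \<open>j\<close> and by a function \<open>c\<close>,
  of which only the values \<open>c j < \<dots> < c i\<close> on \<open>{j..i}\<close> matter.
\<close>

definition binomial_expansion :: "nat \<Rightarrow> nat \<Rightarrow> (nat \<Rightarrow> nat) \<Rightarrow> nat \<Rightarrow> bool" where
  "binomial_expansion i k c j \<longleftrightarrow>
     1 \<le> j \<and> j \<le> i \<and> j \<le> c j \<and> strict_mono_on {j..i} c \<and> k = (\<Sum>l = j..i. c l choose l)"

definition macaulay_up :: "nat \<Rightarrow> nat \<Rightarrow> nat" where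
  "macaulay_up k i =
     (THE m. \<exists>c j. binomial_expansion i k c j \<and> m = (\<Sum>l = j..i. Suc (c l) choose Suc l))"

definition MG :: "nat \<Rightarrow> nat \<Rightarrow> int" where
  "MG k n = (THE d. \<exists>c j. binomial_expansion n k c j \<and> d = int (c n) - int n)"

lemma binomial_expansion_ge:
  assumes "binomial_expansion i k c j" "j \<le> l" "l \<le> i"
  shows "l \<le> c l"
  using assms(2,3)
proof (induction l rule: dec_induct)
  case base
  then show ?case using assms(1) by (simp add: binomial_expansion_def)
next
  case (step m)
  have "c m < c (Suc m)"
    using assms(1) step by (auto simp: binomial_expansion_def strict_mono_on_def)
  with step show ?case by simp
qed

lemma binomial_expansion_step:
  assumes "binomial_expansion (Suc i) k c j" "j \<le> i"
  shows "binomial_expansion i (k - (c (Suc i) choose Suc i)) c j"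
    and "(c (Suc i) choose Suc i) \<le> k" and "c i < c (Suc i)"
  using assms by (auto simp: binomial_expansion_def strict_mono_on_def)

lemma binomial_expansion_bounds:
  assumes "binomial_expansion i k c j"
  shows "(c i choose i) \<le> k \<and> k < (Suc (c i) choose i)"
  using assms
proof (induction i arbitrary: k)
  case 0
  then show ?case by (auto simp: binomial_expansion_def)
next
  case (Suc i)
  show ?case
  proof (cases "j \<le> i")
    case True
    let ?k = "k - (c (Suc i) choose Suc i)"
    note st = binomial_expansion_step[OF Suc.prems True]
    have "?k < (Suc (c i) choose i)" using Suc.IH[OF st(1)] by simp
    also have "\<dots> \<le> (c (Suc i) choose i)" using st(3) by (intro binomial_right_mono) simp
    finally show ?thesis using st(2) by simp
  next
    case False
    then have j: "j = Suc i" using Suc.prems by (simp add: binomial_expansion_def)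
    then have "k = (c (Suc i) choose Suc i)" "Suc i \<le> c (Suc i)"
      using Suc.prems by (simp_all add: binomial_expansion_def)
    moreover from this have "0 < (c (Suc i) choose i)" by simp
    ultimately show ?thesis by simp
  qed
qed

lemma binomial_expansion_pos: "binomial_expansion i k c j \<Longrightarrow> 0 < k"
  using binomial_expansion_bounds[of i k c j] binomial_expansion_ge[of i k c j i]
  by (force simp: binomial_expansion_def zero_less_binomial_iff dest: order.strict_trans2)

lemma binomial_expansion_unique:
  assumes "binomial_expansion i k c j" "binomial_expansion i k c' j'"
  shows "j = j' \<and> (\<forall>l\<in>{j..i}. c l = c' l)"
  using assms
proof (induction i arbitrary: k)
  case 0
  then show ?case by (auto simp: binomial_expansion_def)
next
  case (Suc i)
  have *: "\<not> a < b" if "k < (Suc a choose Suc i)" "(b choose Suc i) \<le> k" for a b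
    using that binomial_right_mono[of "Suc a" b "Suc i"] by linarith
  have top: "c (Suc i) = c' (Suc i)"
    using binomial_expansion_bounds[OF Suc.prems(1)] binomial_expansion_bounds[OF Suc.prems(2)] *
    by (metis linorder_neqE_nat)
  have low: "j = Suc i \<longleftrightarrow> k = (c (Suc i) choose Suc i)" if "binomial_expansion (Suc i) k c j" for c j
  proof
    assume "k = (c (Suc i) choose Suc i)"
    then show "j = Suc i"
      using binomial_expansion_step(1)[OF that] binomial_expansion_pos that
      by (fastforce simp: binomial_expansion_def)
  qed (use that in \<open>simp add: binomial_expansion_def\<close>)
  show ?case
  proof (cases "j = Suc i")
    case True
    then show ?thesis using low[OF Suc.prems(1)] low[OF Suc.prems(2)] top by simp
  next
    case False
    then have "j' \<noteq> Suc i" using low[OF Suc.prems(1)] low[OF Suc.prems(2)] top by simp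
    with False have "j \<le> i" "j' \<le> i" using Suc.prems by (auto simp: binomial_expansion_def)
    then have "j = j' \<and> (\<forall>l\<in>{j..i}. c l = c' l)"
      using Suc.IH binomial_expansion_step(1) Suc.prems top by metis
    then show ?thesis using top by (auto simp: le_Suc_eq)
  qed
qed

lemma binomial_expansion_exists:
  assumes "0 < k" "0 < i"
  shows "\<exists>c j. binomial_expansion i k c j"
  using assms
proof (induction i arbitrary: k)
  case 0
  then show ?case by simp
next
  case (Suc i)
  define P where "P = (\<lambda>m. (m choose Suc i) \<le> k)"
  have bd: "m \<le> k + i" if "P m" for m
  proof (rule ccontr)
    assume "\<not> m \<le> k + i"
    then have "Suc (k + i) choose Suc i \<le> k"
      using that binomial_right_mono[of "Suc (k + i)" m "Suc i"] by (simp add: P_def)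
    moreover have "k < (Suc (k + i) choose Suc i)"
    proof -
      have "k < (Suc (k + n) choose Suc n)" for n
        by (induction n) auto
      then show ?thesis .
    qed
    ultimately show False by simp
  qed
  have P1: "P (Suc i)" using Suc.prems by (simp add: P_def)
  define m where "m = (GREATEST m. P m)"
  have Pm: "P m" unfolding m_def by (rule GreatestI_nat[where P = P, OF P1 bd])
  have mi: "Suc i \<le> m" unfolding m_def by (rule Greatest_le_nat[where P = P, OF P1 bd])
  have "\<not> P (Suc m)"
  proof
    assume "P (Suc m)"
    then have "Suc m \<le> m" unfolding m_def by (rule Greatest_le_nat[where P = P, OF _ bd])
    then show False by simp
  qed
  then have up: "k - (m choose Suc i) < (m choose i)" using Pm by (simp add: P_def)
  show ?case
  proof (cases "k = (m choose Suc i)")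
    case True
    then have "binomial_expansion (Suc i) k (\<lambda>_. m) (Suc i)"
      using mi by (simp add: binomial_expansion_def strict_mono_on_def)
    then show ?thesis by blast
  next
    case False
    then have pos: "0 < k - (m choose Suc i)" using Pm by (simp add: P_def)
    then have "0 < i" using up by (cases i) auto
    from Suc.IH[OF pos this] obtain c j
      where cj: "binomial_expansion i (k - (m choose Suc i)) c j" by blast
    have "c i < m"
    proof (rule ccontr)
      assume "\<not> c i < m"
      then have "(m choose i) \<le> (c i choose i)" by (intro binomial_right_mono) simp
      then show False using binomial_expansion_bounds[OF cj] up by simp
    qed
    moreover have "c l \<le> c i" if "l \<in> {j..i}" for l
      using cj that strict_mono_onD[of "{j..i}" c l i]
      by (cases "l = i") (auto simp: binomial_expansion_def)
    ultimately have lt: "c l < m" if "l \<in> {j..i}" for l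
      using that by (meson le_less_trans)
    have "(\<Sum>l = j..i. (c(Suc i := m)) l choose l) = (\<Sum>l = j..i. c l choose l)"
      by (rule sum.cong) auto
    then have "binomial_expansion (Suc i) k (c(Suc i := m)) j"
      using cj lt Pm unfolding binomial_expansion_def P_def
      by (auto simp: strict_mono_on_def le_Suc_eq)
    then show ?thesis by blast
  qed
qed

lemma macaulay_up_eq:
  assumes "binomial_expansion i k c j"
  shows "macaulay_up k i = (\<Sum>l = j..i. Suc (c l) choose Suc l)"
  unfolding macaulay_up_def
proof (rule the_equality)
  fix m
  assume "\<exists>c j. binomial_expansion i k c j \<and> m = (\<Sum>l = j..i. Suc (c l) choose Suc l)"
  then obtain c' j' where c': "binomial_expansion i k c' j'"
    and m: "m = (\<Sum>l = j'..i. Suc (c' l) choose Suc l)" by blast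
  show "m = (\<Sum>l = j..i. Suc (c l) choose Suc l)"
    unfolding m using binomial_expansion_unique[OF assms c'] by (auto intro!: sum.cong)
qed (use assms in blast)

lemma MG_eq:
  assumes "binomial_expansion n k c j"
  shows "MG k n = int (c n) - int n"
  unfolding MG_def
proof (rule the_equality)
  fix d
  assume "\<exists>c j. binomial_expansion n k c j \<and> d = int (c n) - int n"
  then obtain c' j' where c': "binomial_expansion n k c' j'" and d: "d = int (c' n) - int n"
    by blast
  show "d = int (c n) - int n"
    using binomial_expansion_unique[OF assms c'] assms
    by (auto simp: d binomial_expansion_def)
qed (use assms in blast)


section \<open>Graded ideals of a polynomial ring\<close>

text \<open>
  The polynomial ring over \<open>'k\<close> in the variables indexed by the finite type \<open>'v\<close>;
  thus \<open>r = CARD('v)\<close>.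
\<close>

type_synonym ('v, 'k) mpolys = "('v \<Rightarrow>\<^sub>0 nat) \<Rightarrow>\<^sub>0 'k"

definition mon_degree :: "('v::finite \<Rightarrow>\<^sub>0 nat) \<Rightarrow> nat" where
  "mon_degree m = (\<Sum>v\<in>UNIV. Poly_Mapping.lookup m v)"

definition forms :: "nat \<Rightarrow> ('v::finite, 'k::field) mpolys set" where
  "forms t = {f. \<forall>m \<in> Poly_Mapping.keys f. mon_degree m = t}"

text \<open>Ideals of a commutative ring are its submodules over itself.\<close>

lemma module_times: "module ((*) :: 'a::comm_ring_1 \<Rightarrow> 'a \<Rightarrow> 'a)"
  by unfold_locales (simp_all add: algebra_simps)

abbreviation is_ideal :: "'a::comm_ring_1 set \<Rightarrow> bool" where
  "is_ideal \<equiv> module.subspace (*)"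

abbreviation ideal_generated :: "'a::comm_ring_1 set \<Rightarrow> 'a set" where
  "ideal_generated \<equiv> module.span (*)"

definition is_prime_ideal :: "'a::comm_ring_1 set \<Rightarrow> bool" where
  "is_prime_ideal P \<longleftrightarrow> is_ideal P \<and> P \<noteq> UNIV \<and> (\<forall>a b. a * b \<in> P \<longrightarrow> a \<in> P \<or> b \<in> P)"

definition homogeneous_ideal :: "('v::finite, 'k::field) mpolys set \<Rightarrow> bool" where
  "homogeneous_ideal J \<longleftrightarrow> (\<exists>G \<subseteq> (\<Union>t. forms t). J = ideal_generated G)"

text \<open>
  \<open>hilbert_function J t\<close> is the dimension of \<open>[S/J]\<^sub>t\<close>, that is, the cardinality of a set of forms of
  degree \<open>t\<close> whose residue classes modulo \<open>J\<close> are a basis of \<open>[S/J]\<^sub>t\<close>. Multiplication by the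
  constant polynomial \<open>Poly_Mapping.single 0 a\<close> is scalar multiplication by \<open>a\<close>.
\<close>

definition residue_basis ::
  "('v::finite, 'k::field) mpolys set \<Rightarrow> nat \<Rightarrow> ('v, 'k) mpolys set \<Rightarrow> bool" where
  "residue_basis J t B \<longleftrightarrow> finite B \<and> B \<subseteq> forms t \<and>
     (\<forall>a. (\<Sum>b\<in>B. Poly_Mapping.single 0 (a b) * b) \<in> J \<longrightarrow> (\<forall>b\<in>B. a b = 0)) \<and>
     (\<forall>f \<in> forms t. \<exists>a. f - (\<Sum>b\<in>B. Poly_Mapping.single 0 (a b) * b) \<in> J)"

definition hilbert_function :: "('v::finite, 'k::field) mpolys set \<Rightarrow> nat \<Rightarrow> nat" where
  "hilbert_function J t = (THE d. \<exists>B. residue_basis J t B \<and> d = card B)"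


section \<open>The projective spectrum\<close>

text \<open>The points: homogeneous prime ideals not containing all forms of positive degree.\<close>

definition Proj_points :: "('v::finite, 'k::field) mpolys set set" where
  "Proj_points = {P. is_prime_ideal P \<and> homogeneous_ideal P \<and> \<not> (\<Union>t\<in>{1..}. forms t) \<subseteq> P}"

definition Proj_zeros :: "('v::finite, 'k::field) mpolys set \<Rightarrow> ('v, 'k) mpolys set set" where
  "Proj_zeros I = {P \<in> Proj_points. I \<subseteq> P}"

definition Proj :: "('v::finite, 'k::field) mpolys set topology" where
  "Proj = topology (\<lambda>U. \<exists>I. homogeneous_ideal I \<and> U = Proj_points - Proj_zeros I)"

lemma Proj_zeros_ideal_generated: "Proj_zeros (ideal_generated G) = Proj_zeros G"
proof -
  have "ideal_generated G \<subseteq> P \<longleftrightarrow> G \<subseteq> P" if "P \<in> Proj_points" for P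
  proof -
    from that have "is_ideal P" by (simp add: Proj_points_def is_prime_ideal_def)
    then show ?thesis
      using module.span_minimal[OF module_times, of G P]
        module.span_superset[OF module_times, of G] by blast
  qed
  then show ?thesis by (auto simp: Proj_zeros_def)
qed

lemma forms_mult:
  assumes "f \<in> forms s" "g \<in> forms t"
  shows "f * g \<in> forms (s + t)"
  using assms keys_mult[of f g]
  by (fastforce simp: forms_def mon_degree_def lookup_add sum.distrib)

lemma openin_Proj:
  fixes U :: "('v::finite, 'k::field) mpolys set set"
  shows "openin Proj U \<longleftrightarrow> (\<exists>I. homogeneous_ideal I \<and> U = Proj_points - Proj_zeros I)"
proof -
  let ?H = "\<Union>t. forms t :: ('v, 'k) mpolys set"
  let ?op = "\<lambda>U. \<exists>G \<subseteq> ?H. U = Proj_points - Proj_zeros (G :: ('v, 'k) mpolys set)"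
  have eq: "(\<exists>I. homogeneous_ideal I \<and> U = Proj_points - Proj_zeros I) \<longleftrightarrow> ?op U" for U
  proof
    assume "?op U"
    then obtain G where G: "G \<subseteq> ?H" "U = Proj_points - Proj_zeros G" by blast
    then have "homogeneous_ideal (ideal_generated G)"
      unfolding homogeneous_ideal_def by blast
    then show "\<exists>I. homogeneous_ideal I \<and> U = Proj_points - Proj_zeros I"
      using G(2) by (intro exI[of _ "ideal_generated G"]) (simp add: Proj_zeros_ideal_generated)
  qed (auto simp: homogeneous_ideal_def Proj_zeros_ideal_generated)
  have "istopology ?op"
    unfolding istopology_def
  proof (intro conjI allI impI)
    fix U V :: "('v, 'k) mpolys set set"
    assume "?op U" "?op V"
    then obtain G G' where G: "G \<subseteq> ?H" "U = Proj_points - Proj_zeros G"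
      and G': "G' \<subseteq> ?H" "V = Proj_points - Proj_zeros G'" by blast
    let ?GG = "{g * g' | g g'. g \<in> G \<and> g' \<in> G'}"
    have "?GG \<subseteq> ?H"
    proof
      fix f assume "f \<in> ?GG"
      then obtain g g' where "f = g * g'" "g \<in> ?H" "g' \<in> ?H" using G(1) G'(1) by blast
      then show "f \<in> ?H" using forms_mult by (metis UN_iff UNIV_I)
    qed
    moreover have "Proj_zeros ?GG = Proj_zeros G \<union> Proj_zeros G'"
    proof -
      have "?GG \<subseteq> P \<longleftrightarrow> G \<subseteq> P \<or> G' \<subseteq> P" if "P \<in> Proj_points" for P
      proof
        from that have P: "is_ideal P" "\<And>a b. a * b \<in> P \<Longrightarrow> a \<in> P \<or> b \<in> P"
          by (auto simp: Proj_points_def is_prime_ideal_def)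
        show "G \<subseteq> P \<or> G' \<subseteq> P" if "?GG \<subseteq> P"
          using that P(2) by blast
        have "a * b \<in> P" if "a \<in> P \<or> b \<in> P" for a b
          using that module.subspace_scale[OF module_times P(1)] by (metis mult.commute)
        then show "?GG \<subseteq> P" if "G \<subseteq> P \<or> G' \<subseteq> P"
          using that by blast
      qed
      then show ?thesis unfolding Proj_zeros_def by blast
    qed
    moreover have "U \<inter> V = Proj_points - (Proj_zeros G \<union> Proj_zeros G')"
      unfolding G(2) G'(2) by blast
    ultimately show "?op (U \<inter> V)" by (intro exI[of _ ?GG]) simp
  next
    fix \<U> :: "('v, 'k) mpolys set set set"
    assume op: "\<forall>U\<in>\<U>. ?op U"
    define F where "F = (\<lambda>U. SOME G. G \<subseteq> ?H \<and> U = Proj_points - Proj_zeros G)"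
    have F: "F U \<subseteq> ?H \<and> U = Proj_points - Proj_zeros (F U)" if "U \<in> \<U>" for U
      unfolding F_def by (rule someI_ex) (rule bspec[OF op that])
    have "\<Union>\<U> = (\<Union>U\<in>\<U>. U)" by simp
    also have "\<dots> = (\<Union>U\<in>\<U>. Proj_points - Proj_zeros (F U))"
      by (rule SUP_cong[OF refl]) (rule conjunct2[OF F])
    also have "\<dots> = Proj_points - Proj_zeros (\<Union>U\<in>\<U>. F U)"
      unfolding Proj_zeros_def by blast
    finally have "\<Union>\<U> = Proj_points - Proj_zeros (\<Union>U\<in>\<U>. F U)" .
    moreover have "(\<Union>U\<in>\<U>. F U) \<subseteq> ?H"
      by (rule UN_least) (rule conjunct1[OF F])
    ultimately show "?op (\<Union>\<U>)" by (intro exI[of _ "\<Union>U\<in>\<U>. F U"] conjI)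
  qed
  then have "openin (topology ?op) = ?op" by (rule topology_inverse')
  then show ?thesis unfolding Proj_def eq by simp
qed

text \<open>
  The underlying topological space of the closed subscheme of \<open>Proj S\<close> defined by the ideal
  generated by \<open>[J]\<^sub>n\<close>.
\<close>

definition base_locus ::
  "('v::finite, 'k::field) mpolys set \<Rightarrow> nat \<Rightarrow> ('v, 'k) mpolys set topology" where
  "base_locus J n = subtopology Proj (Proj_zeros (ideal_generated (J \<inter> forms n)))"


section \<open>Dimension of a topological space\<close>

definition irreducible_closedin :: "'a topology \<Rightarrow> 'a set \<Rightarrow> bool" where
  "irreducible_closedin X Z \<longleftrightarrow> closedin X Z \<and> Z \<noteq> {} \<and>
     (\<forall>A B. closedin X A \<and> closedin X B \<and> Z = A \<union> B \<longrightarrow> Z = A \<or> Z = B)"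

text \<open>
  The dimension of a scheme is that of its underlying space: the supremum of the lengths of chains
  of irreducible closed subsets. The empty space has dimension \<open>-\<infinity>\<close>.
\<close>

definition krull_dim :: "'a topology \<Rightarrow> ereal" where
  "krull_dim X = Sup {ereal (real n) | n.
     \<exists>Z. (\<forall>i\<le>n. irreducible_closedin X (Z i)) \<and> (\<forall>i<n. Z i \<subset> Z (Suc i))}"

end

theory Submission
  imports Defs "HOL-Library.Function_Algebras"
begin

text \<open>
  All ideals are replaced by their inverse systems: the dual of \<open>[S/I]\<^sub>t\<close> is a space \<open>\<Lambda>\<close> of
  functionals, a hyperplane section by \<open>l\<close> is the kernel of \<open>l\<close> on \<open>\<Lambda>\<close>, the colon ideal by \<open>l\<close> is
  the image \<open>l \<Lambda>\<close>, and passing to the next degree is prolongation. Green's bound for a general \<open>l\<close>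
  then yields Macaulay's bound by rank and nullity.

  Dimension is measured by the growth of the Hilbert function. A general hyperplane section lowers
  the growth by one, and any single equation lowers it by at most one. If \<open>[J]\<^sub>n\<close> has growth one
  below the maximum, a general section again has growth at most one below the maximum, or has
  maximal growth, so one is reduced to proving that the base locus is non-empty when the
  MG-dimension is one. There either multiplication by \<open>l\<close> is a bijection on dual spaces, and the
  operators \<open>x\<^sub>v / l\<close> have commutators of rank at most one and hence a common eigenvector, which is
  a point of the base locus; or the colon ideal by \<open>l\<close> has (almost) maximal growth in degree
  \<open>n - 1\<close> and one concludes by induction on \<open>n\<close>. The upper bound for the dimension is the same
  reduction to general sections.
\<close>

section \<open>Linear algebra in finitely spanned subspaces\<close>

text \<open>For a Hilbert function, \<open>\<not> grows_le k\<close> is to be read as: the zero set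
  has dimension at least \<open>k\<close>; for \<open>k = 0\<close> it is non-empty. Only this class
  is followed, never a Hilbert polynomial. The reduction to sections rests on an identity:
  Macaulay's bound for \<open>c\<close> is \<open>c\<close> plus Macaulay's bound for Green's number
  of \<open>c\<close>. A missing dimension is thus lost either in the image of \<open>l\<close> or
  in the section; in the second case the section keeps Green's value with submaximal growth, or has
  one dimension less with maximal growth. The obstacle is MG-dimension one: there the section may
  die in degree \<open>n + 1\<close>, and sections alone no longer produce a point. But then nothing
  is lost in the image, so \<open>l\<close> maps the prolongation onto \<open>\<Lambda>\<close>.
  This surjectivity allows division by \<open>l\<close>, and it places \<open>\<Lambda>\<close>
  inside the prolongation of \<open>l \<Lambda>\<close>. Arbitrary characteristic causes no trouble
  because polynomials act by contraction of monomials, without the factorials of differentiation,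
  and because general position is derived from the finiteness of eigenvalues in pencils.\<close>

definition (in vector_space) fin_spanned :: "'b set \<Rightarrow> bool" where
  "fin_spanned V \<longleftrightarrow> (\<exists>F. finite F \<and> V \<subseteq> span F)"

context vector_space
begin

lemma fin_spanned_subset: "fin_spanned W \<Longrightarrow> V \<subseteq> W \<Longrightarrow> fin_spanned V"
  unfolding fin_spanned_def by blast

lemma fin_spanned_independent:
  assumes "fin_spanned V" "independent B" "B \<subseteq> V"
  shows "finite B"
  using assms independent_span_bound unfolding fin_spanned_def by (meson subset_trans)

lemma fin_spanned_basis:
  assumes "fin_spanned V"
  obtains B where "B \<subseteq> V" "independent B" "V \<subseteq> span B" "card B = dim V" "finite B"
  using basis_exists[of V] fin_spanned_independent[OF assms] by metis

text \<open>Without finite spanning the claim can fail: \<open>dim\<close> is the cardinality of a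
  basis, and an infinite basis counts as 0. The functions on all monomials form such an
  infinite-dimensional space.\<close>

lemma dim_mono_fin:
  assumes "fin_spanned W" "V \<subseteq> W"
  shows "dim V \<le> dim W"
proof -
  obtain B where "B \<subseteq> W" "independent B" "W \<subseteq> span B" "card B = dim W" "finite B"
    using fin_spanned_basis[OF assms(1)] by metis
  then show ?thesis using dim_le_card[of V B] assms(2) by auto
qed

lemma card_le_dim_fin:
  assumes "fin_spanned V" "independent B" "B \<subseteq> V"
  shows "card B \<le> dim V"
  using dim_mono_fin[OF assms(1,3)] dim_eq_card_independent[OF assms(2)] by simp

lemma subspace_eq_if_dim_le:
  assumes "subspace V" "V \<subseteq> W" "fin_spanned W" "dim W \<le> dim V"
  shows "V = W"
proof (rule ccontr)
  assume "V \<noteq> W"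
  then obtain x where x: "x \<in> W" "x \<notin> V" using assms(2) by blast
  have fV: "fin_spanned V" using fin_spanned_subset assms by blast
  obtain B where B: "B \<subseteq> V" "independent B" "V \<subseteq> span B" "card B = dim V" "finite B"
    using fin_spanned_basis[OF fV] by metis
  have "span B = V" using B assms(1) by (simp add: span_subspace)
  then have "independent (insert x B)" "x \<notin> B"
    using x B independent_insertI by auto
  then have "Suc (dim V) \<le> dim W"
    using card_le_dim_fin[OF assms(3), of "insert x B"] B x assms(2) by auto
  then show False using assms(4) by simp
qed

lemma dim_less_fin:
  assumes "subspace V" "V \<subset> W" "fin_spanned W"
  shows "dim V < dim W"
  using subspace_eq_if_dim_le[of V W] assms by (metis not_le psubsetE order.refl)

lemma dim_zero_subspace [simp]: "dim {0} = 0"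
  using dim_span_eq_card_independent[of "{}"] independent_empty by simp

lemma dim_0_iff_fin:
  assumes "subspace V" "fin_spanned V"
  shows "dim V = 0 \<longleftrightarrow> V = {0}"
proof
  assume "dim V = 0"
  then show "V = {0}"
    using subspace_eq_if_dim_le[of "{0}" V] assms subspace_0[of V] by auto
qed simp

text \<open>Coordinates with respect to \<open>B\<close> are supported in \<open>K\<close> and also
  in \<open>B - K\<close>.\<close>

lemma independent_Int_span:
  assumes "independent B" "K \<subseteq> B" "x \<in> span K" "x \<in> span (B - K)"
  shows "x = 0"
proof -
  have "representation B x = representation K x"
    by (rule representation_extend[OF assms(1,3,2)])
  moreover have "representation B x = representation (B - K) x"
    by (rule representation_extend[OF assms(1,4)]) blast
  ultimately have z: "representation B x b = 0" for b
    using representation_ne_zero[of K x b] representation_ne_zero[of "B - K" x b] by auto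
  have "x \<in> span B" using assms span_mono by blast
  then show ?thesis
    using sum_nonzero_representation_eq[OF assms(1)] z by fastforce
qed

lemma complement_of_subspace:
  assumes "subspace V" "fin_spanned V" "subspace N" "N \<subseteq> V"
  obtains M where "subspace M" "M \<subseteq> V" "M \<inter> N = {0}" "dim V = dim N + dim M"
    "\<And>x. x \<in> V \<Longrightarrow> \<exists>y\<in>N. \<exists>z\<in>M. x = y + z"
proof -
  obtain K where K: "K \<subseteq> N" "independent K" "N \<subseteq> span K" "card K = dim N" "finite K"
    using fin_spanned_basis fin_spanned_subset assms by metis
  obtain B where B: "K \<subseteq> B" "B \<subseteq> V" "independent B" "V \<subseteq> span B"
    using maximal_independent_subset_extend[of K V] K assms by blast
  have fB: "finite B" using fin_spanned_independent assms B by blast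
  have sB: "span B = V" using B assms by (simp add: span_subspace)
  have sK: "span K = N" using K assms by (simp add: span_subspace)
  let ?M = "span (B - K)"
  have i: "independent (B - K)" using B(3) independent_mono by blast
  have 1: "?M \<subseteq> V" using sB span_mono[of "B - K" B] by auto
  have 2: "?M \<inter> N = {0}"
    using independent_Int_span[OF B(3,1)] sK span_zero by auto
  have "dim V = card B" using dim_eq_card[of B V] B sB by (metis span_span)
  moreover have "dim ?M = card (B - K)" using i by (rule dim_span_eq_card_independent)
  moreover have "card B = card K + card (B - K)"
    using fB B(1) by (metis card_Diff_subset card_mono le_add_diff_inverse finite_subset)
  ultimately have 3: "dim V = dim N + dim ?M" using K by simp
  have 4: "\<exists>y\<in>N. \<exists>z\<in>?M. x = y + z" if "x \<in> V" for x
  proof -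
    have "x \<in> span (K \<union> (B - K))" using that sB B(1) by (simp add: Un_absorb1)
    then show ?thesis unfolding span_Un sK by blast
  qed
  show thesis using that[of ?M] 1 2 3 4 by auto
qed

end

section \<open>Rank and nullity on a subspace\<close>

context vector_space_pair
begin

lemma subspace_kernel_on:
  assumes "Vector_Spaces.linear s1 s2 f" "vs1.subspace V"
  shows "vs1.subspace {x \<in> V. f x = 0}"
proof -
  interpret Vector_Spaces.linear s1 s2 f by fact
  show ?thesis using assms(2) unfolding vs1.subspace_def by (auto simp: add scale)
qed

lemma subspace_image_linear:
  assumes "Vector_Spaces.linear s1 s2 f" "vs1.subspace V"
  shows "vs2.subspace (f ` V)"
proof -
  interpret Vector_Spaces.linear s1 s2 f by fact
  show ?thesis using assms(2) by (rule subspace_image)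
qed

lemma fin_spanned_image:
  assumes "Vector_Spaces.linear s1 s2 f" "vs1.fin_spanned V"
  shows "vs2.fin_spanned (f ` V)"
proof -
  interpret Vector_Spaces.linear s1 s2 f by fact
  obtain F where F: "finite F" "V \<subseteq> vs1.span F"
    using assms(2) by (auto simp: vs1.fin_spanned_def)
  then have "f ` V \<subseteq> vs2.span (f ` F)" using span_image by blast
  then show ?thesis using F unfolding vs2.fin_spanned_def by blast
qed

lemma rank_nullity_on:
  assumes lin: "Vector_Spaces.linear s1 s2 f" and V: "vs1.subspace V" "vs1.fin_spanned V"
  shows "vs1.dim V = vs1.dim {x \<in> V. f x = 0} + vs2.dim (f ` V)"
proof -
  interpret Vector_Spaces.linear s1 s2 f by fact
  let ?N = "{x \<in> V. f x = 0}"
  obtain M where M: "vs1.subspace M" "M \<subseteq> V" "M \<inter> ?N = {0}" "vs1.dim V = vs1.dim ?N + vs1.dim M"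
    "\<And>x. x \<in> V \<Longrightarrow> \<exists>y\<in>?N. \<exists>z\<in>M. x = y + z"
    by (rule vs1.complement_of_subspace[OF V subspace_kernel_on[OF lin V(1)] Collect_restrict]) (rule that)
  obtain B where B: "B \<subseteq> M" "vs1.independent B" "M \<subseteq> vs1.span B" "card B = vs1.dim M" "finite B"
    using vs1.fin_spanned_basis vs1.fin_spanned_subset[OF V(2) M(2)] by metis
  have sB: "vs1.span B = M" using B M by (simp add: vs1.span_subspace)
  have inj: "inj_on f (vs1.span B)"
    unfolding sB linear_inj_on_iff_eq_0[OF lin M(1)] using M(2,3) by blast
  have ind: "vs2.independent (f ` B)" using B(2) inj by (rule independent_injective_image)
  have "f ` V \<subseteq> f ` M"
  proof
    fix w assume "w \<in> f ` V"
    then obtain y z where "y \<in> ?N" "z \<in> M" "w = f (y + z)" using M(5) by blast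
    then show "w \<in> f ` M" by (auto simp: add)
  qed
  then have "f ` V = f ` M" using M(2) by blast
  also have "\<dots> = vs2.span (f ` B)" using sB span_image by simp
  finally have "vs2.dim (f ` V) = card (f ` B)"
    using vs2.dim_span_eq_card_independent[OF ind] by simp
  also have "\<dots> = card B" using inj vs1.span_superset by (meson card_image inj_on_subset)
  finally show ?thesis using M(4) B(4) by simp
qed

lemma dim_image_inj_on:
  assumes "Vector_Spaces.linear s1 s2 f" "vs1.subspace V" "vs1.fin_spanned V" "\<And>x. x \<in> V \<Longrightarrow> f x = 0 \<Longrightarrow> x = 0"
  shows "vs2.dim (f ` V) = vs1.dim V"
proof -
  interpret Vector_Spaces.linear s1 s2 f by fact
  have "{x \<in> V. f x = 0} = {0}" using assms(2,4) vs1.subspace_0 by (auto simp: zero)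
  then show ?thesis using rank_nullity_on[OF assms(1-3)] by simp
qed

end

section \<open>Eigenvalues and pencils of linear maps\<close>

context vector_space
begin

text \<open>Eigenvectors of distinct eigenvalues are independent. \<open>Q\<close> is not assumed to
  preserve \<open>M\<close>: in the application it is a left inverse composed with another map, and
  only the eigenvectors inside \<open>M\<close> are counted.\<close>

lemma finite_eigenvalues_on:
  assumes lin: "Vector_Spaces.linear scale scale Q" and M: "fin_spanned M"
  shows "finite {c. \<exists>v\<in>M. v \<noteq> 0 \<and> Q v = scale c v}" (is "finite ?E")
proof -
  interpret Vector_Spaces.linear scale scale Q by fact
  define v where "v = (\<lambda>c. SOME v. v \<in> M \<and> v \<noteq> 0 \<and> Q v = scale c v)"
  have v: "v c \<in> M \<and> v c \<noteq> 0 \<and> Q (v c) = scale c (v c)" if "c \<in> ?E" for c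
  proof -
    from that have "\<exists>v. v \<in> M \<and> v \<noteq> 0 \<and> Q v = scale c v" by simp blast
    then show ?thesis unfolding v_def by (rule someI_ex)
  qed
  have indep: "\<forall>u. (\<Sum>c\<in>T. scale (u c) (v c)) = 0 \<longrightarrow> (\<forall>c\<in>T. u c = 0)"
    if "finite T" "T \<subseteq> ?E" for T
    using that
  proof (induction T rule: finite_induct)
    case (insert d T)
    show ?case
    proof (intro allI impI)
      fix u assume u: "(\<Sum>c\<in>insert d T. scale (u c) (v c)) = 0"
      have Qd: "Q (v d) = scale d (v d)" using v[of d] insert.prems by auto
      have QT: "Q (v c) = scale c (v c)" if "c \<in> T" for c
        using v[of c] insert.prems that by auto
      \<comment> \<open>Applying \<open>Q - d\<close> removes the eigenvector of \<open>d\<close>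
        and multiplies every other coefficient by \<open>c - d\<close>, which is non-zero.\<close>
      have "0 = Q (\<Sum>c\<in>insert d T. scale (u c) (v c)) - scale d (\<Sum>c\<in>insert d T. scale (u c) (v c))"
        by (simp add: u zero)
      also have "\<dots> = (\<Sum>c\<in>T. scale (u c) (Q (v c))) - (\<Sum>c\<in>T. scale (d * u c) (v c))"
        using insert.hyps Qd
        by (simp add: add sum scale scale_right_distrib scale_sum_right mult.commute)
      also have "\<dots> = (\<Sum>c\<in>T. scale (u c * (c - d)) (v c))"
        using QT by (simp add: sum_subtractf[symmetric] scale_left_diff_distrib[symmetric]
            right_diff_distrib mult.commute)
      finally have "\<forall>c\<in>T. u c * (c - d) = 0"
        using insert.IH[THEN spec, of "\<lambda>c. u c * (c - d)"] insert.prems by simp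
      then have T: "\<forall>c\<in>T. u c = 0" using insert.hyps by auto
      then have "scale (u d) (v d) = 0" using u insert.hyps by simp
      then have "u d = 0" using v[of d] insert.prems by auto
      then show "\<forall>c\<in>insert d T. u c = 0" using T by simp
    qed
  qed simp
  have inj: "inj_on v ?E"
  proof (rule inj_onI)
    fix c d assume cd: "c \<in> ?E" "d \<in> ?E" "v c = v d"
    have c: "v c \<noteq> 0" "Q (v c) = scale c (v c)" and d: "Q (v d) = scale d (v d)"
      using v[OF cd(1)] v[OF cd(2)] by blast+
    have "scale c (v c) = Q (v c)" using c(2) by (rule sym)
    also have "\<dots> = Q (v d)" by (rule arg_cong[OF cd(3)])
    also have "\<dots> = scale d (v d)" by (rule d)
    also have "\<dots> = scale d (v c)" by (rule arg_cong[OF cd(3)[symmetric]])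
    finally have "scale c (v c) = scale d (v c)" .
    then show "c = d" using c(1) scale_cancel_right by blast
  qed
  have bound: "card T \<le> dim M" if "finite T" "T \<subseteq> ?E" for T
  proof -
    have injT: "inj_on v T" using inj that(2) by (rule inj_on_subset)
    have "independent (v ` T)"
    proof (rule independent_if_scalars_zero)
      fix f x assume "(\<Sum>x\<in>v ` T. scale (f x) x) = 0" "x \<in> v ` T"
      then show "f x = 0"
        using indep[OF that, THEN spec, of "f \<circ> v"] injT by (auto simp: sum.reindex)
    qed (use that in simp)
    moreover have "v ` T \<subseteq> M"
    proof (rule image_subsetI)
      fix c assume "c \<in> T"
      then have "c \<in> ?E" using that(2) by (rule rev_subsetD)
      then show "v c \<in> M" by (rule v[THEN conjunct1])
    qed
    ultimately have "card (v ` T) \<le> dim M" by (rule card_le_dim_fin[OF M])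
    then show ?thesis using card_image[OF injT] by simp
  qed
  show ?thesis
  proof (rule ccontr)
    assume "infinite ?E"
    from infinite_arbitrarily_large[OF this, of "Suc (dim M)"]
    obtain T where T: "finite T \<and> card T = Suc (dim M) \<and> T \<subseteq> ?E" ..
    then have "card T \<le> dim M" by (intro bound) (elim conjE; assumption)+
    then show False using T[THEN conjunct2, THEN conjunct1] by simp
  qed
qed

end

context vector_space_pair
begin

lemma linear_pencil:
  assumes "Vector_Spaces.linear s1 s2 A" "Vector_Spaces.linear s1 s2 B"
  shows "Vector_Spaces.linear s1 s2 (\<lambda>x. A x + s2 t (B x))"
proof -
  interpret A: Vector_Spaces.linear s1 s2 A by fact
  interpret B: Vector_Spaces.linear s1 s2 B by fact
  show ?thesis
    unfolding Vector_Spaces.linear_iff using vs1.vector_space_axioms vs2.vector_space_axioms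
    by (simp add: A.add B.add A.scale B.scale vs2.scale_right_distrib mult.commute add_ac)
qed

text \<open>A left inverse \<open>P\<close> of \<open>A\<close> on \<open>M\<close> turns
  \<open>A x + t B x = 0\<close> into the eigenvalue equation \<open>P (B x) = - x / t\<close>. The
  case \<open>t = 0\<close> is excluded by injectivity of \<open>A\<close>.\<close>

lemma finite_noninjective_in_pencil:
  assumes A: "Vector_Spaces.linear s1 s2 A" and B: "Vector_Spaces.linear s1 s2 B"
    and M: "vs1.subspace M" "vs1.fin_spanned M" "\<And>x. x \<in> M \<Longrightarrow> A x = 0 \<Longrightarrow> x = 0"
  shows "finite {t. \<exists>x\<in>M. x \<noteq> 0 \<and> A x + s2 t (B x) = 0}" (is "finite ?S")
proof -
  interpret A: Vector_Spaces.linear s1 s2 A by fact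
  interpret p: vector_space_pair s2 s1 by unfold_locales
  have "inj_on A M" using linear_inj_on_iff_eq_0[OF A M(1)] M(3) by blast
  then obtain P where P: "Vector_Spaces.linear s2 s1 P" "\<And>v. v \<in> M \<Longrightarrow> P (A v) = v"
    using linear_exists_left_inverse_on[OF A M(1)] by blast
  interpret P: Vector_Spaces.linear s2 s1 P by fact
  have PB: "Vector_Spaces.linear s1 s1 (\<lambda>x. P (B x))"
    using Vector_Spaces.linear_compose[OF B P(1)] by (simp add: comp_def)
  let ?E = "{c. \<exists>v\<in>M. v \<noteq> 0 \<and> P (B v) = s1 c v}"
  have fin: "finite ?E" by (rule vs1.finite_eigenvalues_on[OF PB M(2)])
  have "?S \<subseteq> (\<lambda>c. - inverse c) ` ?E"
  proof
    fix t assume "t \<in> ?S"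
    then obtain x where x: "x \<in> M" "x \<noteq> 0" "A x + s2 t (B x) = 0" by blast
    have t0: "t \<noteq> 0" using x M(3) by auto
    have "P (A x + s2 t (B x)) = 0" using x(3) P.zero by simp
    then have "x + s1 t (P (B x)) = 0" by (simp add: P.add P.scale P(2)[OF x(1)])
    then have "s1 t (P (B x)) = - x" by (simp add: eq_neg_iff_add_eq_0 add.commute)
    then have "s1 (inverse t) (s1 t (P (B x))) = s1 (inverse t) (- x)" by simp
    then have "P (B x) = s1 (- inverse t) x" using t0 by simp
    then have "- inverse t \<in> ?E" using x by blast
    moreover have "t = - inverse (- inverse t)" using t0 by simp
    ultimately show "t \<in> (\<lambda>c. - inverse c) ` ?E" by blast
  qed
  then show ?thesis using fin finite_surj by blast
qed

text \<open>Semicontinuity of the rank along a line: \<open>A\<close> is injective on a complement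
  \<open>C\<close> of its kernel, and injectivity on \<open>C\<close> survives for all but finitely
  many \<open>t\<close>.\<close>

lemma finite_kernel_jump_in_pencil:
  assumes A: "Vector_Spaces.linear s1 s2 A" and B: "Vector_Spaces.linear s1 s2 B"
    and M: "vs1.subspace M" "vs1.fin_spanned M" and k: "vs1.dim {x\<in>M. A x = 0} \<le> k"
  shows "finite {t. \<not> vs1.dim {x\<in>M. A x + s2 t (B x) = 0} \<le> k}" (is "finite ?S")
proof -
  obtain C where C: "vs1.subspace C" "C \<subseteq> M" "C \<inter> {x\<in>M. A x = 0} = {0}"
    "vs1.dim M = vs1.dim {x\<in>M. A x = 0} + vs1.dim C"
    by (rule vs1.complement_of_subspace[OF M subspace_kernel_on[OF A M(1)] Collect_restrict]) (rule that)
  have fC: "vs1.fin_spanned C" using M(2) C(2) vs1.fin_spanned_subset by blast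
  let ?T = "{t. \<exists>x\<in>C. x \<noteq> 0 \<and> A x + s2 t (B x) = 0}"
  have "?S \<subseteq> ?T"
  proof (rule ccontr)
    assume "\<not> ?S \<subseteq> ?T"
    then obtain t where t: "\<not> vs1.dim {x\<in>M. A x + s2 t (B x) = 0} \<le> k"
      "\<And>x. x \<in> C \<Longrightarrow> A x + s2 t (B x) = 0 \<Longrightarrow> x = 0" by blast
    let ?f = "\<lambda>x. A x + s2 t (B x)"
    have f: "Vector_Spaces.linear s1 s2 ?f" using A B by (rule linear_pencil)
    have "vs1.dim C = vs2.dim (?f ` C)" using dim_image_inj_on[OF f C(1) fC t(2)] by simp
    also have "\<dots> \<le> vs2.dim (?f ` M)"
      by (rule vs2.dim_mono_fin[OF fin_spanned_image[OF f M(2)] image_mono[OF C(2)]])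
    finally show False using rank_nullity_on[OF f M] C(4) k t(1) by linarith
  qed
  moreover have "finite ?T"
    by (rule finite_noninjective_in_pencil[OF A B C(1) fC]) (use C(2,3) in blast)
  ultimately show ?thesis by (rule finite_subset)
qed

end


section \<open>Functionals and eigenvectors\<close>

lemma vector_space_field: "vector_space ((*) :: 'a::field \<Rightarrow> 'a \<Rightarrow> 'a)"
  by unfold_locales (auto simp: algebra_simps)

context vector_space
begin

lemma exists_separating_functional:
  assumes W: "subspace W" and x: "x \<notin> W"
  shows "\<exists>\<phi>. Vector_Spaces.linear scale (*) \<phi> \<and> (\<forall>w\<in>W. \<phi> w = 0) \<and> \<phi> x = 1"
proof -
  interpret F: vector_space "(*) :: 'a \<Rightarrow> 'a \<Rightarrow> 'a" by (rule vector_space_field)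
  interpret p: vector_space_pair scale "(*) :: 'a \<Rightarrow> 'a \<Rightarrow> 'a" by unfold_locales
  obtain B where B: "B \<subseteq> W" "independent B" "W \<subseteq> span B" "card B = dim W"
    by (rule basis_exists)
  have sB: "span B = W" using B(1,3) W by (simp add: span_subspace)
  have "independent (insert x B)" using B(2) x sB by (intro independent_insertI) auto
  from p.linear_independent_extend[OF this, of "\<lambda>b. if b = x then 1 else 0"]
  obtain g where g: "Vector_Spaces.linear scale (*) g"
    "\<And>b. b \<in> insert x B \<Longrightarrow> g b = (if b = x then 1 else 0)" by blast
  have "subspace {y \<in> UNIV. g y = 0}" by (rule p.subspace_kernel_on[OF g(1) subspace_UNIV])
  moreover have "B \<subseteq> {y \<in> UNIV. g y = 0}" using g(2) B(1) x by auto
  ultimately have "span B \<subseteq> {y \<in> UNIV. g y = 0}" by (intro span_minimal)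
  then have "\<forall>w\<in>W. g w = 0" using sB by auto
  moreover have "g x = 1" using g(2)[of x] by simp
  ultimately show ?thesis using g(1) by blast
qed

end

text \<open>The vectors \<open>u, A u, ..., A^N u\<close> are dependent in a space of dimension
  \<open>N\<close>. A relation of least degree has a root \<open>b\<close>, and its cofactor of
  \<open>X - b\<close>, evaluated at \<open>A\<close> and applied to \<open>u\<close>, is non-zero
  by minimality and is the eigenvector.\<close>

lemma exists_eigenvector:
  fixes scale :: "'a::alg_closed_field \<Rightarrow> 'b::ab_group_add \<Rightarrow> 'b"
  assumes vs: "vector_space scale" and A: "Vector_Spaces.linear scale scale A"
    and U: "module.subspace scale U" "vector_space.fin_spanned scale U" "U \<noteq> {0}" "A ` U \<subseteq> U"
  shows "\<exists>c. \<exists>u\<in>U. u \<noteq> 0 \<and> A u = scale c u"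
proof -
  interpret vector_space scale by fact
  interpret A: Vector_Spaces.linear scale scale A by fact
  interpret P: vector_space "smult :: 'a \<Rightarrow> 'a poly \<Rightarrow> 'a poly"
    by unfold_locales (auto simp: smult_add_right smult_add_left)
  interpret pr: vector_space_pair "smult :: 'a \<Rightarrow> 'a poly \<Rightarrow> 'a poly" scale
    by unfold_locales
  obtain u where u: "u \<in> U" "u \<noteq> 0" using U(1,3) subspace_0 by blast
  define w where "w i = (A ^^ i) u" for i
  have w: "w i \<in> U" for i
    by (induction i) (use u U(4) in \<open>auto simp: w_def\<close>)
  define N where "N = dim U"
  \<comment> \<open>For \<open>degree p \<le> N\<close> this is \<open>p(A) u\<close>; cutting the
    sum off at a fixed \<open>N\<close> makes linearity in \<open>p\<close> immediate.\<close>
  define ev where "ev p = (\<Sum>i\<le>N. scale (coeff p i) (w i))" for p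
  have evU: "ev p \<in> U" for p
    unfolding ev_def using w U(1) by (intro subspace_sum subspace_scale) auto
  have ev_lin: "Vector_Spaces.linear smult scale ev"
    unfolding Vector_Spaces.linear_iff using P.vector_space_axioms vs
    by (auto simp: ev_def scale_left_distrib sum.distrib scale_sum_right)
  interpret ev: Vector_Spaces.linear smult scale ev by (rule ev_lin)
  let ?M = "(\<lambda>i. monom (1::'a) i) ` {..N}"
  have inj: "inj_on (\<lambda>i. monom (1::'a) i) {..N}" by (auto simp: inj_on_def monom_eq_iff')
  have ind: "P.independent ?M"
  proof (rule P.independent_if_scalars_zero)
    fix f x assume *: "(\<Sum>x\<in>?M. smult (f x) x) = 0" "x \<in> ?M"
    then obtain j where j: "x = monom 1 j" "j \<le> N" by blast
    have "0 = coeff (\<Sum>x\<in>?M. smult (f x) x) j" using * by simp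
    also have "\<dots> = (\<Sum>i\<le>N. f (monom 1 i) * (if i = j then 1 else 0))"
      using inj by (simp add: sum.reindex coeff_sum)
    also have "\<dots> = f x" using j by (simp add: if_distrib cong: if_cong)
    finally show "f x = 0" by simp
  qed simp
  have "P.fin_spanned (P.span ?M)" unfolding P.fin_spanned_def by blast
  moreover have "P.dim (P.span ?M) = Suc N"
    using P.dim_span_eq_card_independent[OF ind] card_image[OF inj] by simp
  moreover have "dim (ev ` P.span ?M) \<le> N"
    unfolding N_def by (rule dim_mono_fin[OF U(2)]) (use evU in auto)
  ultimately have "\<not> (\<forall>p\<in>P.span ?M. ev p = 0 \<longrightarrow> p = 0)"
    using pr.dim_image_inj_on[OF ev_lin P.subspace_span, of ?M] by auto
  then obtain p0 where p0: "p0 \<in> P.span ?M" "ev p0 = 0" "p0 \<noteq> 0" by blast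
  have "P.subspace {p. degree p \<le> N}"
    unfolding P.subspace_def by (auto intro: degree_add_le order.trans[OF degree_smult_le])
  then have "P.span ?M \<subseteq> {p. degree p \<le> N}"
    by (rule P.span_minimal[rotated]) (auto simp: degree_monom_eq)
  then have deg0: "degree p0 \<le> N" using p0(1) by auto
  define Q where "Q p \<longleftrightarrow> p \<noteq> 0 \<and> degree p \<le> N \<and> ev p = 0" for p
  have "Q p0" using p0 deg0 by (simp add: Q_def)
  then obtain p where p: "Q p" and minp: "\<And>q. Q q \<Longrightarrow> degree p \<le> degree q"
    using ex_has_least_nat[of Q p0 degree] by blast
  have "degree p > 0"
  proof (rule ccontr)
    assume "\<not> degree p > 0"
    then obtain a where a: "p = [:a:]" "a \<noteq> 0"
      using p by (auto simp: Q_def elim: degree_eq_zeroE)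
    have "ev p = (\<Sum>i\<le>N. if i = 0 then scale a u else 0)"
      unfolding ev_def a(1) by (intro sum.cong) (auto simp: w_def coeff_pCons split: nat.splits)
    also have "\<dots> = scale a u" by simp
    finally show False using p a(2) u by (simp add: Q_def)
  qed
  then obtain b where "poly p b = 0" using alg_closed_imp_poly_has_root by blast
  then obtain q where q: "p = [:-b, 1:] * q" by (metis poly_eq_0_iff_dvd dvdE)
  have q0: "q \<noteq> 0" using p q by (auto simp: Q_def)
  have dq: "degree p = Suc (degree q)" unfolding q using q0 by (subst degree_mult_eq) auto
  then have nz: "ev q \<noteq> 0" using minp[of q] p q0 by (auto simp: Q_def)
  have dN: "degree q < N" using dq p by (simp add: Q_def)
  have "ev (pCons 0 q) = A (ev q)"
  proof -
    have "ev (pCons 0 q) = (\<Sum>i\<in>{1..N}. scale (coeff (pCons 0 q) i) (w i))"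
      unfolding ev_def by (rule sum.mono_neutral_right) (auto simp: coeff_pCons split: nat.splits)
    also have "\<dots> = (\<Sum>i<N. scale (coeff q i) (w (Suc i)))"
      by (rule sum.reindex_bij_witness[of _ Suc "\<lambda>i. i - 1"]) (auto simp: coeff_pCons split: nat.splits)
    also have "\<dots> = (\<Sum>i\<le>N. scale (coeff q i) (w (Suc i)))"
      by (rule sum.mono_neutral_left) (use dN in \<open>auto simp: coeff_eq_0\<close>)
    also have "\<dots> = A (ev q)"
      unfolding ev_def A.sum A.scale by (simp add: w_def)
    finally show ?thesis .
  qed
  moreover have "p = pCons 0 q + smult (- b) q" unfolding q by simp
  ultimately have "A (ev q) + scale (- b) (ev q) = 0"
    using p by (simp add: Q_def ev.diff ev.scale)
  then have "A (ev q) = scale b (ev q)" by (simp add: eq_neg_iff_add_eq_0)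
  then show ?thesis using nz evU by blast
qed

text \<open>A variant of a theorem of Laffey and Guralnick on commutators of rank one. A non-scalar \<open>A i\<close>
  becomes singular on \<open>U\<close> after subtracting an eigenvalue; then its image is stable under the whole
  family if it contains \<open>l\<close>, and its kernel is stable otherwise.\<close>

lemma common_eigenvector:
  fixes scale :: "'a::alg_closed_field \<Rightarrow> 'b::ab_group_add \<Rightarrow> 'b"
  assumes vs: "vector_space scale" and A: "\<And>i. Vector_Spaces.linear scale scale (A i)"
    and U: "module.subspace scale U" "vector_space.fin_spanned scale U" "U \<noteq> {0}"
      "\<And>i. A i ` U \<subseteq> U"
    and L: "\<And>i j u. u \<in> U \<Longrightarrow> A i (A j u) - A j (A i u) \<in> range (\<lambda>c. scale c l)"
  shows "\<exists>u\<in>U. u \<noteq> 0 \<and> (\<forall>i. \<exists>c. A i u = scale c u)"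
  using U L
proof (induction "vector_space.dim scale U" arbitrary: U rule: less_induct)
  case less
  interpret vector_space scale by fact
  interpret pp: vector_space_pair scale scale by unfold_locales
  note subU = less.prems(1) and fU = less.prems(2) and U0 = less.prems(3)
  have AU: "A i u \<in> U" if "u \<in> U" for i u using less.prems(4)[of i] that by blast
  note L = less.prems(5)
  show ?case
  proof (cases "\<forall>i. \<exists>c. \<forall>u\<in>U. A i u = scale c u")
    case True
    obtain u where "u \<in> U" "u \<noteq> 0" using subU U0 subspace_0 by blast
    with True show ?thesis by blast
  next
    case False
    then obtain i where i: "\<not> (\<exists>c. \<forall>u\<in>U. A i u = scale c u)" by blast
    obtain c v where v: "v \<in> U" "v \<noteq> 0" "A i v = scale c v"
      using exists_eigenvector[OF vs A subU fU U0 less.prems(4)] by blast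
    define T where "T x = A i x + scale (- c) x" for x
    have T: "Vector_Spaces.linear scale scale T"
      using pp.linear_pencil[OF A linear_id, of i "- c"] unfolding T_def id_apply .
    interpret T: Vector_Spaces.linear scale scale T by (rule T)
    let ?K = "{x \<in> U. T x = 0}" and ?I = "T ` U"
    have TU: "T x \<in> U" if "x \<in> U" for x
      unfolding T_def using AU that subU by (intro subspace_add subspace_scale) auto
    have K: "subspace ?K" by (rule pp.subspace_kernel_on[OF T subU])
    have I: "subspace ?I" by (rule pp.subspace_image_linear[OF T subU])
    have rn: "dim U = dim ?K + dim ?I" by (rule pp.rank_nullity_on[OF T subU fU])
    have fK: "fin_spanned ?K" by (rule fin_spanned_subset[OF fU]) auto
    have fI: "fin_spanned ?I" by (rule fin_spanned_subset[OF fU]) (use TU in auto)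
    have vK: "v \<in> ?K" using v by (simp add: T_def)
    have K0: "?K \<noteq> {0}" using vK v(2) by blast
    obtain x where x: "x \<in> U" "A i x \<noteq> scale c x" using i by blast
    have "T x \<noteq> 0" using x by (simp add: T_def add_eq_0_iff)
    then have I0: "?I \<noteq> {0}" using x(1) by blast
    have dK: "dim ?K > 0" using dim_0_iff_fin[OF K fK] K0 by blast
    have dI: "dim ?I > 0" using dim_0_iff_fin[OF I fI] I0 by blast
    have comm: "T (A j y) - A j (T y) \<in> range (\<lambda>c. scale c l)" if "y \<in> U" for j y
    proof -
      interpret Aj: Vector_Spaces.linear scale scale "A j" by (rule A)
      have "T (A j y) - A j (T y) = A i (A j y) - A j (A i y)"
        unfolding T_def by (simp add: Aj.diff Aj.scale)
      then show ?thesis using L[OF that] by simp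
    qed
    show ?thesis
    proof (cases "l \<in> ?I")
      case True
      have "A j ` ?I \<subseteq> ?I" for j
      proof
        fix z assume "z \<in> A j ` ?I"
        then obtain y where y: "y \<in> U" "z = A j (T y)" by blast
        obtain a where a: "T (A j y) - A j (T y) = scale a l" using comm[OF y(1)] by blast
        have "z = T (A j y) - scale a l" using a y(2) by (simp add: algebra_simps)
        moreover have "T (A j y) \<in> ?I" using AU[OF y(1)] by blast
        moreover have "scale a l \<in> ?I" using True I subspace_scale by blast
        ultimately show "z \<in> ?I" using I subspace_diff by metis
      qed
      moreover have "A i (A j u) - A j (A i u) \<in> range (\<lambda>c. scale c l)" if "u \<in> ?I" for i j u
        using that TU by (intro L) auto
      moreover have "dim ?I < dim U" using rn dK by simp
      ultimately have "\<exists>u\<in>?I. u \<noteq> 0 \<and> (\<forall>i. \<exists>c. A i u = scale c u)"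
        using I fI I0 by (intro less.hyps)
      then show ?thesis using TU by blast
    next
      case False
      have "A j ` ?K \<subseteq> ?K" for j
      proof
        fix z assume "z \<in> A j ` ?K"
        then obtain y where y: "y \<in> U" "T y = 0" "z = A j y" by blast
        obtain a where a: "T (A j y) - A j (T y) = scale a l" using comm[OF y(1)] by blast
        interpret Aj: Vector_Spaces.linear scale scale "A j" by (rule A)
        have a': "T z = scale a l" using a y by (simp add: Aj.zero)
        have "a = 0"
        proof (rule ccontr)
          assume "a \<noteq> 0"
          have "scale (inverse a) (T z) \<in> ?I"
            using I AU[OF y(1)] y(3) by (intro subspace_scale) auto
          then show False using a' \<open>a \<noteq> 0\<close> False by simp
        qed
        then show "z \<in> ?K" using a' AU[OF y(1)] y(3) by simp
      qed
      moreover have "A i (A j u) - A j (A i u) \<in> range (\<lambda>c. scale c l)" if "u \<in> ?K" for i j u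
        using that by (intro L) simp
      moreover have "dim ?K < dim U" using rn dI by simp
      ultimately have "\<exists>u\<in>?K. u \<noteq> 0 \<and> (\<forall>i. \<exists>c. A i u = scale c u)"
        using K fK K0 by (intro less.hyps)
      then show ?thesis by blast
    qed
  qed
qed

section \<open>Macaulay's and Green's numerical functions\<close>

definition bin_top :: "nat \<Rightarrow> nat \<Rightarrow> nat" where
  "bin_top n c = (GREATEST a. a choose n \<le> c)"

text \<open>Recursive forms of \<open>k\<^sup>\<langle>\<^sup>n\<^sup>\<rangle>\<close> and of Green's \<open>k\<^sub>\<langle>\<^sub>n\<^sub>\<rangle>\<close>, which unlike the
  binomial expansion are total: for \<open>n \<ge> 1\<close> and \<open>c = 0\<close> the top digit is \<open>n - 1\<close>.\<close>

fun mac_up :: "nat \<Rightarrow> nat \<Rightarrow> nat" where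
  "mac_up 0 c = 0"
| "mac_up (Suc 0) c = Suc c choose 2"
| "mac_up (Suc (Suc n)) c = (let a = bin_top (Suc (Suc n)) c in
     (Suc a choose Suc (Suc (Suc n))) + mac_up (Suc n) (c - (a choose Suc (Suc n))))"

fun green_low :: "nat \<Rightarrow> nat \<Rightarrow> nat" where
  "green_low 0 c = 0"
| "green_low (Suc 0) c = c - 1"
| "green_low (Suc (Suc n)) c = (let a = bin_top (Suc (Suc n)) c in
     ((a - 1) choose Suc (Suc n)) + green_low (Suc n) (c - (a choose Suc (Suc n))))"

lemma bin_top_eq:
  assumes "a choose n \<le> c" "c < Suc a choose n"
  shows "bin_top n c = a"
  unfolding bin_top_def
proof (rule Greatest_equality)
  fix y assume y: "y choose n \<le> c"
  show "y \<le> a"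
  proof (rule ccontr)
    assume "\<not> y \<le> a"
    then have "Suc a choose n \<le> y choose n" by (intro binomial_right_mono) simp
    then show False using y assms(2) by simp
  qed
qed (rule assms(1))

text \<open>One digit is split off. The bound \<open>d < a choose n\<close> makes \<open>a\<close>
  the top digit, and \<open>c = 0\<close> is covered by \<open>a = n\<close>, where
  \<open>n choose Suc n\<close> is 0.\<close>

lemma bin_decomposition:
  assumes "n \<ge> 1"
  obtains a d where "n \<le> a" "d < a choose n" "c = (a choose Suc n) + d"
proof (cases "c = 0")
  case True
  then show ?thesis using that[of n 0] by simp
next
  case False
  then obtain f j where fj: "binomial_expansion (Suc n) c f j"
    using binomial_expansion_exists[of c "Suc n"] by auto
  have b: "f (Suc n) choose Suc n \<le> c" "c < Suc (f (Suc n)) choose Suc n"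
    using binomial_expansion_bounds[OF fj] by auto
  have "Suc n \<le> f (Suc n)"
    using binomial_expansion_ge[OF fj] fj by (simp add: binomial_expansion_def)
  then show ?thesis using that[of "f (Suc n)" "c - (f (Suc n) choose Suc n)"] b by auto
qed

lemma mac_up_0 [simp]: "mac_up n 0 = 0"
proof (induction n)
  case (Suc n)
  show ?case
  proof (cases n)
    case (Suc m)
    have "bin_top (Suc (Suc m)) 0 = Suc m" by (rule bin_top_eq) simp_all
    then show ?thesis using \<open>mac_up n 0 = 0\<close> Suc by (simp add: Let_def)
  qed simp
qed simp

lemma green_low_0 [simp]: "green_low n 0 = 0"
proof (induction n)
  case (Suc n)
  show ?case
  proof (cases n)
    case (Suc m)
    have "bin_top (Suc (Suc m)) 0 = Suc m" by (rule bin_top_eq) simp_all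
    then show ?thesis using \<open>green_low n 0 = 0\<close> Suc by (simp add: Let_def)
  qed simp
qed simp

lemma mac_up_choose: "n \<ge> 1 \<Longrightarrow> mac_up n (a choose n) = Suc a choose Suc n"
proof (induction n rule: nat_induct_at_least)
  case (Suc n)
  then obtain m where m: "n = Suc m" by (cases n) auto
  show ?case
  proof (cases "a < n")
    case False
    then have "bin_top (Suc n) (a choose Suc n) = a"
      by (intro bin_top_eq) auto
    then show ?thesis using m by (simp add: Let_def)
  qed (use m in \<open>simp add: binomial_eq_0\<close>)
qed (auto simp: numeral_2_eq_2)

lemma green_low_choose: "n \<ge> 1 \<Longrightarrow> green_low n (a choose n) = (a - 1) choose n"
proof (induction n rule: nat_induct_at_least)
  case (Suc n)
  then obtain m where m: "n = Suc m" by (cases n) auto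
  show ?case
  proof (cases "a < n")
    case False
    then have "bin_top (Suc n) (a choose Suc n) = a"
      by (intro bin_top_eq) auto
    then show ?thesis using m by (simp add: Let_def)
  qed (use m in \<open>simp add: binomial_eq_0\<close>)
qed auto

lemma bin_top_decomposition:
  assumes "n \<ge> 1" "n \<le> a" "d < a choose n"
  shows "bin_top (Suc n) ((a choose Suc n) + d) = a"
  by (rule bin_top_eq) (use assms in auto)

text \<open>The boundary value \<open>d = a choose n\<close> is allowed: there the digits carry over.\<close>

lemma mac_up_decomposition:
  assumes "n \<ge> 1" "n \<le> a" "d \<le> a choose n"
  shows "mac_up (Suc n) ((a choose Suc n) + d) = (Suc a choose Suc (Suc n)) + mac_up n d"
proof (cases "d = a choose n")
  case True
  then have "(a choose Suc n) + d = Suc a choose Suc n" by simp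
  then have "mac_up (Suc n) ((a choose Suc n) + d) = Suc (Suc a) choose Suc (Suc n)"
    using mac_up_choose[of "Suc n" "Suc a"] by (simp only:)
  then show ?thesis using mac_up_choose[OF assms(1), of a] True by simp
next
  case False
  then have d: "d < a choose n" using assms by simp
  obtain m where "n = Suc m" using assms(1) by (cases n) auto
  then show ?thesis using bin_top_decomposition[OF assms(1,2) d] by (simp add: Let_def)
qed

lemma green_low_decomposition:
  assumes "n \<ge> 1" "n \<le> a" "d \<le> a choose n"
  shows "green_low (Suc n) ((a choose Suc n) + d) = ((a - 1) choose Suc n) + green_low n d"
proof (cases "d = a choose n")
  case True
  then have "(a choose Suc n) + d = Suc a choose Suc n" by simp
  then have "green_low (Suc n) ((a choose Suc n) + d) = a choose Suc n"
    using green_low_choose[of "Suc n" "Suc a"] by (simp only: diff_Suc_1)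
  moreover obtain b where "a = Suc b" using assms by (cases a) auto
  ultimately show ?thesis using green_low_choose[OF assms(1), of a] True by simp
next
  case False
  then have d: "d < a choose n" using assms by simp
  obtain m where "n = Suc m" using assms(1) by (cases n) auto
  then show ?thesis using bin_top_decomposition[OF assms(1,2) d] by (simp add: Let_def)
qed

text \<open>Since the decomposition holds up to and including \<open>d = a choose n\<close>, both
  \<open>c\<close> and \<open>Suc c\<close> can be split with the same digit \<open>a\<close>, and
  the claim passes to \<open>d\<close> without a case distinction on carries.\<close>

lemma green_low_Suc:
  "n \<ge> 1 \<Longrightarrow> green_low n c \<le> green_low n (Suc c) \<and> green_low n (Suc c) \<le> Suc (green_low n c)"
proof (induction n arbitrary: c rule: nat_induct_at_least)
  case (Suc n)
  obtain a d where ad: "n \<le> a" "d < a choose n" "c = (a choose Suc n) + d"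
    using bin_decomposition[OF Suc.hyps] by metis
  then have "Suc c = (a choose Suc n) + Suc d" by simp
  then show ?case
    using green_low_decomposition[OF Suc.hyps ad(1), of "Suc d"]
      green_low_decomposition[OF Suc.hyps ad(1), of d] ad(2,3) Suc.IH[of d]
    by (simp only: Suc_leI less_imp_le add_le_cancel_left add_less_cancel_left add_Suc_right[symmetric] simp_thms)
qed auto

lemma mac_up_Suc: "n \<ge> 1 \<Longrightarrow> mac_up n c < mac_up n (Suc c)"
proof (induction n arbitrary: c rule: nat_induct_at_least)
  case (Suc n)
  obtain a d where ad: "n \<le> a" "d < a choose n" "c = (a choose Suc n) + d"
    using bin_decomposition[OF Suc.hyps] by metis
  then have "Suc c = (a choose Suc n) + Suc d" by simp
  then show ?case
    using mac_up_decomposition[OF Suc.hyps ad(1), of "Suc d"]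
      mac_up_decomposition[OF Suc.hyps ad(1), of d] ad(2,3) Suc.IH[of d]
    by (simp only: Suc_leI less_imp_le add_le_cancel_left add_less_cancel_left add_Suc_right[symmetric] simp_thms)
qed (simp add: numeral_2_eq_2)

lemma green_low_mono: "n \<ge> 1 \<Longrightarrow> c \<le> c' \<Longrightarrow> green_low n c \<le> green_low n c'"
  using lift_Suc_mono_le[of "green_low n"] green_low_Suc by blast

lemma mac_up_strict_mono: "n \<ge> 1 \<Longrightarrow> c < c' \<Longrightarrow> mac_up n c < mac_up n c'"
  using lift_Suc_mono_less[of "mac_up n"] mac_up_Suc by blast

lemma mac_up_mono: "n \<ge> 1 \<Longrightarrow> c \<le> c' \<Longrightarrow> mac_up n c \<le> mac_up n c'"
  using mac_up_strict_mono[of n c c'] by (cases "c = c'") auto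

text \<open>\<open>green_low n\<close> climbs by at most one when its argument climbs by
  one.\<close>

lemma diff_green_low_mono:
  assumes "n \<ge> 1" "c \<le> c'"
  shows "c - green_low n c \<le> c' - green_low n c'"
proof (rule lift_Suc_mono_le[OF _ assms(2), of "\<lambda>c. c - green_low n c"])
  fix c
  show "c - green_low n c \<le> Suc c - green_low n (Suc c)"
    using green_low_Suc[OF assms(1), of c] by linarith
qed

lemma green_low_less: "n \<ge> 1 \<Longrightarrow> c > 0 \<Longrightarrow> green_low n c < c"
proof (induction n arbitrary: c rule: nat_induct_at_least)
  case (Suc n)
  obtain a d where ad: "n \<le> a" "d < a choose n" "c = (a choose Suc n) + d"
    using bin_decomposition[OF Suc.hyps] by metis
  have eq: "green_low (Suc n) c = ((a - 1) choose Suc n) + green_low n d"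
    unfolding ad(3) using green_low_decomposition[OF Suc.hyps ad(1)] ad(2) by simp
  show ?case
  proof (cases "d = 0")
    case True
    then have "a choose Suc n > 0" using Suc.prems ad(3) by simp
    then have "Suc n \<le> a" by (simp add: zero_less_binomial_iff)
    then obtain b where b: "a = Suc b" "n \<le> b" by (cases a) auto
    then have "b choose n > 0" by simp
    then show ?thesis using eq ad(3) True b by simp
  next
    case False
    then have "green_low n d < d" using Suc.IH by simp
    moreover have "(a - 1) choose Suc n \<le> a choose Suc n" by (intro binomial_right_mono) simp
    ultimately show ?thesis using eq ad(3) by simp
  qed
qed auto

lemma green_low_le: "n \<ge> 1 \<Longrightarrow> green_low n c \<le> c"
  using green_low_less[of n c] by (cases "c = 0") auto

text \<open>Digit by digit this is Pascal's rule
  \<open>Suc a choose Suc n = (a choose n) + (a choose Suc n)\<close>, because the digit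
  \<open>a\<close> of \<open>c\<close> becomes \<open>a - 1\<close> in \<open>green_low n c\<close>.
  It is the numerical counterpart of rank and nullity for a general linear form.\<close>

lemma mac_up_green_low: "n \<ge> 1 \<Longrightarrow> mac_up n c = c + mac_up n (green_low n c)"
proof (induction n arbitrary: c rule: nat_induct_at_least)
  case base
  show ?case by (cases c) (simp_all add: numeral_2_eq_2)
next
  case (Suc n)
  obtain a d where ad: "n \<le> a" "d < a choose n" "c = (a choose Suc n) + d"
    using bin_decomposition[OF Suc.hyps] by metis
  show ?case
  proof (cases "a = n")
    case True
    then show ?thesis using ad by (simp add: binomial_eq_0)
  next
    case False
    then obtain b where b: "a = Suc b" "n \<le> b" using ad(1) by (cases a) auto
    \<comment> \<open>The lowered remainder still fits below the lowered digit \<open>b\<close>, so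
      \<open>mac_up\<close> may be split there as well.\<close>
    have "green_low n d \<le> green_low n (a choose n)"
      using ad(2) Suc.hyps by (intro green_low_mono) auto
    then have le: "green_low n d \<le> b choose n" using green_low_choose[OF Suc.hyps] b by simp
    have l: "green_low (Suc n) c = (b choose Suc n) + green_low n d"
      unfolding ad(3) using green_low_decomposition[OF Suc.hyps ad(1)] ad(2) b by simp
    have "mac_up (Suc n) (green_low (Suc n) c) = (a choose Suc (Suc n)) + mac_up n (green_low n d)"
      unfolding l using mac_up_decomposition[OF Suc.hyps b(2) le] b by simp
    moreover have "mac_up (Suc n) c = (Suc a choose Suc (Suc n)) + mac_up n d"
      unfolding ad(3) using mac_up_decomposition[OF Suc.hyps ad(1)] ad(2) by simp
    ultimately show ?thesis using Suc.IH[of d] ad(3) by simp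
  qed
qed

text \<open>All digits equal their positions here, so each binomial becomes 0 when its digit is
  lowered.\<close>

lemma green_low_small: "n \<ge> 1 \<Longrightarrow> c \<le> n \<Longrightarrow> green_low n c = 0"
proof (induction n arbitrary: c rule: nat_induct_at_least)
  case (Suc n)
  show ?case
  proof (cases c)
    case (Suc e)
    then have "green_low (Suc n) ((Suc n choose Suc n) + e) = ((Suc n - 1) choose Suc n) + green_low n e"
      using Suc.prems Suc.hyps by (intro green_low_decomposition) auto
    then show ?thesis using Suc Suc.prems Suc.IH[of e] by simp
  qed simp
qed auto

lemma mac_up_small: "n \<ge> 1 \<Longrightarrow> c \<le> n \<Longrightarrow> mac_up n c = c"
  using mac_up_green_low[of n c] green_low_small[of n c] by simp

text \<open>The largest admissible \<open>y\<close> decides, by monotonicity. For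
  \<open>a = n\<close> and \<open>y = 0\<close> both sides would be 0, whence \<open>n < a\<close>.
  The strict inequality is what lowers the dimension bound by one with each section.\<close>

lemma green_low_less_choose:
  "n \<ge> 1 \<Longrightarrow> n < a \<Longrightarrow> y < a choose n \<Longrightarrow> green_low n y < (a - 1) choose n"
proof (induction n arbitrary: a y rule: nat_induct_at_least)
  case (Suc n)
  obtain b where b: "a = Suc b" "n < b" using Suc.prems by (cases a) auto
  have pos: "b choose n > 0" using b by simp
  have "y \<le> (b choose Suc n) + ((b choose n) - 1)" using Suc.prems(2) b pos by simp
  then have "green_low (Suc n) y \<le> green_low (Suc n) ((b choose Suc n) + ((b choose n) - 1))"
    by (intro green_low_mono) auto
  also have "\<dots> = ((b - 1) choose Suc n) + green_low n ((b choose n) - 1)"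
    using Suc.hyps b by (intro green_low_decomposition) auto
  also have "\<dots> < ((b - 1) choose Suc n) + ((b - 1) choose n)"
    using Suc.IH[of b "(b choose n) - 1"] b pos by simp
  also have "\<dots> = b choose Suc n" using b by (cases b) auto
  finally show ?case using b by simp
qed auto

text \<open>This says that the inequality of Green's argument fails at the first forbidden value
  \<open>x = Suc (green_low n c)\<close>. When the top digits are split off, the same binomial
  \<open>e choose n\<close> appears on both sides and cancels, leaving the claim for the remainder
  \<open>d\<close>; only \<open>d = 0\<close> has to be computed directly.\<close>

lemma green_low_diff_less:
  "n \<ge> 1 \<Longrightarrow> c \<ge> 1 \<Longrightarrow>
    green_low (n - 1) (c - green_low n c - 1) < Suc (green_low n c) - green_low n (Suc (green_low n c))"
proof (induction n arbitrary: c rule: nat_induct_at_least)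
  case (Suc n)
  obtain a d where ad: "n \<le> a" "d < a choose n" "c = (a choose Suc n) + d"
    using bin_decomposition[OF Suc.hyps] by metis
  have "a \<noteq> n" using ad Suc.prems by (auto simp: binomial_eq_0)
  then obtain b where b: "a = Suc b" "n \<le> b" using ad(1) by (cases a) auto
  obtain e where e: "b = Suc e" using b Suc.hyps by (cases b) auto
  have l: "green_low (Suc n) c = (b choose Suc n) + green_low n d"
    unfolding ad(3) using green_low_decomposition[OF Suc.hyps ad(1)] ad(2) b by simp
  have q: "c - green_low (Suc n) c = (b choose n) + (d - green_low n d)"
    using l ad(3) b green_low_le[OF Suc.hyps, of d] by simp
  have bpos: "b choose n > 0" using b by simp
  show ?case
  proof (cases "d = 0")
    case True
    have "green_low (Suc n) ((b choose Suc n) + 1) = ((b - 1) choose Suc n) + green_low n 1"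
      using Suc.hyps b(2) bpos by (intro green_low_decomposition) linarith+
    then have "green_low (Suc n) (Suc (b choose Suc n)) = (e choose Suc n)"
      using green_low_small[OF Suc.hyps, of 1] Suc.hyps e by simp
    then have "Suc (green_low (Suc n) c) - green_low (Suc n) (Suc (green_low (Suc n) c)) = Suc (e choose n)"
      using l True e by simp
    moreover have "green_low n ((b choose n) - 1) \<le> green_low n (b choose n)"
      using Suc.hyps by (intro green_low_mono) auto
    ultimately show ?thesis using q True green_low_choose[OF Suc.hyps, of b] e by simp
  next
    case False
    let ?z = "Suc (green_low n d)" and ?w = "d - green_low n d - 1"
    have z: "?z \<le> b choose n"
      using green_low_less_choose[OF Suc.hyps, of a d] ad b by simp
    have "green_low (Suc n) ((b choose Suc n) + ?z) = ((b - 1) choose Suc n) + green_low n ?z"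
      using Suc.hyps b z by (intro green_low_decomposition) auto
    moreover have zz: "green_low n ?z \<le> ?z" by (rule green_low_le[OF Suc.hyps])
    ultimately have R: "Suc (green_low (Suc n) c) - green_low (Suc n) (Suc (green_low (Suc n) c))
        = (e choose n) + (?z - green_low n ?z)"
      using l e by simp
    have dpos: "green_low n d < d" using green_low_less[OF Suc.hyps] False by simp
    have "green_low n ((b choose n) + ?w) = (e choose n) + green_low (n - 1) ?w"
    proof (cases "n = 1")
      case True
      then show ?thesis using e False by simp
    next
      case n: False
      then obtain m where m: "n = Suc m" "m \<ge> 1" using Suc.hyps by (cases n) auto
      have "d - green_low n d \<le> (a choose n) - green_low n (a choose n)"
        using ad(2) by (intro diff_green_low_mono[OF Suc.hyps]) simp
      also have "\<dots> = b choose m" using green_low_choose[OF Suc.hyps, of a] b m by simp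
      finally have "?w \<le> b choose m" by simp
      then show ?thesis using green_low_decomposition[of m b ?w] m b e by simp
    qed
    moreover have "c - green_low (Suc n) c - 1 = (b choose n) + ?w" using q dpos by simp
    moreover have "green_low (n - 1) ?w < ?z - green_low n ?z" using Suc.IH[of d] False by simp
    ultimately show ?thesis unfolding R diff_Suc_1 by (simp only: add_less_cancel_left)
  qed
qed auto

text \<open>The last hypothesis reads
  \<open>x - green_low (Suc n) x \<le> green_low n (c - x)\<close>. Its left side grows and its
  right side shrinks with \<open>x\<close>, so it is enough that it fails at
  \<open>Suc (green_low (Suc n) c)\<close>.\<close>

lemma le_green_low_if:
  assumes n: "n \<ge> 1" and "x \<le> c" and x: "x \<le> green_low n (c - x) + green_low (Suc n) x"
  shows "x \<le> green_low (Suc n) c"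
proof (rule ccontr)
  assume "\<not> x \<le> green_low (Suc n) c"
  then have gt: "Suc (green_low (Suc n) c) \<le> x" by simp
  then have "c \<ge> 1" using assms(2) by simp
  then have "green_low n (c - green_low (Suc n) c - 1)
      < Suc (green_low (Suc n) c) - green_low (Suc n) (Suc (green_low (Suc n) c))"
    using green_low_diff_less[of "Suc n" c] by simp
  also have "\<dots> \<le> x - green_low (Suc n) x" using gt by (intro diff_green_low_mono) auto
  finally have "green_low n (c - green_low (Suc n) c - 1) < x - green_low (Suc n) x" .
  moreover have "green_low n (c - x) \<le> green_low n (c - green_low (Suc n) c - 1)"
    using gt n by (intro green_low_mono) auto
  ultimately show False using x by simp
qed

section \<open>Comparison with the binomial expansion, and the range of MG-dimension at most
  one\<close>

lemma mac_up_binomial_expansion: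
  "n \<ge> 1 \<Longrightarrow> binomial_expansion n k c j \<Longrightarrow> mac_up n k = (\<Sum>l = j..n. Suc (c l) choose Suc l)"
proof (induction n arbitrary: k rule: nat_induct_at_least)
  case base
  then have "j = 1" "k = c 1" by (auto simp: binomial_expansion_def)
  then show ?case by (simp add: numeral_2_eq_2)
next
  case (Suc n)
  show ?case
  proof (cases "j \<le> n")
    case True
    note st = binomial_expansion_step[OF Suc.prems True]
    let ?k = "k - (c (Suc n) choose Suc n)"
    have "?k < Suc (c n) choose n" using binomial_expansion_bounds[OF st(1)] by simp
    also have "\<dots> \<le> c (Suc n) choose n" using st(3) by (intro binomial_right_mono) simp
    finally have "?k \<le> c (Suc n) choose n" by simp
    moreover have "n \<le> c (Suc n)" using binomial_expansion_ge[OF Suc.prems, of "Suc n"] True by simp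
    ultimately have "mac_up (Suc n) ((c (Suc n) choose Suc n) + ?k)
        = (Suc (c (Suc n)) choose Suc (Suc n)) + mac_up n ?k"
      using Suc.hyps by (intro mac_up_decomposition) auto
    then show ?thesis using Suc.IH[OF st(1)] st(2) True by (simp add: sum.cl_ivl_Suc)
  next
    case False
    then have "j = Suc n" "k = (c (Suc n) choose Suc n)"
      using Suc.prems by (auto simp: binomial_expansion_def)
    then show ?thesis using mac_up_choose[of "Suc n" "c (Suc n)"] by simp
  qed
qed

lemma macaulay_up_eq_mac_up:
  assumes "n \<ge> 1" "k \<ge> 1"
  shows "macaulay_up k n = mac_up n k"
proof -
  obtain c j where "binomial_expansion n k c j"
    using binomial_expansion_exists[of k n] assms by auto
  then show ?thesis using macaulay_up_eq mac_up_binomial_expansion[OF assms(1)] by metis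
qed

text \<open>For \<open>s + e \<le> n\<close>, the \<open>n\<close>-binomial expansion of \<open>stair n s + e\<close> has the digits \<open>l + 1\<close> for the
  top \<open>s\<close> values of \<open>l\<close> and \<open>l\<close> for the next \<open>e\<close> ones.\<close>

definition stair :: "nat \<Rightarrow> nat \<Rightarrow> nat" where
  "stair n s = (\<Sum>i<s. n + 1 - i)"

lemma stair_0 [simp]: "stair n 0 = 0"
  by (simp add: stair_def)

lemma stair_Suc_Suc: "stair (Suc n) (Suc s) = n + 2 + stair n s"
  unfolding stair_def by (subst sum.lessThan_Suc_shift) simp

lemma choose_Suc_Suc_2: "Suc (Suc n) choose n = (n + 2) choose 2"
  using binomial_symmetric[of n "Suc (Suc n)"] by simp

lemma stair_less: "s + e \<le> n \<Longrightarrow> stair n s + e < (n + 2) choose 2"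
proof (induction n arbitrary: s)
  case (Suc n)
  show ?case
  proof (cases s)
    case 0
    then show ?thesis using Suc.prems by (simp add: numeral_2_eq_2)
  next
    case (Suc r)
    then have "stair n r + e < (n + 2) choose 2" using Suc.prems Suc.IH by simp
    then show ?thesis using Suc by (simp add: stair_Suc_Suc numeral_2_eq_2)
  qed
qed (simp add: numeral_2_eq_2)

text \<open>After lowering, each of the \<open>s\<close> digits \<open>l + 1\<close> contributes
  \<open>l choose l = 1\<close>, and the \<open>e\<close> digits \<open>l\<close> contribute
  nothing.\<close>

lemma green_low_stair: "n \<ge> 1 \<Longrightarrow> s + e \<le> n \<Longrightarrow> green_low n (stair n s + e) = s"
proof (induction n arbitrary: s rule: nat_induct_at_least)
  case base
  then consider "s = 0" "e \<le> 1" | "s = 1" "e = 0" by linarith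
  then show ?case by cases (auto simp: stair_def)
next
  case (Suc n)
  show ?case
  proof (cases s)
    case 0
    then show ?thesis using green_low_small[of "Suc n" e] Suc.prems by simp
  next
    case (Suc r)
    then have r: "r + e \<le> n" using Suc.prems by simp
    have "stair n r + e \<le> Suc (Suc n) choose n"
      using stair_less[OF r] choose_Suc_Suc_2[of n] by simp
    then have "green_low (Suc n) ((Suc (Suc n) choose Suc n) + (stair n r + e))
        = ((Suc (Suc n) - 1) choose Suc n) + green_low n (stair n r + e)"
      using Suc.hyps by (intro green_low_decomposition) auto
    moreover have "Suc (Suc n) choose Suc n = n + 2"
      using binomial_symmetric[of "Suc n" "Suc (Suc n)"] by simp
    ultimately show ?thesis using Suc Suc.IH[OF r] by (simp add: stair_Suc_Suc add.assoc)
  qed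
qed

lemma mac_up_stair: "n \<ge> 1 \<Longrightarrow> s + e \<le> n \<Longrightarrow> mac_up n (stair n s + e) = stair n s + e + s"
  using mac_up_green_low[of n "stair n s + e"] green_low_stair[of n s e] mac_up_small[of n s] by simp

text \<open>Below \<open>(n + 2) choose 2\<close> the top digit is at most \<open>n + 1\<close>, so
  every digit exceeds its position by at most one.\<close>

lemma stair_exists: "c < (n + 2) choose 2 \<Longrightarrow> \<exists>s e. s + e \<le> n \<and> c = stair n s + e"
proof (induction n arbitrary: c)
  case 0
  then show ?case by (intro exI[of _ 0]) (simp add: numeral_2_eq_2)
next
  case (Suc n)
  show ?case
  proof (cases "c \<le> Suc n")
    case True
    then show ?thesis by (intro exI[of _ 0] exI[of _ c]) simp
  next
    case False
    then have "c - (n + 2) < (n + 2) choose 2" using Suc.prems by (simp add: numeral_2_eq_2)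
    then obtain s e where "s + e \<le> n" "c - (n + 2) = stair n s + e" using Suc.IH by blast
    then show ?thesis using False by (intro exI[of _ "Suc s"] exI[of _ e]) (simp add: stair_Suc_Suc)
  qed
qed

text \<open>Each of the \<open>s\<close> summands drops by one. This accounts for the loss of
  \<open>s\<close> dimensions when \<open>\<Lambda>\<close> is replaced by
  \<open>l \<Lambda>\<close> one degree lower.\<close>

lemma stair_pred: "s \<le> Suc n \<Longrightarrow> stair (Suc n) s = stair n s + s"
proof (induction s)
  case (Suc s)
  have "stair (Suc n) (Suc s) = stair (Suc n) s + (n + 2 - s)"
    "stair n (Suc s) = stair n s + (n + 1 - s)" by (simp_all add: stair_def)
  then show ?case using Suc by simp
qed simp

lemma stair_Suc: "stair n (Suc s) = stair n s + (n + 1 - s)"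
  by (simp add: stair_def)

lemma stair_full: "stair n (Suc n) = (n + 2) choose 2"
proof (induction n)
  case 0
  show ?case by (simp add: stair_def numeral_2_eq_2)
next
  case (Suc n)
  then show ?case by (simp add: stair_Suc_Suc numeral_2_eq_2)
qed

section \<open>Inverse systems\<close>

abbreviation lookup where "lookup \<equiv> Poly_Mapping.lookup"
abbreviation keys where "keys \<equiv> Poly_Mapping.keys"
abbreviation single where "single \<equiv> Poly_Mapping.single"

section \<open>Contraction of functionals by polynomials\<close>

type_synonym ('v, 'k) dual = "('v \<Rightarrow>\<^sub>0 nat) \<Rightarrow> 'k"

definition sc :: "'k::field \<Rightarrow> ('a \<Rightarrow> 'k) \<Rightarrow> ('a \<Rightarrow> 'k)" where
  "sc c f = (\<lambda>x. c * f x)"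

definition psc :: "'k::field \<Rightarrow> ('v::finite, 'k) mpolys \<Rightarrow> ('v, 'k) mpolys" where
  "psc c f = single 0 c * f"

interpretation fv: vector_space sc
  by unfold_locales (auto simp: sc_def fun_eq_iff algebra_simps)

interpretation pv: vector_space psc
  by unfold_locales (auto simp: psc_def algebra_simps single_add mult_single)

interpretation fp: vector_space_pair sc sc by unfold_locales

lemma mpolys_eq_sum_single:
  fixes f :: "'a \<Rightarrow>\<^sub>0 'k::comm_monoid_add"
  shows "f = (\<Sum>u\<in>keys f. single u (lookup f u))"
  by (rule poly_mapping_eqI) (auto simp: lookup_sum lookup_single when_def in_keys_iff sum.delta)

lemma mpolys_induct [case_names single add]:
  fixes f :: "'a \<Rightarrow>\<^sub>0 'k::comm_monoid_add"
  assumes s: "\<And>u c. P (single u c)" and a: "\<And>f g. P f \<Longrightarrow> P g \<Longrightarrow> P (f + g)"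
  shows "P f"
proof -
  have "P (\<Sum>u\<in>A. single u (c u))" if "finite A" for A and c :: "'a \<Rightarrow> 'k"
    using that
  proof induction
    case empty
    then show ?case using s[of undefined 0] by simp
  qed (simp add: s a)
  then show ?thesis by (subst mpolys_eq_sum_single) simp
qed

lemma lookup_psc: "lookup (psc c f) u = c * lookup f u"
proof (induction f rule: mpolys_induct)
  case (single u' a)
  then show ?case by (simp add: psc_def mult_single lookup_single when_def)
next
  case (add f g)
  then show ?case by (simp add: psc_def algebra_simps lookup_add)
qed

text \<open>A function \<open>L\<close> on monomials stands for the linear functional on polynomials with these values;
  \<open>act f L\<close> is the functional \<open>g \<mapsto> L (f * g)\<close>, so \<open>act f L 0\<close> is the value of \<open>L\<close> at \<open>f\<close>.\<close>

definition act :: "('v::finite, 'k::field) mpolys \<Rightarrow> (('v \<Rightarrow>\<^sub>0 nat) \<Rightarrow> 'k) \<Rightarrow> ('v \<Rightarrow>\<^sub>0 nat) \<Rightarrow> 'k" where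
  "act f L = (\<lambda>m. \<Sum>u\<in>keys f. lookup f u * L (u + m))"

lemma act_superset:
  assumes "finite A" "keys f \<subseteq> A"
  shows "act f L m = (\<Sum>u\<in>A. lookup f u * L (u + m))"
  unfolding act_def using assms by (intro sum.mono_neutral_left) (auto simp: in_keys_iff)

lemma act_add_left: "act (f + g) L = act f L + act g L"
proof
  fix m
  let ?A = "keys f \<union> keys g"
  have "act h L m = (\<Sum>u\<in>?A. lookup h u * L (u + m))" if "h \<in> {f, g, f + g}" for h
    using that keys_add[of f g] by (intro act_superset) auto
  then show "act (f + g) L m = (act f L + act g L) m"
    by (simp add: lookup_add sum.distrib algebra_simps)
qed

lemma act_single: "act (single u c) L = (\<lambda>m. c * L (u + m))"
  by (auto simp: act_def fun_eq_iff)

lemma act_0_left [simp]: "act 0 L = 0"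
  by (auto simp: act_def fun_eq_iff)

lemma act_1_left [simp]: "act 1 L = L"
  using act_single[of 0 1 L] by simp

lemma act_add_right: "act f (L + M) = act f L + act f M"
  by (auto simp: act_def fun_eq_iff algebra_simps sum.distrib)

lemma act_sc_right: "act f (sc c L) = sc c (act f L)"
  by (auto simp: act_def sc_def fun_eq_iff algebra_simps sum_distrib_left)

lemma act_linear: "Vector_Spaces.linear sc sc (act f)"
  unfolding Vector_Spaces.linear_iff using fv.vector_space_axioms act_add_right act_sc_right by blast

interpretation act: Vector_Spaces.linear sc sc "act f" for f by (rule act_linear)

lemma act_mult: "act (f * g) L = act f (act g L)"
proof (induction f rule: mpolys_induct)
  case (single u c)
  show ?case
  proof (induction g rule: mpolys_induct)
    case (single w d)
    show ?case by (simp add: mult_single act_single fun_eq_iff algebra_simps)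
  next
    case (add f g)
    then show ?case by (simp only: distrib_left act_add_left act_add_right)
  qed
next
  case (add f g)
  then show ?case by (simp add: distrib_right act_add_left)
qed

lemma act_commute: "act f (act g L) = act g (act f L)"
  by (metis act_mult mult.commute)

lemma act_psc: "act (psc c f) L = sc c (act f L)"
  by (simp add: psc_def act_mult act_single sc_def)

lemma act_minus_left: "act (- f) L = - act f L"
  by (auto simp: act_def fun_eq_iff sum_negf)

lemma act_diff_left: "act (f - g) L = act f L - act g L"
  using act_add_left[of f "- g" L] by (simp add: act_minus_left)

section \<open>Graded pieces and their duals\<close>

lemma mon_degree_add: "mon_degree (m + m') = mon_degree m + mon_degree m'"
  by (simp add: mon_degree_def lookup_add sum.distrib)

lemma mon_degree_0 [simp]: "mon_degree 0 = 0"
  by (simp add: mon_degree_def)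

lemma mon_degree_eq_0 [simp]: "mon_degree m = 0 \<longleftrightarrow> m = 0"
  by (auto simp: mon_degree_def intro!: poly_mapping_eqI)

lemma mon_degree_single [simp]: "mon_degree (single v c) = c"
  by (simp add: mon_degree_def lookup_single when_def)

lemma mon_degree_Suc:
  assumes "mon_degree m = Suc t"
  obtains v m' where "m = single v 1 + m'" "mon_degree m' = t"
proof -
  have "\<exists>v. lookup m v \<noteq> 0"
    using assms by (auto simp: mon_degree_def intro: ccontr)
  then obtain v where v: "lookup m v \<noteq> 0" ..
  have m: "m = single v 1 + (m - single v 1)"
    by (rule poly_mapping_eqI) (use v in \<open>auto simp: lookup_add lookup_minus lookup_single when_def\<close>)
  have "mon_degree (m - single v 1) = t"
    using assms by (subst (asm) m) (simp add: mon_degree_add)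
  then show ?thesis using that m by blast
qed

definition monomials :: "nat \<Rightarrow> ('v::finite \<Rightarrow>\<^sub>0 nat) set" where
  "monomials t = {m. mon_degree m = t}"

lemma finite_monomials [simp]: "finite (monomials t :: ('v::finite \<Rightarrow>\<^sub>0 nat) set)"
proof -
  have "lookup m \<in> PiE UNIV (\<lambda>_. {..t})" if "m \<in> monomials t" for m :: "'v \<Rightarrow>\<^sub>0 nat"
    using that member_le_sum[of _ UNIV "lookup m"] by (auto simp: monomials_def mon_degree_def)
  then have "lookup ` (monomials t :: ('v \<Rightarrow>\<^sub>0 nat) set) \<subseteq> PiE UNIV (\<lambda>_. {..t})"
    by blast
  then have "finite (lookup ` (monomials t :: ('v \<Rightarrow>\<^sub>0 nat) set))"
    by (rule finite_subset) (simp add: finite_PiE)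
  then have "finite (monomials t :: ('v \<Rightarrow>\<^sub>0 nat) set)"
    by (rule finite_imageD) (auto simp: inj_on_def lookup_inject)
  then show ?thesis .
qed

definition dual_forms :: "nat \<Rightarrow> ('v::finite, 'k::field) dual set" where
  "dual_forms t = {L. \<forall>m. mon_degree m \<noteq> t \<longrightarrow> L m = 0}"

definition delta :: "'a \<Rightarrow> 'a \<Rightarrow> 'k::field" where
  "delta u = (\<lambda>m. if m = u then 1 else 0)"

lemma sum_fun_apply: "(\<Sum>i\<in>A. f i) x = (\<Sum>i\<in>A. f i x)"
  by (induction A rule: infinite_finite_induct) auto

lemma dual_forms_eq_sum_delta:
  assumes "L \<in> dual_forms t"
  shows "L = (\<Sum>u\<in>monomials t. sc (L u) (delta u))"
proof
  fix m
  have "(\<Sum>u\<in>monomials t. sc (L u) (delta u)) m = (\<Sum>u\<in>monomials t. if m = u then L u else 0)"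
    unfolding sum_fun_apply by (rule sum.cong) (auto simp: sc_def delta_def)
  also have "\<dots> = (if m \<in> monomials t then L m else 0)"
    by (rule sum.delta') simp
  also have "\<dots> = L m" using assms by (auto simp: dual_forms_def monomials_def)
  finally show "L m = (\<Sum>u\<in>monomials t. sc (L u) (delta u)) m" ..
qed

lemma subspace_dual_forms: "fv.subspace (dual_forms t)"
  by (auto simp: fv.subspace_def dual_forms_def sc_def)

lemma fin_spanned_dual_forms: "fv.fin_spanned (dual_forms t)"
proof -
  have "L \<in> fv.span (delta ` monomials t)" if "L \<in> dual_forms t" for L :: "('v::finite \<Rightarrow>\<^sub>0 nat) \<Rightarrow> 'k::field"
    by (subst dual_forms_eq_sum_delta[OF that]) (intro fv.span_sum fv.span_scale fv.span_base imageI)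
  then show ?thesis unfolding fv.fin_spanned_def by (metis finite_imageI finite_monomials subsetI)
qed

lemma act_dual_forms:
  assumes "f \<in> forms s" "L \<in> dual_forms (s + t)"
  shows "act f L \<in> dual_forms t"
  using assms by (auto simp: act_def dual_forms_def forms_def mon_degree_add intro!: sum.neutral)

lemma act_dual_forms_eq_0:
  assumes "f \<in> forms s" "L \<in> dual_forms t" "t < s"
  shows "act f L = 0"
  using assms
  by (auto simp: fun_eq_iff act_def dual_forms_def forms_def mon_degree_add intro!: sum.neutral)

definition lin :: "('v::finite \<Rightarrow> 'k::field) \<Rightarrow> ('v, 'k) mpolys" where
  "lin a = (\<Sum>v\<in>UNIV. single (single v 1) (a v))"

definition var :: "'v::finite \<Rightarrow> ('v, 'k::field) mpolys" where
  "var v = single (single v 1) 1"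

lemma forms_0 [simp]: "0 \<in> forms t"
  by (simp add: forms_def)

lemma forms_add: "f \<in> forms t \<Longrightarrow> g \<in> forms t \<Longrightarrow> f + g \<in> forms t"
  using keys_add[of f g] by (auto simp: forms_def)

lemma forms_sum: "(\<And>i. i \<in> A \<Longrightarrow> f i \<in> forms t) \<Longrightarrow> sum f A \<in> forms t"
  by (induction A rule: infinite_finite_induct) (auto intro: forms_add)

lemma forms_single: "mon_degree m = t \<Longrightarrow> single m c \<in> forms t"
  by (auto simp: forms_def)

lemma forms_psc: "f \<in> forms t \<Longrightarrow> psc c f \<in> forms t"
  by (auto simp: forms_def in_keys_iff lookup_psc)

lemma subspace_forms: "pv.subspace (forms t)"
  by (auto simp: pv.subspace_def forms_add forms_psc)

lemma forms_lin: "lin a \<in> forms 1"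
  unfolding lin_def by (intro forms_sum forms_single) simp

lemma forms_var: "var v \<in> forms 1"
  unfolding var_def by (intro forms_single) simp

lemma lin_add: "lin (a + b) = lin a + lin b"
  by (simp add: lin_def single_add sum.distrib)

lemma lin_sc: "lin (sc c a) = psc c (lin a)"
  by (simp add: lin_def psc_def sc_def sum_distrib_left mult_single)

lemma lin_eq_sum_var: "lin a = (\<Sum>v\<in>UNIV. psc (a v) (var v))"
  by (simp add: lin_def psc_def var_def mult_single)

lemma act_sum_left: "act (\<Sum>i\<in>A. f i) L = (\<Sum>i\<in>A. act (f i) L)"
  by (induction A rule: infinite_finite_induct) (auto simp: act_add_left)

lemma act_lin: "act (lin a) L = (\<Sum>v\<in>UNIV. sc (a v) (act (var v) L))"
  by (simp add: lin_eq_sum_var act_sum_left act_psc)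

lemma act_var: "act (var v) L m = L (single v 1 + m)"
  by (simp add: var_def act_single)

lemma act_lin_pencil: "act (lin (a + sc t b)) L = act (lin a) L + sc t (act (lin b) L)"
  by (simp add: lin_add lin_sc act_add_left act_psc)

lemma act_lin_dual_forms: "L \<in> dual_forms (Suc t) \<Longrightarrow> act (lin a) L \<in> dual_forms t"
  using act_dual_forms[OF forms_lin, of L t a] by simp

lemma act_var_dual_forms: "L \<in> dual_forms (Suc t) \<Longrightarrow> act (var v) L \<in> dual_forms t"
  using act_dual_forms[OF forms_var, of L t v] by simp

text \<open>Every monomial of positive degree is a variable times a monomial. In degree 0 the claim
  is false, as variables kill all functionals of degree 0; hence the conditions
  \<open>n \<ge> 1\<close> later on.\<close>

lemma dual_forms_Suc_eq_0:
  assumes "L \<in> dual_forms (Suc t)" "\<And>v. act (var v) L = 0"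
  shows "L = 0"
proof
  fix m
  show "L m = 0 m"
  proof (cases "mon_degree m = Suc t")
    case True
    then obtain v m' where m: "m = single v 1 + m'" by (rule mon_degree_Suc)
    have "act (var v) L m' = 0" using assms(2) by simp
    then show ?thesis by (simp add: act_var m)
  next
    case False
    then show ?thesis using assms(1) by (simp add: dual_forms_def)
  qed
qed

lemma forms_1_eq_lin:
  assumes "f \<in> forms 1"
  shows "f = lin (\<lambda>v. lookup f (single v 1))"
proof (rule poly_mapping_eqI)
  fix m
  show "lookup f m
      = lookup (lin (\<lambda>v. lookup f (single v 1))) m"
  proof (cases "mon_degree m = 1")
    case True
    then obtain v m' where m: "m = single v 1 + m'" "mon_degree m' = 0"
      by (metis One_nat_def mon_degree_Suc)
    then have m': "m = single v 1" by simp
    have "single w (1::nat) = single v 1 \<longleftrightarrow> w = v" for w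
      by (metis lookup_single_eq lookup_single_not_eq zero_neq_one)
    then show ?thesis by (simp add: lin_def lookup_sum lookup_single when_def m')
  next
    case False
    then have "m \<notin> keys f" "m \<notin> keys (lin a)" for a :: "'a \<Rightarrow> 'b"
      using assms forms_lin[of a] by (auto simp: forms_def)
    then show ?thesis by (simp add: in_keys_iff)
  qed
qed

lemma act_dual_forms_same:
  assumes "f \<in> forms t" "L \<in> dual_forms t"
  shows "act f L = 0 \<longleftrightarrow> act f L 0 = 0"
proof
  assume 0: "act f L 0 = 0"
  have d: "act f L \<in> dual_forms 0" using act_dual_forms[of f t L 0] assms by simp
  show "act f L = 0"
  proof
    fix m show "act f L m = 0 m"
      using d 0 by (cases "m = 0") (auto simp: dual_forms_def)
  qed
qed simp

section \<open>Duality between forms and functionals\<close>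

lemma separate_form:
  assumes W: "pv.subspace W" and f: "f \<in> forms t" "f \<notin> W"
  shows "\<exists>L\<in>dual_forms t. (\<forall>g\<in>W \<inter> forms t. act g L = 0) \<and> act f L \<noteq> 0"
proof -
  obtain \<phi> where \<phi>: "Vector_Spaces.linear psc (*) \<phi>" "\<forall>w\<in>W. \<phi> w = 0" "\<phi> f = 1"
    using pv.exists_separating_functional[OF W f(2)] by blast
  interpret Vector_Spaces.linear psc "(*)" \<phi> by fact
  define L where "L m = (if mon_degree m = t then \<phi> (single m 1) else 0)" for m
  have L: "L \<in> dual_forms t" by (simp add: L_def dual_forms_def)
  have ev: "act g L 0 = \<phi> g" if "g \<in> forms t" for g
  proof -
    have "\<phi> g = \<phi> (\<Sum>u\<in>keys g. psc (lookup g u) (single u 1))"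
      by (subst mpolys_eq_sum_single[of g]) (simp add: psc_def mult_single)
    also have "\<dots> = (\<Sum>u\<in>keys g. lookup g u * \<phi> (single u 1))"
      by (simp add: sum scale)
    also have "\<dots> = act g L 0"
      unfolding act_def by (rule sum.cong) (use that in \<open>auto simp: L_def forms_def\<close>)
    finally show ?thesis by simp
  qed
  have "act g L = 0" if "g \<in> W \<inter> forms t" for g
    using that ev[of g] \<phi>(2) act_dual_forms_same[of g t L] L by auto
  moreover have "act f L \<noteq> 0" using ev[OF f(1)] \<phi>(3) by auto
  ultimately show ?thesis using L by blast
qed

text \<open>Finite-dimensional biduality: a functional \<open>\<phi>\<close> on
  \<open>dual_forms t\<close> is evaluation at the form with coefficients
  \<open>\<phi> (delta m)\<close>.\<close>

lemma separate_dual_form: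
  assumes M: "fv.subspace M" "M \<subseteq> dual_forms t" and L: "L \<in> dual_forms t" "L \<notin> M"
  shows "\<exists>g\<in>forms t. (\<forall>L'\<in>M. act g L' = 0) \<and> act g L 0 = 1"
proof -
  obtain \<phi> where \<phi>: "Vector_Spaces.linear sc (*) \<phi>" "\<forall>w\<in>M. \<phi> w = 0" "\<phi> L = 1"
    using fv.exists_separating_functional[OF M(1) L(2)] by blast
  interpret Vector_Spaces.linear sc "(*)" \<phi> by fact
  define g where "g = (\<Sum>m\<in>monomials t. single m (\<phi> (delta m)))"
  have g: "g \<in> forms t"
    unfolding g_def by (intro forms_sum forms_single) (simp add: monomials_def)
  have ev: "act g K 0 = \<phi> K" if "K \<in> dual_forms t" for K
  proof -
    have "\<phi> K = \<phi> (\<Sum>u\<in>monomials t. sc (K u) (delta u))"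
      using dual_forms_eq_sum_delta[OF that] by simp
    also have "\<dots> = (\<Sum>u\<in>monomials t. K u * \<phi> (delta u))" by (simp add: sum scale)
    also have "\<dots> = act g K 0"
      by (simp add: g_def act_sum_left sum_fun_apply act_single mult.commute)
    finally show ?thesis by simp
  qed
  have "act g K = 0" if "K \<in> M" for K
    using that ev[of K] \<phi>(2) act_dual_forms_same[OF g, of K] M(2) by auto
  then show ?thesis using g ev[OF L(1)] \<phi>(3) by auto
qed

text \<open>The whole contraction \<open>act g L\<close> has to vanish, not only the value of
  \<open>L\<close> at \<open>g\<close>. This makes the space dual to the degree \<open>t\<close>
  part of \<open>S\<close> modulo the ideal generated by \<open>G\<close>.\<close>

definition perp :: "('v::finite, 'k::field) mpolys set \<Rightarrow> nat \<Rightarrow> ('v, 'k) dual set" where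
  "perp G t = {L \<in> dual_forms t. \<forall>g\<in>G. act g L = 0}"

definition hdim :: "('v::finite, 'k::field) mpolys set \<Rightarrow> nat \<Rightarrow> nat" where
  "hdim G t = fv.dim (perp G t)"

text \<open>For a subspace of \<open>dual_forms n\<close> this is dual to degree
  \<open>n + 1\<close> of \<open>S\<close> modulo the ideal generated by the forms of degree
  \<open>n\<close> that annihilate \<open>\<Lambda>\<close>.\<close>

definition prolong :: "nat \<Rightarrow> ('v::finite, 'k::field) dual set \<Rightarrow> ('v, 'k) dual set" where
  "prolong n \<Lambda> = {L \<in> dual_forms (Suc n). \<forall>v. act (var v) L \<in> \<Lambda>}"

definition gens :: "nat \<Rightarrow> ('v::finite, 'k::field) dual set \<Rightarrow> ('v, 'k) mpolys set" where
  "gens n \<Lambda> = {f \<in> forms n. \<forall>L\<in>\<Lambda>. act f L = 0}"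

lemma perp_subset: "perp G t \<subseteq> dual_forms t"
  by (auto simp: perp_def)

lemma subspace_perp: "fv.subspace (perp G t)"
  using subspace_dual_forms[of t]
  by (auto simp: perp_def fv.subspace_def act_add_right act_sc_right act.zero)

lemma fin_spanned_perp: "fv.fin_spanned (perp G t)"
  using fv.fin_spanned_subset[OF fin_spanned_dual_forms perp_subset] .

lemma perp_antimono: "G \<subseteq> H \<Longrightarrow> perp H t \<subseteq> perp G t"
  by (auto simp: perp_def)

lemma hdim_le_if_subset: "perp G t \<subseteq> perp H t \<Longrightarrow> hdim G t \<le> hdim H t"
  unfolding hdim_def by (rule fv.dim_mono_fin[OF fin_spanned_perp])

lemma perp_insert: "perp (insert f G) t = {L \<in> perp G t. act f L = 0}"
  by (auto simp: perp_def)

lemma perp_Suc_subset: "perp G (Suc t) \<subseteq> prolong t (perp G t)"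
  by (auto simp: perp_def prolong_def act_var_dual_forms act_commute[of _ "var _"] act.zero)

text \<open>For a generator \<open>g\<close> of degree at most \<open>t\<close> the contraction
  \<open>act g L\<close> has positive degree and is killed by all variables, so it vanishes. Beyond
  the degrees of the generators no new condition appears.\<close>

lemma perp_Suc:
  assumes G: "G \<subseteq> (\<Union>s\<le>n. forms s)" and "n \<le> t"
  shows "perp G (Suc t) = prolong t (perp G t)"
proof
  show "prolong t (perp G t) \<subseteq> perp G (Suc t)"
  proof
    fix L assume L: "L \<in> prolong t (perp G t)"
    then have Ld: "L \<in> dual_forms (Suc t)" by (simp add: prolong_def)
    have "act g L = 0" if "g \<in> G" for g
    proof -
      obtain s where s: "s \<le> n" "g \<in> forms s" using G \<open>g \<in> G\<close> by blast
      have "act g L \<in> dual_forms (Suc (t - s))"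
        using act_dual_forms[OF s(2), of L "Suc (t - s)"] Ld s(1) assms(2) by (simp add: Suc_diff_le)
      moreover have "act (var v) (act g L) = 0" for v
        using L \<open>g \<in> G\<close> by (simp add: prolong_def perp_def act_commute[of "var v"])
      ultimately show ?thesis by (rule dual_forms_Suc_eq_0)
    qed
    then show "L \<in> perp G (Suc t)" using Ld by (simp add: perp_def)
  qed
qed (rule perp_Suc_subset)

lemma prolong_mono: "\<Lambda> \<subseteq> \<Lambda>' \<Longrightarrow> prolong n \<Lambda> \<subseteq> prolong n \<Lambda>'"
  by (auto simp: prolong_def)

lemma perp_subset_perp:
  assumes H: "H \<subseteq> (\<Union>s\<le>n. forms s)" and "perp G n \<subseteq> perp H n" and "n \<le> t"
  shows "perp G t \<subseteq> perp H t"
  using assms(3)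
proof (induction t rule: dec_induct)
  case (step t)
  have "perp G (Suc t) \<subseteq> prolong t (perp G t)" by (rule perp_Suc_subset)
  also have "\<dots> \<subseteq> prolong t (perp H t)" using step.IH by (rule prolong_mono)
  also have "\<dots> = perp H (Suc t)" using perp_Suc[OF H step.hyps(1)] by simp
  finally show ?case .
qed (rule assms(2))

lemma gens_subset: "gens n \<Lambda> \<subseteq> forms n"
  by (auto simp: gens_def)

lemma perp_gens:
  assumes "fv.subspace \<Lambda>" "\<Lambda> \<subseteq> dual_forms n"
  shows "perp (gens n \<Lambda>) n = \<Lambda>"
proof
  show "perp (gens n \<Lambda>) n \<subseteq> \<Lambda>"
  proof (rule ccontr)
    assume "\<not> perp (gens n \<Lambda>) n \<subseteq> \<Lambda>"
    then obtain L where L: "L \<in> dual_forms n" "\<And>g. g \<in> gens n \<Lambda> \<Longrightarrow> act g L = 0" "L \<notin> \<Lambda>"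
      by (auto simp: perp_def)
    obtain g where g: "g \<in> forms n" "\<forall>L'\<in>\<Lambda>. act g L' = 0" "act g L 0 = 1"
      using separate_dual_form[OF assms L(1,3)] by blast
    then have "act g L = 0" using L(2) by (simp add: gens_def)
    then show False using g(3) by simp
  qed
qed (use assms(2) in \<open>auto simp: perp_def gens_def\<close>)

lemma prolong_perp_gens:
  assumes "fv.subspace \<Lambda>" "\<Lambda> \<subseteq> dual_forms n"
  shows "perp (gens n \<Lambda>) (Suc n) = prolong n \<Lambda>"
  using perp_Suc[of "gens n \<Lambda>" n n] perp_gens[OF assms] gens_subset
  by (metis UN_I atMost_iff order_refl subset_iff)

lemma subspace_prolong:
  assumes "fv.subspace \<Lambda>" "\<Lambda> \<subseteq> dual_forms n"
  shows "fv.subspace (prolong n \<Lambda>)"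
  using prolong_perp_gens[OF assms] subspace_perp by metis

lemma fin_spanned_prolong: "fv.fin_spanned (prolong n \<Lambda>)"
  by (rule fv.fin_spanned_subset[OF fin_spanned_dual_forms]) (auto simp: prolong_def)

section \<open>Generic linear forms and the theorems of Green and Macaulay\<close>

text \<open>Over a finite field, one plus the product of all \<open>X - a\<close> has no
  root.\<close>

lemma infinite_alg_closed_field: "infinite (UNIV :: 'k::alg_closed_field set)"
proof
  assume fin: "finite (UNIV :: 'k set)"
  define p where "p = (\<Prod>a\<in>(UNIV :: 'k set). [:- a, 1:])"
  have dp: "degree p = card (UNIV :: 'k set)"
    unfolding p_def by (subst degree_prod_sum_eq) auto
  then have "degree (p + 1) = degree p"
    using fin by (intro degree_add_eq_left) (simp add: card_gt_0_iff)
  then have "degree (p + 1) > 0" using dp fin by (simp add: card_gt_0_iff)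
  then obtain x where "poly (p + 1) x = 0" using alg_closed_imp_poly_has_root by blast
  moreover have "poly p x = 0" unfolding p_def poly_prod using fin by (intro prod_zero) auto
  ultimately show False by simp
qed

text \<open>A substitute for non-empty Zariski open sets: along every line through a point of the set, only
  finitely many points are missing.\<close>

definition dense_open :: "('a \<Rightarrow> 'k::field) set \<Rightarrow> bool" where
  "dense_open A \<longleftrightarrow> A \<noteq> {} \<and> (\<forall>a\<in>A. \<forall>v. finite {t. a + sc t v \<notin> A})"

text \<open>The line through a point of \<open>A\<close> and a point of \<open>B\<close>,
  parametrised from either end, leaves each set at finitely many parameters only, and the field is
  infinite.\<close>

lemma dense_open_Int:
  fixes A B :: "('a \<Rightarrow> 'k::alg_closed_field) set"
  assumes "dense_open A" "dense_open B"
  shows "dense_open (A \<inter> B)"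
proof -
  obtain a b where a: "a \<in> A" and b: "b \<in> B" using assms by (auto simp: dense_open_def)
  let ?S = "{t. a + sc t (b - a) \<notin> A}" and ?T = "{t. b + sc t (a - b) \<notin> B}"
  have "finite (?S \<union> (\<lambda>t. 1 - t) ` ?T)"
    using assms a b unfolding dense_open_def by blast
  then obtain t where t: "t \<notin> ?S \<union> (\<lambda>t. 1 - t) ` ?T"
    using ex_new_if_finite[OF infinite_alg_closed_field] by blast
  have "a + sc t (b - a) = b + sc (1 - t) (a - b)"
    by (auto simp: sc_def fun_eq_iff algebra_simps)
  moreover have "1 - t \<notin> ?T"
  proof
    assume "1 - t \<in> ?T"
    then have "1 - (1 - t) \<in> (\<lambda>t. 1 - t) ` ?T" by (rule imageI)
    then show False using t by simp
  qed
  ultimately have "a + sc t (b - a) \<in> A \<inter> B" using t by auto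
  moreover have "finite {t. a + sc t v \<notin> A \<inter> B}" if "a \<in> A \<inter> B" for a v
  proof -
    have "{t. a + sc t v \<notin> A \<inter> B} = {t. a + sc t v \<notin> A} \<union> {t. a + sc t v \<notin> B}" by auto
    then show ?thesis using assms that unfolding dense_open_def by auto
  qed
  ultimately show ?thesis unfolding dense_open_def by blast
qed

definition ker :: "('v::finite, 'k::field) dual set \<Rightarrow> ('v \<Rightarrow> 'k) \<Rightarrow> ('v, 'k) dual set" where
  "ker \<Lambda> a = {L \<in> \<Lambda>. act (lin a) L = 0}"

lemma subspace_ker: "fv.subspace \<Lambda> \<Longrightarrow> fv.subspace (ker \<Lambda> a)"
  unfolding ker_def by (rule fp.subspace_kernel_on[OF act_linear])

lemma ker_subset: "ker \<Lambda> a \<subseteq> \<Lambda>"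
  by (auto simp: ker_def)

lemma fin_spanned_duals: "\<Lambda> \<subseteq> dual_forms n \<Longrightarrow> fv.fin_spanned \<Lambda>"
  using fv.fin_spanned_subset[OF fin_spanned_dual_forms] .

lemma dim_ker_plus_dim_image:
  assumes "fv.subspace \<Lambda>" "\<Lambda> \<subseteq> dual_forms n"
  shows "fv.dim \<Lambda> = fv.dim (ker \<Lambda> a) + fv.dim (act (lin a) ` \<Lambda>)"
  unfolding ker_def
  by (rule fp.rank_nullity_on[OF act_linear assms(1) fin_spanned_duals[OF assms(2)]])

text \<open>As \<open>lin a\<close> depends linearly on \<open>a\<close>, a line of coefficient
  vectors gives a pencil of contractions, whose kernels jump at finitely many parameters.\<close>

lemma dense_open_dim_ker:
  assumes "fv.subspace \<Lambda>" "\<Lambda> \<subseteq> dual_forms n" "fv.dim (ker \<Lambda> a) \<le> k"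
  shows "dense_open {a. fv.dim (ker \<Lambda> a) \<le> k}"
proof -
  have "finite {t. \<not> fv.dim (ker \<Lambda> (b + sc t v)) \<le> k}" if "fv.dim (ker \<Lambda> b) \<le> k" for b v
    using fp.finite_kernel_jump_in_pencil[OF act_linear act_linear assms(1)
        fin_spanned_duals[OF assms(2)], of "lin b" k "lin v"] that
    by (simp add: ker_def act_lin_pencil)
  then show ?thesis using assms(3) by (auto simp: dense_open_def)
qed

lemma lin_delta: "lin (delta v) = var v"
proof -
  have "lin (delta v) = (\<Sum>w\<in>UNIV. if v = w then var w else 0)"
    unfolding lin_def by (rule sum.cong) (auto simp: delta_def var_def)
  then show ?thesis by (simp add: sum.delta')
qed

lemma ker_proper:
  assumes "fv.subspace \<Lambda>" "\<Lambda> \<subseteq> dual_forms (Suc n)" "\<Lambda> \<noteq> {0}"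
  obtains a where "fv.dim (ker \<Lambda> a) < fv.dim \<Lambda>"
proof -
  obtain L where L: "L \<in> \<Lambda>" "L \<noteq> 0" using assms fv.subspace_0 by blast
  then obtain v where "act (var v) L \<noteq> 0" using dual_forms_Suc_eq_0[of L n] assms(2) by blast
  then have "L \<notin> ker \<Lambda> (delta v)" by (simp add: ker_def lin_delta)
  then have "fv.dim (ker \<Lambda> (delta v)) < fv.dim \<Lambda>"
    using L by (intro fv.dim_less_fin subspace_ker assms fin_spanned_duals[OF assms(2)])
      (auto simp: ker_def)
  then show ?thesis by (rule that)
qed

lemma image_lin_subset:
  assumes "\<Lambda> \<subseteq> dual_forms (Suc n)"
  shows "act (lin a) ` \<Lambda> \<subseteq> dual_forms n"
  using assms act_lin_dual_forms by blast

text \<open>Green's argument: for generic \<open>l\<close>, \<open>l'\<close> the numbers \<open>x = dim (ker \<Lambda> l) = dim (ker \<Lambda> l')\<close>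
  and \<open>c = dim \<Lambda>\<close> satisfy \<open>x \<le> green_low n (c - x) + green_low (n + 1) x\<close>.\<close>

theorem green_restriction:
  fixes \<Lambda> :: "('v::finite, 'k::alg_closed_field) dual set"
  assumes "n \<ge> 1" "fv.subspace \<Lambda>" "\<Lambda> \<subseteq> dual_forms n"
  shows "\<exists>a. fv.dim (ker \<Lambda> a) \<le> green_low n (fv.dim \<Lambda>)"
  using assms
proof (induction n arbitrary: \<Lambda> rule: nat_induct_at_least)
  case base
  show ?case
  proof (cases "\<Lambda> = {0}")
    case True
    then have "ker \<Lambda> 0 = {0}" by (auto simp: ker_def act.zero)
    then show ?thesis by (metis fv.dim_zero_subspace le0)
  next
    case False
    then obtain a where "fv.dim (ker \<Lambda> a) < fv.dim \<Lambda>"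
      using ker_proper[of \<Lambda> 0] base by auto
    then show ?thesis by (intro exI[of _ a]) simp
  qed
next
  case (Suc n)
  note outer = Suc.IH
  show ?case
    using Suc.prems
  proof (induction "fv.dim \<Lambda>" arbitrary: \<Lambda> rule: less_induct)
    case less
    note sub = less.prems
    show ?case
    proof (cases "\<Lambda> = {0}")
      case True
      then have "ker \<Lambda> 0 = {0}" by (auto simp: ker_def act.zero)
      then show ?thesis by (metis fv.dim_zero_subspace le0)
    next
      case False
      define x where "x = (LEAST k. \<exists>a. fv.dim (ker \<Lambda> a) = k)"
      have "\<exists>a. fv.dim (ker \<Lambda> a) = x" unfolding x_def by (rule LeastI_ex) blast
      then obtain a0 where a0: "fv.dim (ker \<Lambda> a0) = x" ..
      have xmin: "x \<le> fv.dim (ker \<Lambda> a)" for a unfolding x_def by (rule Least_le) blast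
      let ?c = "fv.dim \<Lambda>"
      have xc: "x < ?c"
        using ker_proper[OF sub False] xmin by (meson le_less_trans)
      have gen: "dense_open {a. fv.dim (ker \<Lambda> a) \<le> x}"
        using dense_open_dim_ker[OF sub, of a0 x] a0 by simp
      have K: "fv.subspace (ker \<Lambda> a)" "ker \<Lambda> a \<subseteq> dual_forms (Suc n)" for a
        using subspace_ker[OF sub(1)] ker_subset[of \<Lambda> a] sub(2) by auto
      obtain l0 where "fv.dim (ker (ker \<Lambda> a0) l0) \<le> green_low (Suc n) x"
        using less.hyps[OF _ K, of a0] a0 xc by auto
      then have "dense_open {a. fv.dim (ker (ker \<Lambda> a0) a) \<le> green_low (Suc n) x}"
        using dense_open_dim_ker[OF K] by blast
      from dense_open_Int[OF gen this]
      obtain l where l: "fv.dim (ker \<Lambda> l) \<le> x" "fv.dim (ker (ker \<Lambda> a0) l) \<le> green_low (Suc n) x"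
        unfolding dense_open_def by blast
      have comm: "ker (ker \<Lambda> a) b = ker (ker \<Lambda> b) a" for a b by (auto simp: ker_def)
      \<comment> \<open>The double kernel is symmetric in the two forms, so \<open>a0\<close> itself
        witnesses the bound for sections of \<open>ker \<Lambda> l\<close>.\<close>
      have A2: "dense_open {a. fv.dim (ker (ker \<Lambda> l) a) \<le> green_low (Suc n) x}"
        using dense_open_dim_ker[OF K, of l a0] l(2) comm[of a0 l] by simp
      let ?N = "act (lin l) ` \<Lambda>"
      have N: "fv.subspace ?N" "?N \<subseteq> dual_forms n"
        using fp.subspace_image_linear[OF act_linear sub(1)] image_lin_subset[OF sub(2)] by auto
      have "fv.dim (ker \<Lambda> l) = x" using l(1) xmin[of l] by simp
      then have dN: "fv.dim ?N = ?c - x" using dim_ker_plus_dim_image[OF sub, of l] by simp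
      obtain b where "fv.dim (ker ?N b) \<le> green_low n (?c - x)" using outer[OF N] dN by auto
      then have "dense_open {a. fv.dim (ker ?N a) \<le> green_low n (?c - x)}"
        using dense_open_dim_ker[OF N] by blast
      from dense_open_Int[OF dense_open_Int[OF gen A2] this]
      obtain l' where l': "fv.dim (ker \<Lambda> l') \<le> x" "fv.dim (ker (ker \<Lambda> l) l') \<le> green_low (Suc n) x"
        "fv.dim (ker ?N l') \<le> green_low n (?c - x)"
        unfolding dense_open_def by blast
      \<comment> \<open>In this instance of rank and nullity the kernel is controlled by induction
        on the dimension and the image by induction on the degree, since the image lies in the
        kernel of \<open>l'\<close> on \<open>l \<Lambda>\<close>.\<close>
      have "fv.dim (ker \<Lambda> l') = fv.dim (ker (ker \<Lambda> l') l) + fv.dim (act (lin l) ` ker \<Lambda> l')"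
        by (rule dim_ker_plus_dim_image[OF K])
      moreover have "act (lin l) ` ker \<Lambda> l' \<subseteq> ker ?N l'"
        by (auto simp: ker_def act_commute[of "lin l'"] act.zero)
      then have "fv.dim (act (lin l) ` ker \<Lambda> l') \<le> fv.dim (ker ?N l')"
        by (rule fv.dim_mono_fin[OF fv.fin_spanned_subset[OF
              fin_spanned_duals[OF N(2)] ker_subset]])
      ultimately have "x \<le> green_low n (?c - x) + green_low (Suc n) x"
        using l' comm[of l' l] xmin[of l'] by simp
      then have "x \<le> green_low (Suc n) ?c"
        using le_green_low_if[OF Suc.hyps] xc by simp
      then show ?thesis using a0 by blast
    qed
  qed
qed

corollary dense_open_green:
  fixes \<Lambda> :: "('v::finite, 'k::alg_closed_field) dual set"
  assumes "n \<ge> 1" "fv.subspace \<Lambda>" "\<Lambda> \<subseteq> dual_forms n"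
  shows "dense_open {a. fv.dim (ker \<Lambda> a) \<le> green_low n (fv.dim \<Lambda>)}"
  using green_restriction[OF assms] dense_open_dim_ker[OF assms(2,3)] by blast

lemma act_lin_prolong:
  assumes "fv.subspace \<Lambda>" "L \<in> prolong n \<Lambda>"
  shows "act (lin a) L \<in> \<Lambda>"
  using assms unfolding act_lin prolong_def
  by (intro fv.subspace_sum fv.subspace_scale) auto

text \<open>Contraction by the linear form lands in degree \<open>n \<ge> 1\<close>, where vanishing
  can be tested by further contraction with the variables; contractions commute.\<close>

lemma ker_prolong:
  assumes "n \<ge> 1"
  shows "ker (prolong n \<Lambda>) a = prolong n (ker \<Lambda> a)"
proof
  show "prolong n (ker \<Lambda> a) \<subseteq> ker (prolong n \<Lambda>) a"
  proof
    fix L assume L: "L \<in> prolong n (ker \<Lambda> a)"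
    obtain m where m: "n = Suc m" using assms by (cases n) auto
    have "act (lin a) L \<in> dual_forms (Suc m)"
      using L act_lin_dual_forms[of L n a] m by (simp add: prolong_def)
    moreover have "act (var v) (act (lin a) L) = 0" for v
      using L by (simp add: prolong_def ker_def act_commute[of "var v"])
    ultimately have "act (lin a) L = 0" by (rule dual_forms_Suc_eq_0)
    then show "L \<in> ker (prolong n \<Lambda>) a"
      using L by (simp add: prolong_def ker_def)
  qed
qed (auto simp: prolong_def ker_def act_commute[of "lin a"] act.zero)

lemma prolong_subset: "prolong n \<Lambda> \<subseteq> dual_forms (Suc n)"
  by (auto simp: prolong_def)

lemma dim_prolong:
  assumes "n \<ge> 1" "fv.subspace \<Lambda>" "\<Lambda> \<subseteq> dual_forms n"
  shows "fv.dim (prolong n \<Lambda>) = fv.dim (prolong n (ker \<Lambda> a)) + fv.dim (act (lin a) ` prolong n \<Lambda>)"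
    and "act (lin a) ` prolong n \<Lambda> \<subseteq> \<Lambda>"
    and "fv.dim (act (lin a) ` prolong n \<Lambda>) \<le> fv.dim \<Lambda>"
proof -
  show "fv.dim (prolong n \<Lambda>) = fv.dim (prolong n (ker \<Lambda> a)) + fv.dim (act (lin a) ` prolong n \<Lambda>)"
    using dim_ker_plus_dim_image[OF subspace_prolong[OF assms(2,3)] prolong_subset]
      ker_prolong[OF assms(1)] by metis
  show *: "act (lin a) ` prolong n \<Lambda> \<subseteq> \<Lambda>"
    using act_lin_prolong[OF assms(2)] by blast
  show "fv.dim (act (lin a) ` prolong n \<Lambda>) \<le> fv.dim \<Lambda>"
    by (rule fv.dim_mono_fin[OF fin_spanned_duals[OF assms(3)] *])
qed

lemma prolong_zero: "prolong n {0} = {0}"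
  using dual_forms_Suc_eq_0 fv.subspace_0[OF subspace_dual_forms] by (auto simp: prolong_def act.zero)

text \<open>For a general linear form the kernel on the prolongation is the prolongation of the
  kernel, bounded by Green and induction, while the image lies in \<open>\<Lambda>\<close>. By
  \<open>mac_up_green_low\<close> the two bounds add up exactly.\<close>

theorem macaulay_bound:
  fixes \<Lambda> :: "('v::finite, 'k::alg_closed_field) dual set"
  assumes "n \<ge> 1" "fv.subspace \<Lambda>" "\<Lambda> \<subseteq> dual_forms n"
  shows "fv.dim (prolong n \<Lambda>) \<le> mac_up n (fv.dim \<Lambda>)"
  using assms(2,3)
proof (induction "fv.dim \<Lambda>" arbitrary: \<Lambda> rule: less_induct)
  case less
  show ?case
  proof (cases "\<Lambda> = {0}")
    case True
    then show ?thesis by (simp add: prolong_zero)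
  next
    case False
    obtain a where a: "fv.dim (ker \<Lambda> a) \<le> green_low n (fv.dim \<Lambda>)"
      using green_restriction[OF assms(1) less.prems] by blast
    have "fv.dim \<Lambda> > 0"
      using fv.dim_0_iff_fin[OF less.prems(1) fin_spanned_duals[OF less.prems(2)]] False
      by simp
    then have lt: "fv.dim (ker \<Lambda> a) < fv.dim \<Lambda>"
      using green_low_less[OF assms(1)] a by (meson le_less_trans)
    have "fv.dim (prolong n (ker \<Lambda> a)) \<le> mac_up n (fv.dim (ker \<Lambda> a))"
      by (rule less.hyps[OF lt subspace_ker[OF less.prems(1)]]) (use ker_subset less.prems(2) in blast)
    also have "\<dots> \<le> mac_up n (green_low n (fv.dim \<Lambda>))"
      by (rule mac_up_mono[OF assms(1) a])
    finally show ?thesis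
      using dim_prolong(1,3)[OF assms(1) less.prems, of a] mac_up_green_low[OF assms(1), of "fv.dim \<Lambda>"]
      by linarith
  qed
qed

section \<open>Growth of Hilbert functions\<close>

text \<open>Summing up to \<open>t\<close> makes the exponent drop under difference equations
  (\<open>grows_le_diff\<close>) without any monotonicity of \<open>h\<close>.\<close>

definition grows_le :: "nat \<Rightarrow> (nat \<Rightarrow> nat) \<Rightarrow> bool" where
  "grows_le k h \<longleftrightarrow> (\<exists>C. \<forall>t. (\<Sum>j\<le>t. h j) \<le> C * (t + 1) ^ k)"

lemma grows_le_mono:
  assumes "grows_le k h" "k \<le> k'"
  shows "grows_le k' h"
proof -
  obtain C where C: "\<And>t. (\<Sum>j\<le>t. h j) \<le> C * (t + 1) ^ k"
    using assms(1) by (auto simp: grows_le_def)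
  have "(\<Sum>j\<le>t. h j) \<le> C * (t + 1) ^ k'" for t
    by (rule le_trans[OF C]) (intro mult_le_mono2 power_increasing assms(2), simp)
  then show ?thesis unfolding grows_le_def by blast
qed

lemma grows_le_dominated:
  assumes "\<And>t. n \<le> t \<Longrightarrow> h t \<le> h' t" "grows_le k h'"
  shows "grows_le k h"
proof -
  obtain C where C: "\<And>t. (\<Sum>j\<le>t. h' j) \<le> C * (t + 1) ^ k"
    using assms(2) by (auto simp: grows_le_def)
  have "(\<Sum>j\<le>t. h j) \<le> (C + (\<Sum>j<n. h j)) * (t + 1) ^ k" for t
  proof -
    have "(\<Sum>j\<le>t. h j) \<le> (\<Sum>j\<le>t. h' j + (if j < n then h j else 0))"
      using assms(1) by (intro sum_mono) (auto simp: not_less trans_le_add1)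
    also have "\<dots> = (\<Sum>j\<le>t. h' j) + (\<Sum>j\<in>{..t} \<inter> {..<n}. h j)"
      by (simp add: sum.distrib sum.If_cases lessThan_def)
    also have "(\<Sum>j\<in>{..t} \<inter> {..<n}. h j) \<le> (\<Sum>j<n. h j)" by (rule sum_mono2) auto
    also have "\<dots> \<le> (\<Sum>j<n. h j) * (t + 1) ^ k" by simp
    finally show ?thesis using C[of t] by (simp add: distrib_right)
  qed
  then show ?thesis unfolding grows_le_def by blast
qed

lemma sum_shifted:
  fixes h :: "nat \<Rightarrow> nat"
  shows "(\<Sum>j\<le>t. if a \<le> j then h (j - a) else 0) = (if a \<le> t then (\<Sum>j\<le>t - a. h j) else 0)"
  by (induction t) (auto simp: Suc_diff_le le_Suc_eq)

lemma grows_le_add_shift: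
  assumes "\<And>t. h t \<le> h1 t + (if a \<le> t then h2 (t - a) else 0)" "grows_le k h1" "grows_le k h2"
  shows "grows_le k h"
proof -
  obtain C1 C2 where C: "\<And>t. (\<Sum>j\<le>t. h1 j) \<le> C1 * (t + 1) ^ k" "\<And>t. (\<Sum>j\<le>t. h2 j) \<le> C2 * (t + 1) ^ k"
    using assms(2,3) by (auto simp: grows_le_def)
  have "(\<Sum>j\<le>t. h j) \<le> (C1 + C2) * (t + 1) ^ k" for t
  proof -
    have "(\<Sum>j\<le>t. h j) \<le> (\<Sum>j\<le>t. h1 j + (if a \<le> j then h2 (j - a) else 0))"
      by (rule sum_mono) (rule assms(1))
    also have "\<dots> = (\<Sum>j\<le>t. h1 j) + (if a \<le> t then (\<Sum>j\<le>t - a. h2 j) else 0)"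
      by (simp only: sum.distrib sum_shifted)
    also have "(if a \<le> t then (\<Sum>j\<le>t - a. h2 j) else 0) \<le> (\<Sum>j\<le>t. h2 j)"
      by (auto intro: sum_mono2)
    finally show ?thesis using C[of t] by (simp add: distrib_right)
  qed
  then show ?thesis unfolding grows_le_def by blast
qed

text \<open>The recursion is the one that a single equation of degree \<open>a\<close> produces. The
  bound reproduces itself because \<open>(t - a + 1) ^ Suc k \<le> t * (t + 1) ^ k\<close> for
  \<open>a \<ge> 1\<close>.\<close>

lemma grows_le_Suc:
  assumes rec: "\<And>t. h t \<le> h' t + (if a \<le> t then h (t - a) else 0)" and "a \<ge> 1" "grows_le k h'"
  shows "grows_le (Suc k) h"
proof -
  obtain C where C: "\<And>t. (\<Sum>j\<le>t. h' j) \<le> C * (t + 1) ^ k"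
    using assms(3) by (auto simp: grows_le_def)
  have "(\<Sum>j\<le>t. h j) \<le> C * (t + 1) ^ Suc k" for t
  proof (induction t rule: less_induct)
    case (less t)
    have "(\<Sum>j\<le>t. h j) \<le> (\<Sum>j\<le>t. h' j + (if a \<le> j then h (j - a) else 0))"
      by (rule sum_mono) (rule rec)
    also have "\<dots> = (\<Sum>j\<le>t. h' j) + (if a \<le> t then (\<Sum>j\<le>t - a. h j) else 0)"
      by (simp only: sum.distrib sum_shifted)
    also have "\<dots> \<le> C * (t + 1) ^ k + C * (t * (t + 1) ^ k)"
    proof (rule add_mono[OF C])
      show "(if a \<le> t then (\<Sum>j\<le>t - a. h j) else 0) \<le> C * (t * (t + 1) ^ k)"
      proof (cases "a \<le> t")
        case True
        then have "(\<Sum>j\<le>t - a. h j) \<le> C * (t - a + 1) ^ Suc k"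
          using assms(2) by (intro less) simp
        also have "(t - a + 1) ^ Suc k \<le> t * (t + 1) ^ k"
          unfolding power_Suc using True assms(2) by (intro mult_le_mono power_mono) auto
        finally show ?thesis using True by simp
      qed simp
    qed
    finally show ?case by (simp add: algebra_simps)
  qed
  then show ?thesis unfolding grows_le_def by blast
qed

text \<open>Telescoping along \<open>t, t + a, ..., t + m * a\<close> puts \<open>m\<close> copies
  of the sum of \<open>h'\<close> below a single sum of \<open>h\<close>. The choice
  \<open>m = t + 1\<close> then lets one factor \<open>t + 1\<close> cancel.\<close>

lemma grows_le_diff:
  assumes rec: "\<And>t. h' t + (if a \<le> t then h (t - a) else 0) \<le> h t" and "grows_le (Suc k) h"
  shows "grows_le k h'"
proof -
  obtain C where C: "\<And>t. (\<Sum>j\<le>t. h j) \<le> C * (t + 1) ^ Suc k"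
    using assms(2) by (auto simp: grows_le_def)
  have step: "(\<Sum>j\<le>t. h' j) + (\<Sum>j\<le>t - a. h j) \<le> (\<Sum>j\<le>t. h j)" if "a \<le> t" for t
  proof -
    have "(\<Sum>j\<le>t. h' j) + (\<Sum>j\<le>t - a. h j) = (\<Sum>j\<le>t. h' j + (if a \<le> j then h (j - a) else 0))"
      using that by (simp only: sum.distrib sum_shifted if_True)
    also have "\<dots> \<le> (\<Sum>j\<le>t. h j)" by (rule sum_mono) (rule rec)
    finally show ?thesis .
  qed
  have tele: "m * (\<Sum>j\<le>t. h' j) \<le> (\<Sum>j\<le>t + m * a. h j)" for m t
  proof (induction m)
    case (Suc m)
    have "(\<Sum>j\<le>t. h' j) \<le> (\<Sum>j\<le>t + Suc m * a. h' j)" by (rule sum_mono2) auto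
    then have "Suc m * (\<Sum>j\<le>t. h' j) \<le> (\<Sum>j\<le>t + Suc m * a. h' j) + (\<Sum>j\<le>t + m * a. h j)"
      using Suc by simp
    also have "\<dots> \<le> (\<Sum>j\<le>t + Suc m * a. h j)" using step[of "t + Suc m * a"] by simp
    finally show ?case .
  qed simp
  have "(\<Sum>j\<le>t. h' j) \<le> (C * (a + 1) ^ Suc k) * (t + 1) ^ k" for t
  proof -
    have "(t + 1) * (\<Sum>j\<le>t. h' j) \<le> C * (t + (t + 1) * a + 1) ^ Suc k"
      using tele[of "t + 1" t] C[of "t + (t + 1) * a"] by (rule le_trans)
    also have "t + (t + 1) * a + 1 = (t + 1) * (a + 1)" by (simp add: algebra_simps)
    also have "C * ((t + 1) * (a + 1)) ^ Suc k = (t + 1) * ((C * (a + 1) ^ Suc k) * (t + 1) ^ k)"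
      by (simp only: power_mult_distrib power_Suc mult_ac)
    finally show ?thesis by (simp only: nat_mult_le_cancel_disj)
  qed
  then show ?thesis unfolding grows_le_def by blast
qed

lemma not_grows_le_0:
  assumes "\<And>t. n \<le> t \<Longrightarrow> h t \<ge> 1"
  shows "\<not> grows_le 0 h"
proof
  assume "grows_le 0 h"
  then obtain C where C: "\<And>t. (\<Sum>j\<le>t. h j) \<le> C" by (auto simp: grows_le_def)
  have "Suc C = (\<Sum>j\<in>{n..n+C}. 1)" by simp
  also have "\<dots> \<le> (\<Sum>j\<in>{n..n+C}. h j)" by (rule sum_mono) (use assms in auto)
  also have "\<dots> \<le> (\<Sum>j\<le>n+C. h j)" by (rule sum_mono2) auto
  finally show False using C[of "n + C"] by simp
qed

lemma grows_le_if_eventually_0: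
  assumes "\<And>t. n \<le> t \<Longrightarrow> h t = 0"
  shows "grows_le k h"
  by (rule grows_le_dominated[where h' = "\<lambda>_. 0" and n = n]) (auto simp: assms grows_le_def)

section \<open>Homogeneous ideals\<close>

interpretation idl: module "(*) :: 'a::comm_ring_1 \<Rightarrow> 'a \<Rightarrow> 'a"
  by (rule module_times)

lemma is_ideal_mult: "is_ideal I \<Longrightarrow> f \<in> I \<Longrightarrow> g * f \<in> I"
  by (rule idl.subspace_scale)

lemma subspace_ideal: "is_ideal I \<Longrightarrow> pv.subspace I"
  by (auto simp: pv.subspace_def psc_def idl.subspace_add idl.subspace_0 is_ideal_mult)

section \<open>Homogeneous components\<close>

definition hcomp :: "nat \<Rightarrow> ('v::finite, 'k::field) mpolys \<Rightarrow> ('v, 'k) mpolys" where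
  "hcomp t f = (\<Sum>u\<in>keys f. if mon_degree u = t then single u (lookup f u) else 0)"

lemma lookup_hcomp: "lookup (hcomp t f) u = (if mon_degree u = t then lookup f u else 0)"
proof -
  have "lookup (hcomp t f) u
      = (\<Sum>w\<in>keys f. if w = u then if mon_degree u = t then lookup f u else 0 else 0)"
    unfolding hcomp_def lookup_sum by (rule sum.cong) (auto simp: lookup_single when_def)
  also have "\<dots> = (if mon_degree u = t then lookup f u else 0)"
    by (auto simp: sum.delta in_keys_iff)
  finally show ?thesis .
qed

lemma hcomp_add: "hcomp t (f + g) = hcomp t f + hcomp t g"
  by (rule poly_mapping_eqI) (simp add: lookup_hcomp lookup_add)

lemma hcomp_0 [simp]: "hcomp t 0 = 0"
  by (rule poly_mapping_eqI) (simp add: lookup_hcomp)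

lemma hcomp_forms: "hcomp t f \<in> forms t"
  by (auto simp: forms_def in_keys_iff lookup_hcomp split: if_splits)

lemma hcomp_of_form: "f \<in> forms s \<Longrightarrow> hcomp t f = (if s = t then f else 0)"
  by (rule poly_mapping_eqI) (auto simp: lookup_hcomp forms_def in_keys_iff)

lemma sum_hcomp: "f = (\<Sum>t\<in>mon_degree ` keys f. hcomp t f)"
proof (rule poly_mapping_eqI)
  fix u
  show "lookup f u = lookup (\<Sum>t\<in>mon_degree ` keys f. hcomp t f) u"
    by (auto simp: lookup_sum lookup_hcomp in_keys_iff)
qed

lemma hcomp_single_mult:
  "hcomp n (single u c * g)
     = (if mon_degree u \<le> n then single u c * hcomp (n - mon_degree u) g else 0)"
proof (induction g rule: mpolys_induct)
  case (single w d)
  have "hcomp n (single (u + w) (c * d))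
      = (if mon_degree (u + w) = n then single (u + w) (c * d) else 0)"
    by (rule hcomp_of_form) (simp add: forms_single)
  moreover have "hcomp (n - mon_degree u) (single w d)
      = (if mon_degree w = n - mon_degree u then single w d else 0)"
    by (rule hcomp_of_form) (simp add: forms_single)
  ultimately show ?case by (auto simp: mult_single mon_degree_add)
next
  case (add f g)
  then show ?case by (simp add: distrib_left hcomp_add)
qed

lemma hcomp_mult: "hcomp n (f * g) = (\<Sum>i\<le>n. hcomp i f * hcomp (n - i) g)"
proof (induction f rule: mpolys_induct)
  case (single u c)
  have "(\<Sum>i\<le>n. hcomp i (single u c) * hcomp (n - i) g)
      = (\<Sum>i\<le>n. if mon_degree u = i then single u c * hcomp (n - mon_degree u) g else 0)"
    by (rule sum.cong) (auto simp: hcomp_of_form[OF forms_single[OF refl]])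
  then show ?case by (simp add: hcomp_single_mult sum.delta')
next
  case (add f g)
  then show ?case by (simp add: distrib_right hcomp_add sum.distrib)
qed

lemma hcomp_mult_form:
  assumes "g \<in> forms s"
  shows "hcomp n (f * g) = (if s \<le> n then hcomp (n - s) f * g else 0)"
proof -
  have "hcomp n (f * g) = (\<Sum>i\<le>n. if s \<le> n \<and> i = n - s then hcomp (n - s) f * g else 0)"
    unfolding hcomp_mult by (rule sum.cong) (auto simp: hcomp_of_form[OF assms])
  then show ?thesis by (simp add: sum.delta)
qed

lemma homogeneous_ideal_iff:
  "homogeneous_ideal I \<longleftrightarrow> is_ideal I \<and> (\<forall>f\<in>I. \<forall>t. hcomp t f \<in> I)"
proof
  assume "homogeneous_ideal I"
  then obtain G where G: "G \<subseteq> (\<Union>t. forms t)" "I = ideal_generated G"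
    by (auto simp: homogeneous_ideal_def)
  have "\<forall>t. hcomp t f \<in> ideal_generated G" if "f \<in> ideal_generated G" for f
    using that
  proof (induction rule: idl.span_induct_alt)
    case base
    then show ?case by (simp add: idl.span_zero)
  next
    case (step c x y)
    then obtain s where "x \<in> forms s" using G(1) by blast
    then show ?case
      using step
      by (auto simp: hcomp_add hcomp_mult_form intro: idl.span_add idl.span_scale idl.span_base)
  qed
  then show "is_ideal I \<and> (\<forall>f\<in>I. \<forall>t. hcomp t f \<in> I)"
    using G(2) idl.subspace_span by blast
next
  assume I: "is_ideal I \<and> (\<forall>f\<in>I. \<forall>t. hcomp t f \<in> I)"
  let ?G = "I \<inter> (\<Union>t. forms t)"
  have "I \<subseteq> ideal_generated ?G"
  proof
    fix f assume "f \<in> I"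
    then have "(\<Sum>t\<in>mon_degree ` keys f. hcomp t f) \<in> ideal_generated ?G"
      using I hcomp_forms by (intro idl.span_sum idl.span_base) blast
    then show "f \<in> ideal_generated ?G" using sum_hcomp[of f] by simp
  qed
  moreover have "ideal_generated ?G \<subseteq> I" using I by (intro idl.span_minimal) auto
  ultimately show "homogeneous_ideal I" unfolding homogeneous_ideal_def by blast
qed

lemma homogeneous_ideal_insert:
  assumes "homogeneous_ideal I" "f \<in> forms a"
  shows "homogeneous_ideal (ideal_generated (insert f I))"
proof -
  obtain G where G: "G \<subseteq> (\<Union>t. forms t)" "I = ideal_generated G"
    using assms(1) by (auto simp: homogeneous_ideal_def)
  have "ideal_generated (insert f I) = ideal_generated (insert f G)"
  proof
    show "ideal_generated (insert f I) \<subseteq> ideal_generated (insert f G)"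
      unfolding G(2) using idl.span_mono[of G "insert f G"]
      by (intro idl.span_minimal idl.subspace_span) (auto intro: idl.span_base)
    show "ideal_generated (insert f G) \<subseteq> ideal_generated (insert f I)"
      unfolding G(2) by (intro idl.span_mono insert_mono idl.span_superset)
  qed
  then show ?thesis
    unfolding homogeneous_ideal_def using G(1) assms(2) by (intro exI[of _ "insert f G"]) auto
qed

lemma homogeneous_ideal_colon:
  assumes "homogeneous_ideal I" "f \<in> forms a"
  shows "homogeneous_ideal {g. g * f \<in> I}"
proof -
  have iI: "is_ideal I" and cI: "\<forall>f\<in>I. \<forall>t. hcomp t f \<in> I"
    using assms(1) unfolding homogeneous_ideal_iff by (rule conjunct1, rule conjunct2)
  have "is_ideal {g. g * f \<in> I}"
  proof (rule idl.subspaceI; unfold mem_Collect_eq)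
    show "0 * f \<in> I" unfolding mult_zero_left by (rule idl.subspace_0[OF iI])
    show "(x + y) * f \<in> I" if "x * f \<in> I" "y * f \<in> I" for x y
      unfolding distrib_right by (rule idl.subspace_add[OF iI that])
    show "c * x * f \<in> I" if "x * f \<in> I" for c x
      unfolding mult.assoc by (rule is_ideal_mult[OF iI that])
  qed
  moreover have "hcomp t g * f \<in> I" if "g * f \<in> I" for g t
  proof -
    have "hcomp (t + a) (g * f) = hcomp t g * f"
      unfolding hcomp_mult_form[OF assms(2)] by simp
    moreover have "hcomp (t + a) (g * f) \<in> I" using cI that by blast
    ultimately show ?thesis by (simp only:)
  qed
  ultimately show ?thesis unfolding homogeneous_ideal_iff by blast
qed

lemma exists_form_not_mem:
  assumes "homogeneous_ideal J" "is_ideal I" "\<not> J \<subseteq> I"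
  obtains t f where "f \<in> forms t" "f \<in> J" "f \<notin> I"
proof -
  obtain f where f: "f \<in> J" "f \<notin> I" using assms by blast
  have "\<exists>t. hcomp t f \<notin> I"
  proof (rule ccontr)
    assume "\<not> ?thesis"
    then have "(\<Sum>t\<in>mon_degree ` keys f. hcomp t f) \<in> I"
      using assms(2) by (intro idl.subspace_sum) auto
    then show False using f(2) sum_hcomp[of f] by simp
  qed
  then obtain t where "hcomp t f \<notin> I" ..
  then show ?thesis
    using that[of "hcomp t f" t] hcomp_forms f(1) assms(1) by (auto simp: homogeneous_ideal_iff)
qed

text \<open>If \<open>a\<close> and \<open>b\<close> lie outside \<open>I\<close>, take their
  highest components outside \<open>I\<close>: the product of these is congruent modulo
  \<open>I\<close> to a component of \<open>a * b\<close>.\<close>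

lemma is_prime_ideal_homogeneous:
  assumes I: "homogeneous_ideal I" "I \<noteq> UNIV"
    and prime: "\<And>f g s t. f \<in> forms s \<Longrightarrow> g \<in> forms t \<Longrightarrow> f * g \<in> I \<Longrightarrow> f \<in> I \<or> g \<in> I"
  shows "is_prime_ideal I"
proof -
  have II: "is_ideal I" "\<And>f t. f \<in> I \<Longrightarrow> hcomp t f \<in> I"
    using I(1) by (auto simp: homogeneous_ideal_iff)
  have top: "\<exists>s. hcomp s a \<notin> I \<and> (\<forall>i>s. hcomp i a \<in> I)" if "a \<notin> I" for a
  proof -
    let ?S = "{s. hcomp s a \<notin> I}"
    have sub: "?S \<subseteq> mon_degree ` keys a"
    proof
      fix s assume "s \<in> ?S"
      then have "hcomp s a \<noteq> 0" using idl.subspace_0[OF II(1)] by auto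
      then obtain u where "lookup (hcomp s a) u \<noteq> 0" by (metis poly_mapping_eqI lookup_zero)
      then show "s \<in> mon_degree ` keys a" by (auto simp: lookup_hcomp in_keys_iff split: if_splits)
    qed
    have fin: "finite ?S" using sub by (rule finite_subset) simp
    have "?S \<noteq> {}"
    proof
      assume "?S = {}"
      then have "(\<Sum>t\<in>mon_degree ` keys a. hcomp t a) \<in> I"
        using II(1) by (intro idl.subspace_sum) auto
      then show False using that sum_hcomp[of a] by simp
    qed
    then have "Max ?S \<in> ?S" using fin by (rule Max_in[rotated])
    moreover have "hcomp i a \<in> I" if "i > Max ?S" for i
    proof (rule ccontr)
      assume "hcomp i a \<notin> I"
      then have "i \<in> ?S" by simp
      then have "i \<le> Max ?S" by (rule Max_ge[OF fin])
      then show False using that by simp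
    qed
    ultimately show ?thesis by blast
  qed
  have "a \<in> I \<or> b \<in> I" if ab: "a * b \<in> I" for a b
  proof (rule ccontr)
    assume "\<not> (a \<in> I \<or> b \<in> I)"
    then obtain s t where s: "hcomp s a \<notin> I" "\<forall>i>s. hcomp i a \<in> I" and t: "hcomp t b \<notin> I" "\<forall>i>t. hcomp i b \<in> I"
      using top by blast
    have "hcomp (s + t) (a * b) = hcomp s a * hcomp t b + (\<Sum>i\<in>{..s+t}-{s}. hcomp i a * hcomp (s + t - i) b)"
      unfolding hcomp_mult by (subst sum.remove[of _ s]) auto
    moreover have "(\<Sum>i\<in>{..s+t}-{s}. hcomp i a * hcomp (s + t - i) b) \<in> I"
    proof (rule idl.subspace_sum[OF II(1)])
      fix i assume i: "i \<in> {..s+t}-{s}"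
      show "hcomp i a * hcomp (s + t - i) b \<in> I"
      proof (cases "i > s")
        case True
        then have "hcomp i a \<in> I" using s(2) by blast
        from is_ideal_mult[OF II(1) this, of "hcomp (s + t - i) b"]
        show ?thesis by (simp only: mult.commute)
      next
        case False
        then have "s + t - i > t" using i by auto
        then have "hcomp (s + t - i) b \<in> I" using t(2) by blast
        then show ?thesis by (rule is_ideal_mult[OF II(1)])
      qed
    qed
    moreover have "hcomp (s + t) (a * b) \<in> I" using II(2) ab by blast
    ultimately have "(hcomp s a * hcomp t b + (\<Sum>i\<in>{..s+t}-{s}. hcomp i a * hcomp (s + t - i) b))
        - (\<Sum>i\<in>{..s+t}-{s}. hcomp i a * hcomp (s + t - i) b) \<in> I"
      by (intro idl.subspace_diff[OF II(1)]) simp_all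
    then have "hcomp s a * hcomp t b \<in> I" by (simp only: add_diff_cancel_right')
    then show False using prime[OF hcomp_forms hcomp_forms] s t by blast
  qed
  then show ?thesis using II(1) I(2) by (auto simp: is_prime_ideal_def)
qed

section \<open>Inverse systems of homogeneous ideals\<close>

lemma perp_ideal_generated: "perp (ideal_generated G) t = perp G t"
proof
  show "perp (ideal_generated G) t \<subseteq> perp G t"
    by (rule perp_antimono) (rule idl.span_superset)
  show "perp G t \<subseteq> perp (ideal_generated G) t"
  proof
    fix L assume L: "L \<in> perp G t"
    have "is_ideal {f. act f L = 0}"
      by (auto simp: idl.subspace_def act_add_left act_mult act.zero)
    then have "ideal_generated G \<subseteq> {f. act f L = 0}"
      using L by (intro idl.span_minimal) (auto simp: perp_def)
    then show "L \<in> perp (ideal_generated G) t" using L by (auto simp: perp_def)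
  qed
qed

lemma hdim_ideal_generated: "hdim (ideal_generated G) = hdim G"
  by (simp add: hdim_def perp_ideal_generated fun_eq_iff)

lemma act_hcomp:
  assumes "L \<in> dual_forms t"
  shows "act f L 0 = act (hcomp t f) L 0"
proof -
  have "act f L 0 = (\<Sum>u\<in>keys f. lookup f u * L (u + 0))" by (simp add: act_def)
  also have "\<dots> = (\<Sum>u\<in>keys f. lookup (hcomp t f) u * L (u + 0))"
    by (rule sum.cong) (use assms in \<open>auto simp: lookup_hcomp dual_forms_def\<close>)
  also have "\<dots> = act (hcomp t f) L 0"
    by (rule act_superset[symmetric]) (auto simp: in_keys_iff lookup_hcomp split: if_splits)
  finally show ?thesis .
qed

text \<open>The value of \<open>act h L\<close> at \<open>m\<close> is that of \<open>L\<close> at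
  the multiple \<open>single m 1 * h\<close>, of which only the component of degree \<open>t\<close>
  counts, and that component lies in \<open>I\<close> again.\<close>

lemma perp_homogeneous:
  assumes "homogeneous_ideal I"
  shows "perp I t = perp (I \<inter> forms t) t"
proof
  show "perp (I \<inter> forms t) t \<subseteq> perp I t"
  proof
    fix L assume L: "L \<in> perp (I \<inter> forms t) t"
    then have Ld: "L \<in> dual_forms t" by (simp add: perp_def)
    have "act h L m = 0" if "h \<in> I" for h m
    proof -
      let ?k = "single m 1 * h"
      have "is_ideal I" using assms by (simp add: homogeneous_ideal_iff)
      then have "?k \<in> I" using that by (rule is_ideal_mult)
      then have "hcomp t ?k \<in> I \<inter> forms t"
        using assms hcomp_forms[of t ?k] by (simp add: homogeneous_ideal_iff)
      then have "act ?k L 0 = 0" using L act_hcomp[OF Ld, of ?k] by (simp add: perp_def)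
      then show ?thesis by (simp add: act_mult act_single)
    qed
    then show "L \<in> perp I t" using Ld by (auto simp: perp_def fun_eq_iff)
  qed
qed (rule perp_antimono, simp)

section \<open>Noetherianity\<close>

lemma nat_seq_incseq_subseq:
  fixes s :: "nat \<Rightarrow> nat"
  shows "\<exists>r. strict_mono r \<and> incseq (s \<circ> r)"
proof -
  obtain f where f: "strict_mono f" "monoseq (\<lambda>n. s (f n))" using seq_monosub by blast
  show ?thesis
  proof (cases "incseq (s \<circ> f)")
    case True
    then show ?thesis using f by blast
  next
    case False
    then have dec: "\<And>m n. m \<le> n \<Longrightarrow> s (f n) \<le> s (f m)"
      using f(2) by (auto simp: monoseq_def incseq_def)
    obtain N where N: "\<And>n. s (f N) \<le> s (f n)"
      using ex_has_least_nat[of "\<lambda>_. True" 0 "\<lambda>n. s (f n)"] by blast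
    have "s (f (n + N)) = s (f N)" for n using dec[of N "n + N"] N[of "n + N"] by simp
    then have "incseq (s \<circ> (\<lambda>n. f (n + N)))" by (simp add: incseq_def)
    moreover have "strict_mono (\<lambda>n. f (n + N))" using f(1) by (auto simp: strict_mono_def)
    ultimately show ?thesis by blast
  qed
qed

text \<open>Weakly increasing subsequences are extracted for one variable after the other.\<close>

lemma dickson:
  fixes u :: "nat \<Rightarrow> 'v::finite \<Rightarrow> nat"
  obtains i j where "i < j" "\<And>v. u i v \<le> u j v"
proof -
  have "\<exists>r. strict_mono r \<and> (\<forall>v\<in>A. incseq (\<lambda>i. u (r i) v))" if "finite A" for A
    using that
  proof induction
    case empty
    show ?case by (intro exI[of _ id]) (simp add: strict_mono_def)
  next
    case (insert v A)
    then obtain r where r: "strict_mono r" "\<forall>v\<in>A. incseq (\<lambda>i. u (r i) v)" by blast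
    obtain q where q: "strict_mono q" "incseq ((\<lambda>i. u (r i) v) \<circ> q)"
      using nat_seq_incseq_subseq by blast
    have "incseq (\<lambda>i. u (r (q i)) v)" using q(2) by (simp add: Fun.comp_def)
    moreover have "incseq (\<lambda>i. u (r (q i)) w)" if "w \<in> A" for w
      using r(2) that strict_mono_less_eq[OF q(1)] by (auto simp: incseq_def)
    ultimately show ?case
      using q(1) r(1) by (intro exI[of _ "r \<circ> q"]) (auto simp: strict_mono_def)
  qed
  then obtain r where r: "strict_mono r" "\<forall>v. incseq (\<lambda>i. u (r i) v)"
    using finite_class.finite_UNIV by blast
  have "r 0 < r 1" using r(1) by (simp add: strict_mono_def)
  moreover have "u (r 0) v \<le> u (r 1) v" for v using r(2) by (auto simp: incseq_def)
  ultimately show ?thesis by (rule that)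
qed

lemma lookup_single_mult:
  fixes g :: "('v::finite, 'k::field) mpolys"
  shows "lookup (single m c * g) (m + w) = c * lookup g w"
proof (induction g rule: mpolys_induct)
  case (single u d)
  then show ?case by (simp add: mult_single lookup_single when_def)
next
  case (add f g)
  then show ?case by (simp add: distrib_left lookup_add)
qed

text \<open>A basis theorem by leading monomials: each strict inclusion yields a monomial that is
  leading for a form of \<open>I (Suc i)\<close> but for none of \<open>I i\<close>, and by
  Dickson's lemma one of these monomials divides a later one, which is impossible.\<close>

theorem wf_homogeneous_ideals:
  "wf {(J :: ('v::finite, 'k::field) mpolys set, I). homogeneous_ideal I \<and> homogeneous_ideal J \<and> I \<subset> J}"
  unfolding wf_iff_no_infinite_down_chain
proof
  assume "\<exists>F. \<forall>i. (F (Suc i), F i) \<in> {(J :: ('v, 'k) mpolys set, I). homogeneous_ideal I \<and> homogeneous_ideal J \<and> I \<subset> J}"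
  then obtain I :: "nat \<Rightarrow> ('v, 'k) mpolys set"
    where "\<forall>i. (I (Suc i), I i) \<in> {(J, I). homogeneous_ideal I \<and> homogeneous_ideal J \<and> I \<subset> J}" ..
  then have I: "homogeneous_ideal (I i)" "I i \<subset> I (Suc i)" for i by auto
  have mono: "I i \<subseteq> I j" if "i \<le> j" for i j
    using lift_Suc_mono_le[of I] I(2) that by blast
  have idI: "is_ideal (I i)" for i using I(1) by (simp add: homogeneous_ideal_iff)
  obtain \<iota> :: "'v \<Rightarrow> nat" where \<iota>: "inj \<iota>"
    using finite_imp_inj_to_nat_seg[of "UNIV :: 'v set"] by blast
  \<comment> \<open>The index type \<open>'v\<close> carries no order. Numbering the variables
    transports monomials to \<open>nat \<Rightarrow>\<^sub>0 nat\<close>, whose linear order is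
    compatible with addition.\<close>
  define \<Phi> :: "('v \<Rightarrow>\<^sub>0 nat) \<Rightarrow> (nat \<Rightarrow>\<^sub>0 nat)" where
    "\<Phi> m = (\<Sum>v\<in>UNIV. single (\<iota> v) (lookup m v))" for m
  have \<Phi>_add: "\<Phi> (m + m') = \<Phi> m + \<Phi> m'" for m m'
    by (simp add: \<Phi>_def lookup_add single_add sum.distrib)
  have \<Phi>_lookup: "lookup (\<Phi> m) (\<iota> v) = lookup m v" for m v
  proof -
    have "lookup (\<Phi> m) (\<iota> v) = (\<Sum>w\<in>UNIV. if w = v then lookup m w else 0)"
      unfolding \<Phi>_def lookup_sum
      by (rule sum.cong) (use \<iota> in \<open>auto simp: lookup_single when_def inj_eq\<close>)
    then show ?thesis by simp
  qed
  have \<Phi>_inj: "m = m'" if "\<Phi> m = \<Phi> m'" for m m'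
    by (rule poly_mapping_eqI) (metis \<Phi>_lookup that)
  define LM :: "('v, 'k) mpolys \<Rightarrow> ('v \<Rightarrow>\<^sub>0 nat) \<Rightarrow> bool" where
    "LM g u \<longleftrightarrow> u \<in> keys g \<and> (\<forall>w\<in>keys g. \<Phi> w \<le> \<Phi> u)" for g u
  have LM_ex: "\<exists>u. LM g u" if "g \<noteq> 0" for g
  proof -
    have "keys g \<noteq> {}" using that by (metis poly_mapping_eqI in_keys_iff empty_iff lookup_zero)
    then have "Max (\<Phi> ` keys g) \<in> \<Phi> ` keys g" by (intro Max_in) auto
    then obtain u where "u \<in> keys g" "\<Phi> u = Max (\<Phi> ` keys g)" by auto
    then show ?thesis unfolding LM_def by (intro exI[of _ u]) auto
  qed
  define Q where "Q i u \<longleftrightarrow> (\<exists>g\<in>I i \<inter> forms (mon_degree u). LM g u)" for i u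
  have "\<exists>u. Q (Suc i) u \<and> \<not> Q i u" for i
  proof -
    obtain t f where f: "f \<in> forms t" "f \<in> I (Suc i)" "f \<notin> I i"
      using exists_form_not_mem[OF I(1)[of "Suc i"] idI[of i]] I(2)[of i] by blast
    let ?S = "{u. \<exists>g\<in>(I (Suc i) - I i) \<inter> forms t. LM g u}"
    have St: "mon_degree u = t" if "u \<in> ?S" for u
      using that by (auto simp: LM_def forms_def)
    have fin: "finite ?S"
      by (rule finite_subset[OF _ finite_monomials[of t]]) (use St in \<open>auto simp: monomials_def\<close>)
    have "f \<noteq> 0" using f(3) idl.subspace_0[OF idI[of i]] by auto
    then obtain u0 where "LM f u0" using LM_ex by blast
    then have u0: "u0 \<in> ?S" using f by blast
    have "Min (\<Phi> ` ?S) \<in> \<Phi> ` ?S" using fin u0 by (intro Min_in) auto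
    then obtain u where u: "Min (\<Phi> ` ?S) = \<Phi> u" "u \<in> ?S" by (rule imageE)
    have umin: "\<Phi> u \<le> \<Phi> w" if "w \<in> ?S" for w
      using fin that unfolding u(1)[symmetric] by (intro Min_le) auto
    obtain g where g: "g \<in> I (Suc i)" "g \<notin> I i" "g \<in> forms t" "LM g u"
      using u(2) by blast
    have "Q (Suc i) u" using g St[OF u(2)] by (auto simp: Q_def)
    moreover have "\<not> Q i u"
    proof
      assume "Q i u"
      then obtain g' where g': "g' \<in> I i" "g' \<in> forms t" "LM g' u"
        using St[OF u(2)] by (auto simp: Q_def)
      \<comment> \<open>This scalar cancels the common leading term at \<open>u\<close>, so that
        \<open>k\<close> is a form of \<open>I (Suc i)\<close> outside \<open>I i\<close> with a
        smaller leading monomial, against the minimality of \<open>u\<close>.\<close>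
      define c where "c = lookup g u / lookup g' u"
      define k where "k = g - psc c g'"
      have cg: "psc c g' \<in> I i" using subspace_ideal[OF idI] g'(1) by (rule pv.subspace_scale)
      have "k \<in> I (Suc i)"
        unfolding k_def using cg g(1) mono[of i "Suc i"] idl.subspace_diff[OF idI] by auto
      moreover have kI: "k \<notin> I i"
      proof
        assume "k \<in> I i"
        then have "k + psc c g' \<in> I i" using cg by (rule idl.subspace_add[OF idI])
        then show False using g(2) by (simp add: k_def)
      qed
      moreover have "k \<in> forms t"
        unfolding k_def using g(3) forms_psc[OF g'(2)] by (rule pv.subspace_diff[OF subspace_forms])
      moreover have "k \<noteq> 0" using kI idl.subspace_0[OF idI[of i]] by auto
      then obtain w where w: "LM k w" using LM_ex by blast
      ultimately have "w \<in> ?S" by blast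
      then have "\<Phi> u \<le> \<Phi> w" by (rule umin)
      moreover have "lookup k u = 0"
        using g'(3) by (simp add: k_def lookup_minus lookup_psc c_def LM_def in_keys_iff)
      then have "w \<noteq> u" using w by (auto simp: LM_def in_keys_iff)
      moreover have "w \<in> keys g \<or> w \<in> keys g'"
        using w by (auto simp: LM_def in_keys_iff k_def lookup_minus lookup_psc)
      then have "\<Phi> w \<le> \<Phi> u" using g(4) g'(3) by (auto simp: LM_def)
      ultimately show False using \<Phi>_inj[of u w] by simp
    qed
    ultimately show ?thesis by blast
  qed
  then obtain u where u: "\<And>i. Q (Suc i) (u i)" "\<And>i. \<not> Q i (u i)" by metis
  obtain i j where ij: "i < j" "\<And>v. lookup (u i) v \<le> lookup (u j) v"
    using dickson[of "\<lambda>i. lookup (u i)"] by blast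
  define m where "m = u j - u i"
  have m: "u j = m + u i"
    unfolding m_def
    by (rule poly_mapping_eqI) (use ij(2) in \<open>simp add: lookup_add lookup_minus\<close>)
  obtain g where g: "g \<in> I (Suc i)" "g \<in> forms (mon_degree (u i))" "LM g (u i)"
    using u(1)[of i] by (auto simp: Q_def)
  let ?h = "single m 1 * g"
  have "?h \<in> I j" using mono[of "Suc i" j] ij(1) g(1) is_ideal_mult[OF idI] by auto
  moreover have "?h \<in> forms (mon_degree (u j))"
    using forms_mult[OF forms_single[OF refl] g(2)] by (simp add: m mon_degree_add)
  moreover have "LM ?h (u j)"
    unfolding LM_def
  proof (intro conjI ballI)
    show "u j \<in> keys ?h"
      using g(3) by (simp add: LM_def in_keys_iff m lookup_single_mult)
    fix w assume "w \<in> keys ?h"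
    then obtain w' where "w = m + w'" "w' \<in> keys g"
      using keys_mult[of "single m 1" g] by (auto split: if_splits)
    then show "\<Phi> w \<le> \<Phi> (u j)" using g(3) by (simp add: m \<Phi>_add LM_def)
  qed
  ultimately have "Q j (u j)" by (auto simp: Q_def)
  then show False using u(2) by blast
qed

section \<open>Dimension\<close>

text \<open>Dual of the exact sequence \<open>S/(I:f)(-a) \<rightarrow> S/I \<rightarrow> S/(I,f)
  \<rightarrow> 0\<close>: contraction by \<open>f\<close> has as kernel the inverse system of
  \<open>insert f G\<close>, and its image lies in that of \<open>H\<close>. Below degree
  \<open>a\<close> the contraction is zero.\<close>

lemma hdim_le_colon:
  assumes f: "f \<in> forms a" and H: "\<And>h. h \<in> H \<Longrightarrow> h * f \<in> ideal_generated G"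
  shows "hdim G t \<le> hdim (insert f G) t + (if a \<le> t then hdim H (t - a) else 0)"
proof -
  have rn: "hdim G t = hdim (insert f G) t + fv.dim (act f ` perp G t)"
    unfolding hdim_def perp_insert
    by (rule fp.rank_nullity_on[OF act_linear subspace_perp fin_spanned_perp])
  show ?thesis
  proof (cases "a \<le> t")
    case True
    have "act f ` perp G t \<subseteq> perp H (t - a)"
    proof (rule image_subsetI)
      fix L assume L: "L \<in> perp G t"
      then have Ld: "L \<in> dual_forms t" and L': "L \<in> perp (ideal_generated G) t"
        by (simp_all add: perp_def[of G] perp_ideal_generated)
      have "act h (act f L) = 0" if "h \<in> H" for h
      proof -
        have "act (h * f) L = 0" using L' H[OF that] unfolding perp_def by blast
        then show ?thesis by (simp only: act_mult)
      qed
      moreover have "act f L \<in> dual_forms (t - a)"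
        using act_dual_forms[OF f, of L "t - a"] Ld True by simp
      ultimately show "act f L \<in> perp H (t - a)" by (simp add: perp_def)
    qed
    then have "fv.dim (act f ` perp G t) \<le> hdim H (t - a)"
      unfolding hdim_def by (rule fv.dim_mono_fin[OF fin_spanned_perp])
    then show ?thesis using rn True by simp
  next
    case False
    have "act f ` perp G t \<subseteq> {0}"
    proof (rule image_subsetI)
      fix L assume "L \<in> perp G t"
      then show "act f L \<in> {0}"
        using act_dual_forms_eq_0[OF f, of L t] False by (simp add: perp_def)
    qed
    moreover have "act f 0 \<in> act f ` perp G t"
      by (rule imageI) (rule fv.subspace_0[OF subspace_perp])
    ultimately have "act f ` perp G t = {0}" by (auto simp: act.zero)
    then show ?thesis using rn False by simp
  qed
qed

lemma is_unit_form_0: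
  fixes f :: "('v::finite, 'k::field) mpolys"
  assumes "f \<in> forms 0" "f \<noteq> 0" "is_ideal I" "f \<in> I"
  shows "I = UNIV"
proof -
  have f: "f = single 0 (lookup f 0)"
    by (rule poly_mapping_eqI) (use assms(1) in \<open>auto simp: lookup_single when_def forms_def in_keys_iff\<close>)
  then have c: "lookup f 0 \<noteq> 0" using assms(2) by auto
  have "single 0 (inverse (lookup f 0)) * f = 1"
    by (subst f) (use c in \<open>simp add: mult_single\<close>)
  then have "1 \<in> I" using is_ideal_mult[OF assms(3,4)] by metis
  then have "g \<in> I" for g using is_ideal_mult[OF assms(3), of 1 g] by simp
  then show ?thesis by blast
qed

lemma perp_eq_0_if_contains_lin:
  assumes "forms 1 \<subseteq> G" "t \<ge> 1"
  shows "perp G t = {0}"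
proof -
  obtain s where s: "t = Suc s" using assms(2) by (cases t) auto
  have "L = 0" if "L \<in> perp G t" for L
    using that dual_forms_Suc_eq_0[of L s] assms(1) forms_var s by (auto simp: perp_def)
  then show ?thesis using fv.subspace_0[OF subspace_perp] by blast
qed

lemma grows_le_if_contains_lin:
  assumes "forms 1 \<subseteq> G"
  shows "grows_le k (hdim G)"
  by (rule grows_le_if_eventually_0[where n = 1]) (simp add: hdim_def perp_eq_0_if_contains_lin[OF assms])

lemma hdim_antimono: "G \<subseteq> H \<Longrightarrow> hdim H t \<le> hdim G t"
  by (rule hdim_le_if_subset) (rule perp_antimono)

text \<open>Modulo a prime, multiplication by \<open>f\<close> is injective, so dually contraction
  by \<open>f\<close> reaches all of \<open>perp P (t - a)\<close>: a functional that it missed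
  would be separated by a form \<open>g\<close> with \<open>g * f \<in> P\<close>, hence
  \<open>g \<in> P\<close>.\<close>

lemma prime_hdim:
  assumes P: "homogeneous_ideal P" "is_prime_ideal P" and f: "f \<in> forms a" "f \<notin> P"
  shows "hdim (insert f P) t + (if a \<le> t then hdim P (t - a) else 0) \<le> hdim P t"
proof (cases "a \<le> t")
  case False
  then show ?thesis using hdim_antimono[of P "insert f P" t] by auto
next
  case True
  have iP: "is_ideal P" and pr: "\<And>a b. a * b \<in> P \<Longrightarrow> a \<in> P \<or> b \<in> P"
    using P(2) by (auto simp: is_prime_ideal_def)
  have rn: "hdim P t = hdim (insert f P) t + fv.dim (act f ` perp P t)"
    unfolding hdim_def perp_insert
    by (rule fp.rank_nullity_on[OF act_linear subspace_perp fin_spanned_perp])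
  let ?M = "act f ` perp P t"
  have M: "fv.subspace ?M" by (rule fp.subspace_image_linear[OF act_linear subspace_perp])
  have Md: "?M \<subseteq> dual_forms (t - a)"
  proof (rule image_subsetI)
    fix L assume "L \<in> perp P t"
    then show "act f L \<in> dual_forms (t - a)"
      using act_dual_forms[OF f(1), of L "t - a"] True by (simp add: perp_def)
  qed
  have "perp P (t - a) \<subseteq> ?M"
  proof (rule subsetI, rule ccontr)
    fix L0 assume L0: "L0 \<in> perp P (t - a)" "L0 \<notin> ?M"
    then have "L0 \<in> dual_forms (t - a)" by (simp add: perp_def)
    then obtain g where g: "g \<in> forms (t - a)" "\<forall>L\<in>?M. act g L = 0" "act g L0 0 = 1"
      using separate_dual_form[OF M Md _ L0(2)] by blast
    have gf: "g * f \<in> forms t" using forms_mult[OF g(1) f(1)] True by simp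
    have "g * f \<in> P"
    proof (rule ccontr)
      assume "g * f \<notin> P"
      then obtain L where L: "L \<in> dual_forms t" "\<forall>h\<in>P \<inter> forms t. act h L = 0" "act (g * f) L \<noteq> 0"
        using separate_form[OF subspace_ideal[OF iP] gf] by blast
      have "L \<in> perp P t" unfolding perp_homogeneous[OF P(1)] using L by (simp add: perp_def)
      then have "act g (act f L) = 0" using g(2) by blast
      then show False using L(3) by (simp add: act_mult)
    qed
    then have "g \<in> P" using pr f(2) by blast
    then have "act g L0 = 0" using L0(1) by (simp add: perp_def)
    then show False using g(3) by simp
  qed
  then have "hdim P (t - a) \<le> fv.dim ?M"
    unfolding hdim_def using fin_spanned_duals[OF Md] by (intro fv.dim_mono_fin)
  then show ?thesis using rn True by simp
qed

lemma not_prime_homogeneous: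
  assumes "homogeneous_ideal I" "\<not> is_prime_ideal I" "I \<noteq> UNIV"
  obtains f g a b where "f \<in> forms a" "g \<in> forms b" "f * g \<in> I" "f \<notin> I" "g \<notin> I"
proof -
  have "\<not> (\<forall>f g s t. f \<in> forms s \<longrightarrow> g \<in> forms t \<longrightarrow> f * g \<in> I \<longrightarrow> f \<in> I \<or> g \<in> I)"
    using is_prime_ideal_homogeneous[OF assms(1,3)] assms(2) by blast
  then show ?thesis using that by blast
qed

text \<open>Both outer ideals in the exact sequence of \<open>f\<close> are strictly larger than
  \<open>I\<close>, the colon ideal because it contains \<open>g\<close>. This drives the Noetherian
  inductions.\<close>

lemma homogeneous_splitting:
  assumes I: "homogeneous_ideal I" and f: "f \<in> forms a" and "g \<in> forms b" "f * g \<in> I" "f \<notin> I" "g \<notin> I"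
  defines "I1 \<equiv> ideal_generated (insert f I)" and "I2 \<equiv> {h. h * f \<in> I}"
  shows "homogeneous_ideal I1" "I \<subset> I1" "homogeneous_ideal I2" "I \<subset> I2"
proof -
  have iI: "is_ideal I" using I by (simp add: homogeneous_ideal_iff)
  show "homogeneous_ideal I1" unfolding I1_def by (rule homogeneous_ideal_insert[OF I f])
  show "homogeneous_ideal I2" unfolding I2_def by (rule homogeneous_ideal_colon[OF I f])
  have "insert f I \<subseteq> I1" unfolding I1_def by (rule idl.span_superset)
  then show "I \<subset> I1" using assms(5) by blast
  have "h * f \<in> I" if "h \<in> I" for h
    using is_ideal_mult[OF iI that, of f] by (simp only: mult.commute)
  moreover have "g * f \<in> I" using assms(4) by (simp only: mult.commute)
  ultimately show "I \<subset> I2" unfolding I2_def using assms(6) by blast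
qed

lemma dense_open_UNIV: "dense_open (UNIV :: ('a \<Rightarrow> 'k::field) set)"
  by (auto simp: dense_open_def)

text \<open>The excluded coefficient vectors form a linear subspace, which a line through a point
  outside meets at most once.\<close>

lemma dense_open_lin_not_mem:
  fixes I :: "('v::finite, 'k::field) mpolys set"
  assumes I: "is_ideal I" and f: "f \<in> forms 1" "f \<notin> I"
  shows "dense_open {a. lin a \<notin> I}"
  unfolding dense_open_def
proof (intro conjI ballI allI)
  have "lin (\<lambda>v. lookup f (single v 1)) \<notin> I"
    unfolding forms_1_eq_lin[OF f(1), symmetric] by (rule f(2))
  then show "{a. lin a \<notin> I} \<noteq> {}" by blast
  note sI = subspace_ideal[OF I]
  fix a v :: "'v \<Rightarrow> 'k" assume "a \<in> {a. lin a \<notin> I}"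
  then have a: "lin a \<notin> I" by simp
  let ?S = "{t. a + sc t v \<notin> {a. lin a \<notin> I}}"
  have "s = t" if st: "s \<in> ?S" "t \<in> ?S" for s t
  proof (rule ccontr)
    assume "s \<noteq> t"
    have s: "lin a + psc s (lin v) \<in> I" and t: "lin a + psc t (lin v) \<in> I"
      using st by (auto simp: lin_add lin_sc)
    have "(lin a + psc s (lin v)) - (lin a + psc t (lin v)) \<in> I"
      by (rule pv.subspace_diff[OF sI s t])
    moreover have "(lin a + psc s (lin v)) - (lin a + psc t (lin v)) = psc (s - t) (lin v)"
      by (simp add: pv.scale_left_diff_distrib)
    ultimately have "psc (inverse (s - t)) (psc (s - t) (lin v)) \<in> I"
      using pv.subspace_scale[OF sI] by metis
    then have "lin v \<in> I" using \<open>s \<noteq> t\<close> by simp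
    then have "psc s (lin v) \<in> I" by (rule pv.subspace_scale[OF sI])
    then have "(lin a + psc s (lin v)) - psc s (lin v) \<in> I" by (rule pv.subspace_diff[OF sI s])
    then show False using a by simp
  qed
  then have "\<exists>s. ?S \<subseteq> {s}" by (cases "?S = {}") blast+
  then show "finite ?S" using finite_subset by blast
qed

text \<open>For a prime ideal any linear form outside it will do. Otherwise the inequality from the
  exact sequence of \<open>f\<close> survives the addition of \<open>lin c\<close> to all ideals
  involved, so a form that is general for \<open>(I, f)\<close> and for \<open>(I : f)\<close> is
  general for \<open>I\<close>. No primary decomposition enters.\<close>

theorem generic_hyperplane_section:
  fixes I :: "('v::finite, 'k::alg_closed_field) mpolys set"
  assumes "homogeneous_ideal I" "grows_le (Suc k) (hdim I)"
  shows "\<exists>A. dense_open A \<and> (\<forall>a\<in>A. grows_le k (hdim (insert (lin a) I)))"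
  using assms
proof (induction I rule: wf_induct_rule[OF wf_homogeneous_ideals])
  case (1 I)
  note I = "1.prems"(1) and gI = "1.prems"(2)
  have iI: "is_ideal I" using I by (simp add: homogeneous_ideal_iff)
  have IH: "\<exists>A. dense_open A \<and> (\<forall>a\<in>A. grows_le k (hdim (insert (lin a) J)))"
    if "homogeneous_ideal J" "I \<subset> J" for J
  proof (rule "1.IH")
    show "(J, I) \<in> {(J, I). homogeneous_ideal I \<and> homogeneous_ideal J \<and> I \<subset> J}"
      using that I by simp
    show "homogeneous_ideal J" by fact
    show "grows_le (Suc k) (hdim J)"
      by (rule grows_le_dominated[OF _ gI, of 0]) (use that(2) in \<open>auto intro: hdim_antimono\<close>)
  qed
  show ?case
  proof (cases "forms 1 \<subseteq> I")
    case True
    have "grows_le k (hdim (insert (lin a) I))" for a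
      by (rule grows_le_if_contains_lin) (use True in blast)
    then show ?thesis using dense_open_UNIV by blast
  next
    case False
    then obtain l where l: "l \<in> forms 1" "l \<notin> I" by blast
    show ?thesis
    proof (cases "is_prime_ideal I")
      case True
      have "grows_le k (hdim (insert (lin a) I))" if "lin a \<notin> I" for a
        by (rule grows_le_diff[OF prime_hdim[OF I True forms_lin that] gI])
      then show ?thesis using dense_open_lin_not_mem[OF iI l] by blast
    next
      case False
      have "I \<noteq> UNIV" using l by blast
      then obtain f g a b where fg: "f \<in> forms a" "g \<in> forms b" "f * g \<in> I" "f \<notin> I" "g \<notin> I"
        by (rule not_prime_homogeneous[OF I False])
      let ?I1 = "ideal_generated (insert f I)" and ?I2 = "{h. h * f \<in> I}"
      note spl = homogeneous_splitting[OF I fg]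
      obtain A1 where "dense_open A1 \<and> (\<forall>c\<in>A1. grows_le k (hdim (insert (lin c) ?I1)))"
        using IH[OF spl(1,2)] ..
      then have A1: "dense_open A1" "\<And>c. c \<in> A1 \<Longrightarrow> grows_le k (hdim (insert (lin c) ?I1))"
        by simp_all
      obtain A2 where "dense_open A2 \<and> (\<forall>c\<in>A2. grows_le k (hdim (insert (lin c) ?I2)))"
        using IH[OF spl(3,4)] ..
      then have A2: "dense_open A2" "\<And>c. c \<in> A2 \<Longrightarrow> grows_le k (hdim (insert (lin c) ?I2))"
        by simp_all
      have "grows_le k (hdim (insert (lin c) I))" if c: "c \<in> A1 \<inter> A2" for c
      proof (rule grows_le_add_shift)
        have "insert (lin c) I \<subseteq> ideal_generated (insert (lin c) I)"
          by (rule idl.span_superset)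
        then have s: "lin c \<in> ideal_generated (insert (lin c) I)" "I \<subseteq> ideal_generated (insert (lin c) I)" by auto
        have "h * f \<in> ideal_generated (insert (lin c) I)" if "h \<in> insert (lin c) ?I2" for h
        proof (cases "h = lin c")
          case True
          have "f * lin c \<in> ideal_generated (insert (lin c) I)" using s(1) by (rule idl.span_scale)
          then show ?thesis using True by (simp only: mult.commute)
        next
          case False
          then show ?thesis using that s(2) by blast
        qed
        then show "hdim (insert (lin c) I) t \<le> hdim (insert f (insert (lin c) I)) t
            + (if a \<le> t then hdim (insert (lin c) ?I2) (t - a) else 0)" for t
          by (rule hdim_le_colon[OF fg(1)])
        have "perp (insert f (insert (lin c) I)) t \<subseteq> perp (insert (lin c) ?I1) t" for t
          unfolding perp_insert[of "lin c" ?I1] perp_ideal_generated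
          by (auto simp: perp_def)
        then show "grows_le k (hdim (insert f (insert (lin c) I)))"
          using c by (intro grows_le_dominated[OF _ A1(2), of 0] hdim_le_if_subset) auto
        show "grows_le k (hdim (insert (lin c) ?I2))" using c A2(2) by blast
      qed
      then show ?thesis using dense_open_Int[OF A1(1) A2(1)] by blast
    qed
  qed
qed

text \<open>When a non-prime ideal is split, a growth bound common to both larger ideals would pass
  to the original one; so one of the two keeps the growth.\<close>

theorem exists_prime_of_growth:
  fixes I :: "('v::finite, 'k::field) mpolys set"
  assumes "homogeneous_ideal I" "\<not> grows_le k (hdim I)"
  shows "\<exists>P. homogeneous_ideal P \<and> is_prime_ideal P \<and> I \<subseteq> P \<and> \<not> grows_le k (hdim P)"
  using assms
proof (induction I rule: wf_induct_rule[OF wf_homogeneous_ideals])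
  case (1 I)
  note I = "1.prems"(1) and gI = "1.prems"(2)
  have IH: "\<exists>P. homogeneous_ideal P \<and> is_prime_ideal P \<and> I \<subseteq> P \<and> \<not> grows_le k (hdim P)"
    if "homogeneous_ideal J" "I \<subset> J" "\<not> grows_le k (hdim J)" for J
  proof -
    have "\<exists>P. homogeneous_ideal P \<and> is_prime_ideal P \<and> J \<subseteq> P \<and> \<not> grows_le k (hdim P)"
      by (rule "1.IH") (use that I in auto)
    then show ?thesis using that(2) by blast
  qed
  show ?case
  proof (cases "is_prime_ideal I")
    case True
    then show ?thesis using I gI by blast
  next
    case False
    have "I \<noteq> UNIV" using gI grows_le_if_contains_lin[of I k] by blast
    then obtain f g a b where fg: "f \<in> forms a" "g \<in> forms b" "f * g \<in> I" "f \<notin> I" "g \<notin> I"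
      by (rule not_prime_homogeneous[OF I False])
    let ?I1 = "ideal_generated (insert f I)" and ?I2 = "{h. h * f \<in> I}"
    note spl = homogeneous_splitting[OF I fg]
    have "\<not> grows_le k (hdim ?I1) \<or> \<not> grows_le k (hdim ?I2)"
    proof (rule ccontr)
      assume "\<not> ?thesis"
      then have g: "grows_le k (hdim (insert f I))" "grows_le k (hdim ?I2)"
        by (simp_all add: hdim_ideal_generated)
      have "h * f \<in> ideal_generated I" if "h \<in> ?I2" for h using that idl.span_superset by blast
      from hdim_le_colon[OF fg(1) this] g have "grows_le k (hdim I)" by (rule grows_le_add_shift)
      then show False using gI by blast
    qed
    then show ?thesis using IH[OF spl(1,2)] IH[OF spl(3,4)] by blast
  qed
qed

lemma exists_lin_not_mem:
  assumes "\<not> grows_le k (hdim I)"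
  obtains a where "lin a \<notin> I"
proof -
  obtain f where f: "f \<in> forms 1" "f \<notin> I"
    using assms grows_le_if_contains_lin[of I k] by blast
  have "lin (\<lambda>v. lookup f (single v 1)) \<notin> I"
    unfolding forms_1_eq_lin[OF f(1), symmetric] by (rule f(2))
  then show ?thesis by (rule that)
qed

text \<open>Adding to a prime a linear form outside it costs at most one order of growth, and every
  prime over the result is strictly larger.\<close>

theorem prime_chain_of_growth:
  fixes I :: "('v::finite, 'k::field) mpolys set"
  assumes "homogeneous_ideal I" "\<not> grows_le k (hdim I)"
  shows "\<exists>P. (\<forall>i\<le>k. P i \<in> Proj_points \<and> I \<subseteq> P i) \<and> (\<forall>i<k. P i \<subset> P (Suc i))"
  using assms
proof (induction k arbitrary: I)
  case 0
  obtain P where P: "homogeneous_ideal P" "is_prime_ideal P" "I \<subseteq> P" "\<not> grows_le 0 (hdim P)"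
    using exists_prime_of_growth[OF 0] by blast
  obtain a where "lin a \<notin> P" using exists_lin_not_mem[OF P(4)] .
  then have "P \<in> Proj_points" using P forms_lin[of a] by (auto simp: Proj_points_def)
  then show ?case using P(3) by (intro exI[of _ "\<lambda>_. P"]) simp
next
  case (Suc k)
  obtain P where P: "homogeneous_ideal P" "is_prime_ideal P" "I \<subseteq> P" "\<not> grows_le (Suc k) (hdim P)"
    using exists_prime_of_growth[OF Suc.prems] by blast
  obtain a where a: "lin a \<notin> P" using exists_lin_not_mem[OF P(4)] .
  then have PP: "P \<in> Proj_points" using P forms_lin[of a] by (auto simp: Proj_points_def)
  let ?J = "ideal_generated (insert (lin a) P)"
  have J: "homogeneous_ideal ?J" by (rule homogeneous_ideal_insert[OF P(1) forms_lin])
  have iP: "is_ideal P" using P(1) by (simp add: homogeneous_ideal_iff)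
  have "h * lin a \<in> ideal_generated P" if "h \<in> P" for h
    using is_ideal_mult[OF iP that, of "lin a"] idl.span_superset[of P]
    by (simp only: mult.commute) blast
  from hdim_le_colon[OF forms_lin this]
  have "\<not> grows_le k (hdim ?J)"
    using P(4) grows_le_Suc[of "hdim P" "hdim (insert (lin a) P)" 1 k]
    by (auto simp: hdim_ideal_generated)
  then obtain Q where Q: "\<And>i. i \<le> k \<Longrightarrow> Q i \<in> Proj_points" "\<And>i. i \<le> k \<Longrightarrow> ?J \<subseteq> Q i"
    "\<And>i. i < k \<Longrightarrow> Q i \<subset> Q (Suc i)"
    using Suc.IH[OF J] by blast
  have sup: "insert (lin a) P \<subseteq> ?J" by (rule idl.span_superset)
  have PQ: "P \<subset> Q i" if "i \<le> k" for i using Q(2)[OF that] sup a by blast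
  show ?case
  proof (intro exI[of _ "case_nat P Q"] conjI allI impI)
    fix i assume i: "i \<le> Suc k"
    show "case_nat P Q i \<in> Proj_points" using PP Q(1) i by (cases i) auto
    show "I \<subseteq> case_nat P Q i" using P(3) PQ[of "i - 1"] i by (cases i) auto
  next
    fix i assume i: "i < Suc k"
    show "case_nat P Q i \<subset> case_nat P Q (Suc i)"
      using PQ[of 0] Q(3)[of "i - 1"] i by (cases i) auto
  qed
qed

text \<open>The powers of a linear form outside \<open>P\<close> stay outside \<open>P\<close>. Such
  a form exists, since an ideal containing all variables contains all forms of positive
  degree.\<close>

lemma hdim_pos:
  assumes P: "P \<in> Proj_points"
  shows "hdim P t \<ge> 1"
proof -
  have P': "homogeneous_ideal P" "is_prime_ideal P" "\<not> (\<Union>t\<in>{1..}. forms t) \<subseteq> P"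
    using P by (auto simp: Proj_points_def)
  have iP: "is_ideal P" and pr: "\<And>a b. a * b \<in> P \<Longrightarrow> a \<in> P \<or> b \<in> P" and "P \<noteq> UNIV"
    using P'(2) by (auto simp: is_prime_ideal_def)
  have "\<not> forms 1 \<subseteq> P"
  proof
    assume *: "forms 1 \<subseteq> P"
    obtain f s where f: "f \<in> forms s" "s \<ge> 1" "f \<notin> P" using P'(3) by auto
    obtain L where L: "L \<in> dual_forms s" "\<forall>h\<in>P \<inter> forms s. act h L = 0" "act f L \<noteq> 0"
      using separate_form[OF subspace_ideal[OF iP] f(1,3)] by blast
    have "L \<in> perp P s" unfolding perp_homogeneous[OF P'(1)] using L by (simp add: perp_def)
    then have "L = 0" using perp_eq_0_if_contains_lin[OF * f(2)] by simp
    then show False using L(3) by (simp add: act.zero)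
  qed
  then obtain l where l: "l \<in> forms 1" "l \<notin> P" by blast
  have lt: "l ^ t \<in> forms t \<and> l ^ t \<notin> P"
  proof (induction t)
    case 0
    have "1 \<notin> P"
    proof
      assume "1 \<in> P"
      then have "g \<in> P" for g using is_ideal_mult[OF iP, of 1 g] by simp
      then show False using \<open>P \<noteq> UNIV\<close> by blast
    qed
    moreover have "(1 :: ('a, 'b) mpolys) \<in> forms 0" by (auto simp: forms_def)
    ultimately show ?case by simp
  next
    case (Suc t)
    then show ?case using forms_mult[OF l(1), of "l ^ t" t] pr l(2) by auto
  qed
  then obtain L where L: "L \<in> dual_forms t" "\<forall>h\<in>P \<inter> forms t. act h L = 0" "act (l ^ t) L \<noteq> 0"
    using separate_form[OF subspace_ideal[OF iP]] by blast
  have "L \<in> perp P t" unfolding perp_homogeneous[OF P'(1)] using L by (simp add: perp_def)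
  moreover have "L \<noteq> 0" using L(3) by (auto simp: act.zero)
  ultimately have "perp P t \<noteq> {0}" by blast
  then have "hdim P t \<noteq> 0"
    unfolding hdim_def using fv.dim_0_iff_fin[OF subspace_perp fin_spanned_perp] by blast
  then show ?thesis by simp
qed

text \<open>Starting from the largest prime and going down: a form in the difference of two
  consecutive primes is a nonzerodivisor modulo the smaller one, so each step adds one order of
  growth.\<close>

theorem growth_of_prime_chain:
  assumes P: "\<And>i. i \<le> e \<Longrightarrow> P i \<in> Proj_points" "\<And>i. i < e \<Longrightarrow> P i \<subset> P (Suc i)"
  shows "\<not> grows_le e (hdim (P 0))"
proof -
  have "i \<le> e \<Longrightarrow> \<not> grows_le i (hdim (P (e - i)))" for i
  proof (induction i)
    case 0
    then show ?case using hdim_pos[OF P(1)[of e]] not_grows_le_0[of 0 "hdim (P e)"] by simp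
  next
    case (Suc i)
    define j where "j = e - Suc i"
    have j: "j < e" "e - i = Suc j" using Suc.prems by (auto simp: j_def)
    have Pj: "homogeneous_ideal (P j)" "is_prime_ideal (P j)" and Pj': "homogeneous_ideal (P (Suc j))" "is_prime_ideal (P (Suc j))"
      using P(1)[of j] P(1)[of "Suc j"] j(1) by (auto simp: Proj_points_def)
    have i1: "is_ideal (P j)" and i2: "is_ideal (P (Suc j))" "P (Suc j) \<noteq> UNIV"
      using Pj(2) Pj'(2) by (auto simp: is_prime_ideal_def)
    obtain a f where f: "f \<in> forms a" "f \<in> P (Suc j)" "f \<notin> P j"
      using exists_form_not_mem[OF Pj'(1) i1] P(2)[OF j(1)] by blast
    have "f \<noteq> 0" using f(3) idl.subspace_0[OF i1] by auto
    then have "a \<noteq> 0" using is_unit_form_0[of f "P (Suc j)"] f(1,2) i2 by auto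
    have "hdim (P (Suc j)) t \<le> hdim (insert f (P j)) t" for t
      by (rule hdim_antimono) (use f(2) P(2)[OF j(1)] in blast)
    then have "hdim (P (Suc j)) t + (if a \<le> t then hdim (P j) (t - a) else 0) \<le> hdim (P j) t" for t
      using prime_hdim[OF Pj f(1,3), of t] by (meson add_le_mono1 le_trans)
    then have "grows_le (Suc i) (hdim (P j)) \<Longrightarrow> grows_le i (hdim (P (Suc j)))"
      by (rule grows_le_diff)
    then show ?case using Suc j by (auto simp: j_def)
  qed
  from this[of e] show ?thesis by simp
qed

section \<open>Maximal and submaximal growth\<close>

abbreviation forms_upto :: "nat \<Rightarrow> ('v::finite, 'k::field) mpolys set" where
  "forms_upto n \<equiv> \<Union>s\<le>n. forms s"

lemma forms_subset_upto: "m \<le> n \<Longrightarrow> forms m \<subseteq> forms_upto n"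
  by (rule UN_upper) simp

lemma forms_upto_insert_lin: "n \<ge> 1 \<Longrightarrow> G \<subseteq> forms_upto n \<Longrightarrow> insert (lin a) G \<subseteq> forms_upto n"
  using forms_lin[of a] by auto

lemma hdim_le_insert:
  assumes "f \<in> forms a"
  shows "hdim G t \<le> hdim (insert f G) t + (if a \<le> t then hdim G (t - a) else 0)"
proof (rule hdim_le_colon[OF assms])
  fix h assume "h \<in> G"
  then have "h \<in> ideal_generated G" by (rule idl.span_base)
  then have "f * h \<in> ideal_generated G" by (rule idl.span_scale)
  then show "h * f \<in> ideal_generated G" by (simp only: mult.commute)
qed

lemma grows_le_insert:
  assumes "f \<in> forms a" "a \<ge> 1" "grows_le k (hdim (insert f G))"
  shows "grows_le (Suc k) (hdim G)"
  by (rule grows_le_Suc[OF hdim_le_insert[OF assms(1)] assms(2,3)])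

lemma grows_le_perp_subset:
  assumes "\<And>t. n \<le> t \<Longrightarrow> perp G t \<subseteq> perp H t" "grows_le k (hdim H)"
  shows "grows_le k (hdim G)"
  by (rule grows_le_dominated[OF hdim_le_if_subset[OF assms(1)] assms(2)])

lemma grows_le_antimono: "G \<subseteq> H \<Longrightarrow> grows_le k (hdim G) \<Longrightarrow> grows_le k (hdim H)"
  by (rule grows_le_perp_subset[of 0]) (rule perp_antimono)

lemma perp_insert_lin: "perp (insert (lin a) G) t = ker (perp G t) a"
  by (simp add: perp_insert ker_def)

lemma hdim_section:
  fixes G :: "('v::finite, 'k::alg_closed_field) mpolys set"
  assumes "n \<ge> 1" "G \<subseteq> forms_upto n"
  shows "hdim (insert (lin a) G) (Suc n) = fv.dim (prolong n (ker (perp G n) a))"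
    and "hdim G (Suc n) = hdim (insert (lin a) G) (Suc n) + fv.dim (act (lin a) ` prolong n (perp G n))"
    and "fv.dim (act (lin a) ` prolong n (perp G n)) \<le> hdim G n"
    and "hdim G (Suc n) \<le> mac_up n (hdim G n)"
proof -
  have pS: "perp G (Suc n) = prolong n (perp G n)" by (rule perp_Suc[OF assms(2)]) simp
  show 1: "hdim (insert (lin a) G) (Suc n) = fv.dim (prolong n (ker (perp G n) a))"
    unfolding hdim_def perp_insert_lin pS ker_prolong[OF assms(1)] ..
  show "hdim G (Suc n) = hdim (insert (lin a) G) (Suc n) + fv.dim (act (lin a) ` prolong n (perp G n))"
    unfolding 1 unfolding hdim_def pS by (rule dim_prolong(1)[OF assms(1) subspace_perp perp_subset])
  show "fv.dim (act (lin a) ` prolong n (perp G n)) \<le> hdim G n"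
    unfolding hdim_def by (rule dim_prolong(3)[OF assms(1) subspace_perp perp_subset])
  show "hdim G (Suc n) \<le> mac_up n (hdim G n)"
    unfolding hdim_def pS by (rule macaulay_bound[OF assms(1) subspace_perp perp_subset])
qed

lemma generic_section:
  fixes G :: "('v::finite, 'k::alg_closed_field) mpolys set"
  assumes G: "G \<subseteq> forms_upto n" and "grows_le (Suc k) (hdim G)"
  shows "\<exists>A. dense_open A \<and> (\<forall>a\<in>A. grows_le k (hdim (insert (lin a) G)))"
proof -
  have "homogeneous_ideal (ideal_generated G)"
    unfolding homogeneous_ideal_def using G by (intro exI[of _ G]) auto
  moreover have "hdim (insert (lin a) (ideal_generated G)) = hdim (insert (lin a) G)" for a
    by (simp add: hdim_def perp_insert_lin perp_ideal_generated fun_eq_iff)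
  ultimately show ?thesis
    using generic_hyperplane_section[of "ideal_generated G" k] assms(2)
    by (simp add: hdim_ideal_generated)
qed

lemma dense_open_hdim_section:
  fixes G :: "('v::finite, 'k::alg_closed_field) mpolys set"
  assumes "n \<ge> 1"
  shows "dense_open {a. hdim (insert (lin a) G) n \<le> green_low n (hdim G n)}"
  using dense_open_green[OF assms subspace_perp perp_subset, of G]
  by (simp add: hdim_def perp_insert_lin)

lemma choose_add_Suc: "n \<ge> 1 \<Longrightarrow> (n + Suc e) choose n = ((n + e) choose n) + ((n + e) choose (n - 1))"
  by (cases n) auto

text \<open>By Green's bound and \<open>green_low_less_choose\<close> a general section satisfies
  the hypothesis with \<open>e\<close> lowered by one. At \<open>e = 0\<close> the inverse system is
  zero in degree \<open>n\<close> and therefore in all later degrees.\<close>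

theorem growth_upper_bound:
  fixes G :: "('v::finite, 'k::alg_closed_field) mpolys set"
  assumes "n \<ge> 1" "G \<subseteq> forms_upto n" "hdim G n < (n + e) choose n"
  shows "grows_le e (hdim G)"
  using assms(2,3)
proof (induction e arbitrary: G)
  case 0
  then have p: "perp G n = {0}"
    using fv.dim_0_iff_fin[OF subspace_perp fin_spanned_perp, of G n] by (simp add: hdim_def)
  have "perp G t = {0}" if "n \<le> t" for t
    using that
  proof (induction t rule: dec_induct)
    case base
    show ?case by (rule p)
  next
    case (step t)
    then show ?case using perp_Suc[OF 0(1) step(1)] by (simp only: prolong_zero)
  qed
  then show ?case by (intro grows_le_if_eventually_0[of n]) (simp add: hdim_def)
next
  case (Suc e)
  obtain a where a: "hdim (insert (lin a) G) n \<le> green_low n (hdim G n)"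
    using dense_open_hdim_section[OF assms(1), of G] unfolding dense_open_def by blast
  have "green_low n (hdim G n) < (n + Suc e - 1) choose n"
    using Suc.prems(2) by (intro green_low_less_choose[OF assms(1)]) auto
  then have "grows_le e (hdim (insert (lin a) G))"
    using a by (intro Suc.IH forms_upto_insert_lin[OF assms(1) Suc.prems(1)]) simp
  then show ?case by (rule grows_le_insert[OF forms_lin order_refl])
qed

section \<open>Evaluation at points and common eigenvectors\<close>

definition mon_eval :: "('v::finite \<Rightarrow> 'k::field) \<Rightarrow> ('v \<Rightarrow>\<^sub>0 nat) \<Rightarrow> 'k" where
  "mon_eval b m = (\<Prod>v\<in>UNIV. b v ^ lookup m v)"

lemma mon_eval_add: "mon_eval b (m + m') = mon_eval b m * mon_eval b m'"
  by (simp add: mon_eval_def lookup_add power_add prod.distrib)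

lemma mon_eval_0 [simp]: "mon_eval b 0 = 1"
  by (simp add: mon_eval_def)

lemma mon_eval_single: "mon_eval b (single v t) = b v ^ t"
proof -
  have "mon_eval b (single v t) = (\<Prod>w\<in>UNIV. if v = w then b w ^ t else 1)"
    unfolding mon_eval_def by (rule prod.cong) (auto simp: lookup_single when_def)
  then show ?thesis by (simp add: prod.delta')
qed

definition eval_at :: "('v::finite \<Rightarrow> 'k::field) \<Rightarrow> nat \<Rightarrow> ('v \<Rightarrow>\<^sub>0 nat) \<Rightarrow> 'k" where
  "eval_at b t = (\<lambda>m. if mon_degree m = t then mon_eval b m else 0)"

lemma eval_at_dual_forms: "eval_at b t \<in> dual_forms t"
  by (simp add: eval_at_def dual_forms_def)

lemma act_var_eval_at: "act (var v) (eval_at b (Suc t)) = sc (b v) (eval_at b t)"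
  by (auto simp: fun_eq_iff act_var eval_at_def sc_def mon_degree_add mon_eval_add mon_eval_single)

text \<open>The contraction by \<open>lin a\<close> satisfies the same equations one degree lower,
  so it is a multiple of the evaluation at \<open>b\<close>; the hypothesis recovers the values of
  \<open>L\<close> from it variable by variable.\<close>

lemma eigenvector_eq_eval_at:
  assumes "L \<in> dual_forms n" "\<And>v. act (var v) L = sc (b v) (act (lin a) L)"
  shows "\<exists>c. L = sc c (eval_at b n)"
  using assms
proof (induction n arbitrary: L)
  case 0
  then show ?case by (intro exI[of _ "L 0"]) (auto simp: fun_eq_iff sc_def eval_at_def dual_forms_def)
next
  case (Suc n)
  let ?L = "act (lin a) L"
  have "?L \<in> dual_forms n" by (rule act_lin_dual_forms[OF Suc.prems(1)])
  moreover have "act (var v) ?L = sc (b v) (act (lin a) ?L)" for v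
    unfolding act_commute[of "var v"] Suc.prems(2) act_sc_right ..
  ultimately obtain c where c: "?L = sc c (eval_at b n)" using Suc.IH by blast
  have "L m = sc c (eval_at b (Suc n)) m" for m
  proof (cases "mon_degree m = Suc n")
    case True
    then obtain v m' where m: "m = single v 1 + m'" "mon_degree m' = n" by (rule mon_degree_Suc)
    have "L m = act (var v) L m'" by (simp add: act_var m(1))
    also have "\<dots> = b v * (c * mon_eval b m')"
      unfolding Suc.prems(2) c using m(2) by (simp add: sc_def eval_at_def)
    also have "\<dots> = sc c (eval_at b (Suc n)) m"
      using m by (simp add: sc_def eval_at_def mon_degree_add mon_eval_add mon_eval_single)
    finally show ?thesis .
  next
    case False
    then show ?thesis using Suc.prems(1) by (simp add: dual_forms_def sc_def eval_at_def)
  qed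
  then show ?case by blast
qed

lemma dim_le_1_line:
  assumes "fv.fin_spanned V" "fv.dim V \<le> 1"
  shows "\<exists>l. V \<subseteq> range (\<lambda>c. sc c l)"
proof -
  obtain B where B: "B \<subseteq> V" "fv.independent B" "V \<subseteq> fv.span B" "card B = fv.dim V" "finite B"
    using fv.fin_spanned_basis[OF assms(1)] by metis
  have "\<exists>l. B \<subseteq> {l}"
  proof (cases "B = {}")
    case False
    then have "card B = 1"
      using B(4,5) assms(2) by (metis card_gt_0_iff le_antisym less_eq_Suc_le One_nat_def)
    then show ?thesis by (metis card_1_singletonE order_refl)
  qed simp
  then obtain l where "B \<subseteq> {l}" ..
  then have "V \<subseteq> fv.span {l}" using B(3) fv.span_mono by blast
  then show ?thesis unfolding fv.span_singleton by blast
qed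

text \<open>A common eigenvector of the operators \<open>x\<^sub>v / l\<close> on \<open>\<Lambda>\<close> is the evaluation of forms at a point
  of the base locus.\<close>

lemma point_of_bijective_multiplication:
  fixes G :: "('v::finite, 'k::alg_closed_field) mpolys set"
  assumes "n \<ge> 1" and G: "G \<subseteq> forms_upto n" and ne: "hdim G n \<ge> 1"
    and K: "hdim (insert (lin a) G) n \<le> 1"
    and inj: "hdim (insert (lin a) G) (Suc n) = 0"
    and surj: "act (lin a) ` prolong n (perp G n) = perp G n"
  shows "\<not> grows_le 0 (hdim G)"
proof -
  define \<Lambda> where "\<Lambda> = perp G n"
  have sub: "fv.subspace \<Lambda>" "\<Lambda> \<subseteq> dual_forms n"
    by (simp_all add: \<Lambda>_def subspace_perp perp_subset)
  note fin = fin_spanned_duals[OF sub(2)]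
  have P: "fv.subspace (prolong n \<Lambda>)" by (rule subspace_prolong[OF sub])
  have "fv.dim (ker (prolong n \<Lambda>) a) = 0"
    using inj hdim_section(1)[OF assms(1) G, of a]
    by (simp only: ker_prolong[OF assms(1)] \<Lambda>_def)
  then have k0: "ker (prolong n \<Lambda>) a = {0}"
    using fv.dim_0_iff_fin[OF subspace_ker[OF P] fv.fin_spanned_subset[OF fin_spanned_prolong ker_subset]] by blast
  have "inj_on (act (lin a)) (prolong n \<Lambda>)"
    unfolding fp.linear_inj_on_iff_eq_0[OF act_linear P] using k0 by (auto simp: ker_def)
  then obtain g where g: "Vector_Spaces.linear sc sc g" "\<forall>M\<in>prolong n \<Lambda>. g (act (lin a) M) = M"
    using fp.linear_exists_left_inverse_on[OF act_linear P] by blast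
  have gL: "g L \<in> prolong n \<Lambda> \<and> act (lin a) (g L) = L" if "L \<in> \<Lambda>" for L
  proof -
    have "L \<in> act (lin a) ` prolong n \<Lambda>" using surj that by (simp only: \<Lambda>_def)
    then obtain M where "L = act (lin a) M" "M \<in> prolong n \<Lambda>" by (rule imageE)
    then show ?thesis using g(2) by simp
  qed
  define A where "A v L = act (var v) (g L)" for v L
  have A: "Vector_Spaces.linear sc sc (A v)" for v
  proof -
    have "A v = act (var v) \<circ> g" by (simp add: A_def fun_eq_iff)
    then show ?thesis using Vector_Spaces.linear_compose[OF g(1) act_linear] by (simp only:)
  qed
  have A\<Lambda>: "A v L \<in> \<Lambda>" if "L \<in> \<Lambda>" for v L
    using gL[OF that] by (simp add: A_def prolong_def)
  have kA: "fv.fin_spanned (ker \<Lambda> a)" by (rule fv.fin_spanned_subset[OF fin ker_subset])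
  have "fv.dim (ker \<Lambda> a) \<le> 1" using K by (simp add: hdim_def perp_insert_lin \<Lambda>_def)
  then obtain l where l: "ker \<Lambda> a \<subseteq> range (\<lambda>c. sc c l)"
    using dim_le_1_line[OF kA] by blast
  \<comment> \<open>Contraction by \<open>lin a\<close> turns both products into
    \<open>act (var i) (act (var j) (g L))\<close>, which is symmetric. Hence the commutator lies in
    the kernel of \<open>lin a\<close> on \<open>\<Lambda>\<close>, which is contained in a
    line.\<close>
  have comm: "A i (A j L) - A j (A i L) \<in> range (\<lambda>c. sc c l)" if L: "L \<in> \<Lambda>" for i j L
  proof -
    have e: "act (lin a) (A i (A j L)) = act (var i) (act (var j) (g L))" for i j
      using gL[OF A\<Lambda>[OF L, of j]] by (simp add: A_def act_commute[of "lin a"])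
    have "act (lin a) (A i (A j L) - A j (A i L)) = 0"
      unfolding act.diff e by (simp add: act_commute[of "var i"])
    moreover have "A i (A j L) - A j (A i L) \<in> \<Lambda>"
      using A\<Lambda> L sub(1) by (intro fv.subspace_diff) auto
    ultimately show ?thesis using l by (auto simp: ker_def)
  qed
  have ne0: "\<Lambda> \<noteq> {0}"
  proof
    assume "\<Lambda> = {0}"
    then have "fv.dim \<Lambda> = 0" by (simp only: fv.dim_zero_subspace)
    then show False using ne unfolding hdim_def \<Lambda>_def by linarith
  qed
  have "\<exists>u\<in>\<Lambda>. u \<noteq> 0 \<and> (\<forall>i. \<exists>c. A i u = sc c u)"
    by (rule common_eigenvector[OF fv.vector_space_axioms A sub(1) fin ne0 _ comm])
      (rule image_subsetI, rule A\<Lambda>)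
  then obtain L where L: "L \<in> \<Lambda>" "L \<noteq> 0" "\<forall>i. \<exists>c. A i L = sc c L"
    by blast
  from choice[OF L(3)] obtain b where b': "\<forall>v. A v L = sc (b v) L" ..
  then have b: "A v L = sc (b v) L" for v by (rule spec)
  have gLa: "act (lin a) (g L) = L" using gL[OF L(1)] by simp
  have "act (var v) L = sc (b v) (act (lin a) L)" for v
  proof -
    have "act (var v) L = act (lin a) (A v L)"
      unfolding A_def act_commute[of "lin a"] gLa ..
    then show ?thesis by (simp add: b act_sc_right)
  qed
  from eigenvector_eq_eval_at[OF subsetD[OF sub(2) L(1)] this]
  obtain c where c: "L = sc c (eval_at b n)" ..
  have "c \<noteq> 0"
  proof
    assume "c = 0"
    then have "L = 0" unfolding c by (simp only: fv.scale_zero_left)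
    then show False using L(2) by contradiction
  qed
  then have "sc (inverse c) L = eval_at b n" 
    unfolding c fv.scale_scale left_inverse[OF \<open>c \<noteq> 0\<close>] by simp
  moreover have "sc (inverse c) L \<in> \<Lambda>" by (rule fv.subspace_scale[OF sub(1) L(1)])
  ultimately have ev0: "eval_at b n \<in> perp G n" by (simp only: \<Lambda>_def)
  \<comment> \<open>The zero vector is not a point of projective space. It is ruled out because
    \<open>lin a\<close> is a combination of the variables and contracts \<open>g L\<close> to
    \<open>L\<close>.\<close>
  have "\<exists>v. b v \<noteq> 0"
  proof (rule ccontr)
    assume "\<not> ?thesis"
    then have "act (var v) (g L) = 0" for v using b[of v] by (simp add: A_def)
    then have "act (lin a) (g L) = 0" by (simp add: act_lin)
    then show False using gLa L(2) by simp
  qed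
  then obtain v where v: "b v \<noteq> 0" ..
  have ev: "eval_at b t \<in> perp G t" if "n \<le> t" for t
    using that
  proof (induction t rule: dec_induct)
    case (step t)
    then show ?case
      unfolding perp_Suc[OF G step(1)] prolong_def
      by (simp add: eval_at_dual_forms act_var_eval_at fv.subspace_scale[OF subspace_perp])
  qed (rule ev0)
  have "hdim G t \<ge> 1" if "n \<le> t" for t
  proof -
    have "eval_at b t (single v t) \<noteq> 0" using v by (simp add: eval_at_def mon_eval_single)
    then have "eval_at b t \<noteq> 0" by auto
    then have "perp G t \<noteq> {0}" using ev[OF that] by blast
    then have "fv.dim (perp G t) \<noteq> 0"
      using fv.dim_0_iff_fin[OF subspace_perp fin_spanned_perp] by blast
    then show ?thesis unfolding hdim_def by linarith
  qed
  then show ?thesis by (rule not_grows_le_0)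
qed

lemma image_prolong_eq:
  fixes G :: "('v::finite, 'k::alg_closed_field) mpolys set"
  assumes "n \<ge> 1" "hdim G n \<le> fv.dim (act (lin a) ` prolong n (perp G n))"
  shows "act (lin a) ` prolong n (perp G n) = perp G n"
proof (rule fv.subspace_eq_if_dim_le)
  show "fv.subspace (act (lin a) ` prolong n (perp G n))"
    by (rule fp.subspace_image_linear[OF act_linear subspace_prolong[OF subspace_perp perp_subset]])
  show "act (lin a) ` prolong n (perp G n) \<subseteq> perp G n"
    by (rule dim_prolong(2)[OF assms(1) subspace_perp perp_subset])
  show "fv.fin_spanned (perp G n)" by (rule fin_spanned_perp)
  show "fv.dim (perp G n) \<le> fv.dim (act (lin a) ` prolong n (perp G n))"
    using assms(2) by (simp add: hdim_def)
qed

lemma choose_add_mono: "d \<le> d' \<Longrightarrow> (n + d) choose n \<le> (n + d') choose n"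
  by (intro binomial_right_mono) simp

text \<open>Equality in Macaulay's bound forces equality in Green's bound for a general section,
  which again has maximal growth. The descent ends at \<open>hdim G n \<le> n\<close>, where a
  general linear form has zero kernel and maps the prolongation bijectively onto
  \<open>perp G n\<close>.\<close>

theorem maximal_growth:
  fixes G :: "('v::finite, 'k::alg_closed_field) mpolys set"
  assumes n: "n \<ge> 1" and "G \<subseteq> forms_upto n" "(n + d) choose n \<le> hdim G n"
    and "mac_up n (hdim G n) \<le> hdim G (Suc n)"
  shows "\<not> grows_le d (hdim G)"
  using assms(2-)
proof (induction "hdim G n" arbitrary: G d rule: less_induct)
  case less
  note G = less.prems(1)
  let ?c = "hdim G n"
  have "0 < (n + d) choose n" by simp
  then have c1: "?c \<ge> 1" using less.prems(2) by linarith
  show ?case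
  proof (cases "?c \<le> n")
    case True
    have "d = 0"
    proof (rule ccontr)
      assume "d \<noteq> 0"
      then have "(n + 1) choose n \<le> (n + d) choose n" by (intro choose_add_mono) simp
      then show False using less.prems(2) True by simp
    qed
    obtain a where "hdim (insert (lin a) G) n \<le> green_low n ?c"
      using dense_open_hdim_section[OF n, of G] unfolding dense_open_def by blast
    then have a: "hdim (insert (lin a) G) n = 0" using green_low_small[OF n True] by simp
    have "hdim (insert (lin a) G) (Suc n) \<le> mac_up n (hdim (insert (lin a) G) n)"
      by (rule hdim_section(4)[OF n forms_upto_insert_lin[OF n G]])
    then have a': "hdim (insert (lin a) G) (Suc n) = 0" using a by simp
    have "?c \<le> fv.dim (act (lin a) ` prolong n (perp G n))"
      using hdim_section(2)[OF n G, of a] a' less.prems(3) mac_up_small[OF n True] by simp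
    from image_prolong_eq[OF n this] show ?thesis
      using point_of_bijective_multiplication[OF n G c1 _ a'] a \<open>d = 0\<close> by simp
  next
    case False
    \<comment> \<open>For \<open>d = 0\<close> the subtraction truncates and the stronger claim for
      \<open>d = 1\<close> is proved, which is justified by
      \<open>?c \<ge> n + 1 = (n + 1) choose n\<close>.\<close>
    define e where "e = d - 1"
    have "\<not> grows_le (Suc e) (hdim G)"
    proof
      assume gr: "grows_le (Suc e) (hdim G)"
      obtain A where "dense_open A" "\<And>a. a \<in> A \<Longrightarrow> grows_le e (hdim (insert (lin a) G))"
        using generic_section[OF G gr] by blast
      then obtain a where a: "grows_le e (hdim (insert (lin a) G))"
        "hdim (insert (lin a) G) n \<le> green_low n ?c"
        using dense_open_Int[OF _ dense_open_hdim_section[OF n, of G], of A]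
        unfolding dense_open_def by blast
      let ?G = "insert (lin a) G"
      have G': "?G \<subseteq> forms_upto n" by (rule forms_upto_insert_lin[OF n G])
      have "mac_up n ?c \<le> hdim ?G (Suc n) + ?c"
        using hdim_section(2,3)[OF n G, of a] less.prems(3) by linarith
      then have up: "mac_up n (green_low n ?c) \<le> hdim ?G (Suc n)"
        using mac_up_green_low[OF n, of ?c] by linarith
      also have "\<dots> \<le> mac_up n (hdim ?G n)" by (rule hdim_section(4)[OF n G'])
      finally have "\<not> hdim ?G n < green_low n ?c" using mac_up_strict_mono[OF n] by (meson not_le)
      then have eq: "hdim ?G n = green_low n ?c" using a(2) by simp
      have "(n + Suc e) choose n \<le> ?c"
      proof (cases "d = 0")
        case True
        then show ?thesis using False by (simp add: e_def)
      next
        case False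
        then show ?thesis using less.prems(2) by (simp add: e_def)
      qed
      then have "green_low n ((n + Suc e) choose n) \<le> green_low n ?c" by (rule green_low_mono[OF n])
      then have "(n + e) choose n \<le> hdim ?G n"
        using eq green_low_choose[OF n, of "n + Suc e"] by simp
      moreover have "hdim ?G n < ?c" using green_low_less[OF n, of ?c] c1 eq by simp
      ultimately have "\<not> grows_le e (hdim ?G)" using less.hyps[OF _ G'] up eq by simp
      then show False using a(1) by blast
    qed
    moreover have "d \<le> Suc e" unfolding e_def by arith
    ultimately show ?thesis using grows_le_mono by blast
  qed
qed

text \<open>From degree \<open>n\<close> on, the inverse system of \<open>G\<close> is cut out in
  that of \<open>M\<close> by at most \<open>\<delta>\<close> forms of degree \<open>n\<close>, each
  of which lowers the growth by at most one.\<close>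

lemma growth_cut:
  fixes G :: "('v::finite, 'k::alg_closed_field) mpolys set"
  assumes n: "n \<ge> 1" and G: "G \<subseteq> forms_upto n" and "M \<subseteq> forms_upto n" "perp G n \<subseteq> perp M n"
    and "hdim M n \<le> hdim G n + \<delta>" "\<not> grows_le (k + \<delta>) (hdim M)"
  shows "\<not> grows_le k (hdim G)"
  using assms(3-)
proof (induction \<delta> arbitrary: M)
  case 0
  have "perp G n = perp M n"
    by (rule fv.subspace_eq_if_dim_le[OF subspace_perp 0(2) fin_spanned_perp])
      (use 0(3) in \<open>simp add: hdim_def\<close>)
  then have "perp M t \<subseteq> perp G t" if "n \<le> t" for t
    using perp_subset_perp[OF G _ that] by simp
  then show ?case using 0(4) grows_le_perp_subset[of n M G k] by auto
next
  case (Suc \<delta>)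
  show ?case
  proof (cases "perp G n = perp M n")
    case True
    then have "hdim M n \<le> hdim G n + \<delta>" by (simp add: hdim_def)
    moreover have "\<not> grows_le (k + \<delta>) (hdim M)"
      using Suc.prems(4) grows_le_mono[of "k + \<delta>" _ "k + Suc \<delta>"] by auto
    ultimately show ?thesis using Suc.IH Suc.prems(1,2) by blast
  next
    case False
    then obtain L0 where L0: "L0 \<in> perp M n" "L0 \<notin> perp G n" using Suc.prems(2) by blast
    have "L0 \<in> dual_forms n" using L0(1) by (simp add: perp_def)
    then obtain f where f: "f \<in> forms n" "\<forall>L\<in>perp G n. act f L = 0" "act f L0 0 = 1"
      using separate_dual_form[OF subspace_perp perp_subset _ L0(2)] by blast
    have "insert f M \<subseteq> forms_upto n" using Suc.prems(1) f(1) by auto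
    moreover have "perp G n \<subseteq> perp (insert f M) n"
      using Suc.prems(2) f(2) by (auto simp: perp_insert)
    moreover have "hdim (insert f M) n \<le> hdim G n + \<delta>"
    proof -
      have "act f L0 \<noteq> 0" using f(3) by auto
      then have "perp (insert f M) n \<subset> perp M n" using L0(1) by (auto simp: perp_insert)
      then have "hdim (insert f M) n < hdim M n"
        unfolding hdim_def by (rule fv.dim_less_fin[OF subspace_perp _ fin_spanned_perp])
      then show ?thesis using Suc.prems(3) by simp
    qed
    moreover have "\<not> grows_le (k + \<delta>) (hdim (insert f M))"
      using grows_le_insert[OF f(1) n, of "k + \<delta>" M] Suc.prems(4) by auto
    ultimately show ?thesis by (rule Suc.IH)
  qed
qed


text \<open>Here \<open>N = l \<Lambda>\<close> is the inverse system of the colon ideal by the linear form \<open>l\<close>. It lives one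
  degree lower, its growth is smaller than the maximum by at most two, and \<open>\<Lambda>\<close> is cut out in its
  prolongation by as many forms as the growth of \<open>N\<close> exceeds \<open>dim \<Lambda>\<close>.\<close>

lemma submaximal_growth_colon:
  fixes G :: "('v::finite, 'k::alg_closed_field) mpolys set"
  assumes m: "m \<ge> 1" and G: "G \<subseteq> forms_upto (Suc m)"
    and IH: "\<And>(H :: ('v, 'k) mpolys set) d. H \<subseteq> forms_upto m \<Longrightarrow> d \<ge> 1 \<Longrightarrow> (m + d) choose m \<le> hdim H m \<Longrightarrow>
      mac_up m (hdim H m) \<le> Suc (hdim H (Suc m)) \<Longrightarrow> \<not> grows_le (d - 1) (hdim H)"
    and c: "hdim G (Suc m) = stair (Suc m) s + e" and se: "s + e \<le> Suc m" "s \<ge> 2"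
    and ca: "hdim (insert (lin a) G) (Suc m) = s"
    and surj: "act (lin a) ` prolong (Suc m) (perp G (Suc m)) = perp G (Suc m)"
  shows "\<not> grows_le 0 (hdim G)"
proof -
  let ?n = "Suc m" and ?c = "hdim G (Suc m)"
  define \<Lambda> where "\<Lambda> = perp G ?n"
  define N where "N = act (lin a) ` \<Lambda>"
  have L: "fv.subspace \<Lambda>" "\<Lambda> \<subseteq> dual_forms ?n"
    by (simp_all add: \<Lambda>_def subspace_perp perp_subset)
  have N: "fv.subspace N" "N \<subseteq> dual_forms m"
    unfolding N_def using fp.subspace_image_linear[OF act_linear L(1)] image_lin_subset[OF L(2)] by auto
  define H where "H = gens m N"
  have Hm: "H \<subseteq> forms_upto m" and Hn: "H \<subseteq> forms_upto ?n"
    unfolding H_def by (rule order_trans[OF gens_subset forms_subset_upto], simp)+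
  have pH: "perp H m = N" unfolding H_def by (rule perp_gens[OF N])
  have pH': "perp H ?n = prolong m N" unfolding H_def by (rule prolong_perp_gens[OF N])
  \<comment> \<open>Surjectivity writes an element of \<open>\<Lambda>\<close> as the contraction by
    \<open>lin a\<close> of some \<open>K'\<close> whose contractions by variables lie in
    \<open>\<Lambda>\<close>. Since contractions commute, those of the element lie in
    \<open>N\<close>.\<close>
  have sub: "perp G ?n \<subseteq> perp H ?n"
    unfolding pH' prolong_def
  proof (intro subsetI CollectI conjI allI)
    fix K v assume K: "K \<in> perp G ?n"
    then show "K \<in> dual_forms ?n" by (simp add: perp_def)
    obtain K' where K': "K' \<in> prolong ?n (perp G ?n)" "K = act (lin a) K'" using K surj by blast
    then have "act (var v) K' \<in> \<Lambda>" by (simp add: prolong_def \<Lambda>_def)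
    then show "act (var v) K \<in> N" unfolding N_def K'(2) act_commute[of "var v"] by (rule imageI)
  qed
  define x where "x = hdim H m"
  define y where "y = hdim H ?n"
  have "?c = s + x"
    using dim_ker_plus_dim_image[OF L, of a] ca
    unfolding x_def hdim_def pH perp_insert_lin by (simp add: N_def \<Lambda>_def)
  then have x: "x = stair m s + e" and cx: "?c = x + s" using c stair_pred[of s m] se by simp_all
  have cy: "?c \<le> y" unfolding y_def by (rule hdim_le_if_subset[OF sub])
  have ym: "y \<le> mac_up m x" unfolding x_def y_def by (rule hdim_section(4)[OF m Hm])
  have cut: "\<not> grows_le 0 (hdim G)" if "y \<le> ?c + \<delta>" "\<not> grows_le \<delta> (hdim H)" for \<delta>
    using growth_cut[OF _ G Hn sub, of \<delta> 0] that by (simp add: y_def)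
  have max: "\<not> grows_le d (hdim H)" if "(m + d) choose m \<le> x" "y = mac_up m x" for d
    using maximal_growth[OF m Hm] that by (simp add: x_def y_def)
  have submax: "\<not> grows_le (d - 1) (hdim H)" if "d \<ge> 1" "(m + d) choose m \<le> x" "mac_up m x \<le> Suc y" for d
    using IH[OF Hm that(1)] that(2,3) by (simp add: x_def y_def)
  have x1: "1 \<le> x" using se by (cases s) (auto simp: x stair_def sum.lessThan_Suc_shift)
  consider (i) "s + e \<le> m" | (ii) "s + e = Suc m" "Suc s \<le> m" | (iii) "s = m" "e = 1" | (iv) "s = Suc m" "e = 0"
    using se by linarith
  then show ?thesis
  proof cases
    case i
    then have "mac_up m x = ?c" using mac_up_stair[OF m i] x cx by simp
    then have "y = ?c" "y = mac_up m x" using cy ym by simp_all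
    then show ?thesis using cut[of 0] max[of 0] x1 by simp
  next
    case ii
    then have xs: "x = stair m (Suc s) + 0" by (simp add: x stair_Suc)
    then have up: "mac_up m x = Suc ?c" using mac_up_stair[OF m, of "Suc s" 0] ii cx by simp
    have "stair m (Suc 0) \<le> stair m (Suc s)" unfolding stair_def by (rule sum_mono2) auto
    then have "(m + 1) choose m \<le> x" by (simp add: xs stair_def)
    then show ?thesis
      using cut[of 1] cut[of 0] max[of 1] submax[of 1] up cy ym by (cases "y = ?c") auto
  next
    case iv
    then have xs: "x = (m + 2) choose m"
      using stair_full[of m] choose_Suc_Suc_2[of m] by (simp add: x)
    have "mac_up m x = Suc (m + 2) choose Suc m" unfolding xs by (rule mac_up_choose[OF m])
    also have "\<dots> = x + (m + 2)"
      unfolding xs using binomial_symmetric[of "Suc m" "m + 2"] by simp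
    finally have up: "mac_up m x = Suc ?c" using cx iv by simp
    show ?thesis
    proof (cases "y = ?c")
      case True
      then have "\<not> grows_le 1 (hdim H)" using submax[of 2] up xs by simp
      then have "\<not> grows_le 0 (hdim H)" using grows_le_mono[of 0 _ 1] by auto
      then show ?thesis using cut[of 0] True by simp
    next
      case False
      then have "y = Suc ?c" using up cy ym by simp
      then have "\<not> grows_le 2 (hdim H)" using max[of 2] up xs by simp
      then have "\<not> grows_le 1 (hdim H)" using grows_le_mono[of 1 _ 2] by auto
      then show ?thesis using cut[of 1] \<open>y = Suc ?c\<close> by simp
    qed
  next
    case iii
    have "stair m (Suc m) = stair m m + 1" by (simp add: stair_Suc)
    then have xs: "x = (m + 2) choose m"
      using stair_full[of m] choose_Suc_Suc_2[of m] iii by (simp add: x)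
    have "mac_up m x = Suc (m + 2) choose Suc m" unfolding xs by (rule mac_up_choose[OF m])
    also have "\<dots> = x + (m + 2)"
      unfolding xs using binomial_symmetric[of "Suc m" "m + 2"] by simp
    finally have up: "mac_up m x = ?c + 2" using cx iii by simp
    consider "y = ?c + 2" | "y = ?c + 1" | "y = ?c" using up cy ym by linarith
    then show ?thesis
    proof cases
      case 1
      then show ?thesis using cut[of 2] max[of 2] up xs by simp
    next
      case 2
      then show ?thesis using cut[of 1] submax[of 2] up xs by simp
    next
      case 3
      \<comment> \<open>The growth of \<open>H\<close> is two below the maximum, which the induction
        hypothesis does not cover. But \<open>H\<close> and \<open>G\<close> agree in degree
        \<open>m + 1\<close>, and Green's bound for a section of \<open>G\<close> forces
        \<open>?r = m\<close> and makes \<open>lin b\<close> map the prolongation onto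
        \<open>perp H m\<close>.\<close>
      have eq: "perp G ?n = perp H ?n"
        by (rule fv.subspace_eq_if_dim_le[OF subspace_perp sub fin_spanned_perp])
          (use 3 in \<open>simp add: y_def hdim_def\<close>)
      have "\<not> grows_le 0 (hdim H)"
      proof -
        obtain b where b: "hdim (insert (lin b) H) m \<le> green_low m x"
          "hdim (insert (lin b) G) ?n \<le> green_low ?n ?c"
          using dense_open_Int[OF dense_open_hdim_section[OF m, of H] dense_open_hdim_section[of ?n G]]
          unfolding dense_open_def x_def by auto
        let ?r = "hdim (insert (lin b) H) ?n" and ?c' = "hdim (insert (lin b) H) m"
        have bH: "insert (lin b) H \<subseteq> forms_upto m" by (rule forms_upto_insert_lin[OF m Hm])
        have r: "?r = hdim (insert (lin b) G) ?n" by (simp add: hdim_def perp_insert_lin eq)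
        have "green_low ?n ?c = s" unfolding c by (rule green_low_stair) (use se in auto)
        then have "?r \<le> m" using b(2) r iii by simp
        moreover have y': "y = ?r + fv.dim (act (lin b) ` prolong m (perp H m))"
          unfolding y_def by (rule hdim_section(2)[OF m Hm])
        moreover have "fv.dim (act (lin b) ` prolong m (perp H m)) \<le> x"
          unfolding x_def by (rule hdim_section(3)[OF m Hm])
        ultimately have rm: "?r = m" and dimx: "fv.dim (act (lin b) ` prolong m (perp H m)) = x"
          using 3 cx iii by simp_all
        have "green_low m x = m + 1"
          unfolding xs using green_low_choose[OF m, of "m + 2"] binomial_symmetric[of m "Suc m"] by simp
        then have "?c' \<le> m + 1" using b(1) by simp
        moreover have "m \<le> mac_up m ?c'" using hdim_section(4)[OF m bH] rm by simp
        then have "m \<le> ?c'" using mac_up_small[OF m, of ?c'] by (cases "?c' \<le> m") auto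
        ultimately consider "?c' = m" | "?c' = m + 1" by linarith
        then show ?thesis
        proof cases
          case 1
          have "\<not> grows_le 0 (hdim (insert (lin b) H))"
            by (rule maximal_growth[OF m bH]) (use 1 rm m mac_up_small[OF m, of m] in simp_all)
          then show ?thesis using grows_le_antimono[of H "insert (lin b) H" 0] by auto
        next
          case 2
          obtain p where p: "m = Suc p" "p \<ge> 1" using iii se by (cases m) auto
          have surjH: "act (lin b) ` prolong m (perp H m) = perp H m"
            by (rule image_prolong_eq[OF m]) (simp add: dimx x_def)
          \<comment> \<open>A second colon ideal, now by \<open>lin b\<close>. Its dimension in
            degree \<open>p\<close> is the single binomial \<open>(p + 2) choose p\<close>, whose
            Macaulay bound is exactly \<open>x\<close>; so it has maximal growth and agrees with
            \<open>H\<close> in degree \<open>m\<close>.\<close>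
          define E where "E = act (lin b) ` N"
          have E: "fv.subspace E" "E \<subseteq> dual_forms p"
            unfolding E_def
            using fp.subspace_image_linear[OF act_linear N(1)] image_lin_subset[of N p b] N(2) p
            by auto
          define F where "F = gens p E"
          have Fp: "F \<subseteq> forms_upto p" and Fm: "F \<subseteq> forms_upto m"
            unfolding F_def by (rule order_trans[OF gens_subset forms_subset_upto], use p in simp)+
          have pF: "perp F p = E" unfolding F_def by (rule perp_gens[OF E])
          have pF': "perp F m = prolong p E" unfolding F_def p(1) by (rule prolong_perp_gens[OF E])
          have subF: "perp H m \<subseteq> perp F m"
            unfolding pF' prolong_def
          proof (intro subsetI CollectI conjI allI)
            fix K v assume K: "K \<in> perp H m"
            then show "K \<in> dual_forms (Suc p)" using p by (simp add: perp_def)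
            obtain K' where K': "K' \<in> prolong m (perp H m)" "K = act (lin b) K'"
              using K surjH by blast
            then have "act (var v) K' \<in> N" by (simp add: prolong_def pH)
            then show "act (var v) K \<in> E"
              unfolding E_def K'(2) act_commute[of "var v"] by (rule imageI)
          qed
          have "x = ?c' + hdim F p"
            using dim_ker_plus_dim_image[OF N, of b]
            unfolding x_def hdim_def perp_insert_lin pH pF by (simp add: E_def)
          moreover have "x = (m + 1) + ((p + 2) choose p)"
            unfolding xs using p binomial_symmetric[of m "Suc m"] by simp
          ultimately have dF: "hdim F p = (p + 2) choose p" using 2 by simp
          have upF: "mac_up p (hdim F p) = x"
            unfolding dF xs p(1) using mac_up_choose[OF p(2), of "p + 2"] by simp
          have "hdim F m \<le> x" using hdim_section(4)[OF p(2) Fp] upF p by simp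
          moreover have "x \<le> hdim F m" unfolding x_def by (rule hdim_le_if_subset[OF subF])
          ultimately have Fx: "hdim F m = x" by simp
          have "\<not> grows_le 2 (hdim F)"
            by (rule maximal_growth[OF p(2) Fp]) (use dF upF Fx p in simp_all)
          then have "\<not> grows_le 0 (hdim F)" using grows_le_mono[of 0 _ 2] by auto
          then show ?thesis using growth_cut[OF m Hm Fm subF, of 0 0] Fx by (simp add: x_def)
        qed
      qed
      then show ?thesis using cut[of 0] 3 by simp
    qed
  qed
qed

text \<open>In degree \<open>n\<close> a general section has dimension at most
  \<open>s \<le> n\<close>, so it cannot increase. Either it stays constant and positive, which is
  maximal growth, or the deficit lies in the section and the linear form is surjective. In the
  latter case it is bijective if the section vanishes in degree \<open>n + 1\<close>, and otherwise
  the colon ideal takes over.\<close>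

lemma submaximal_growth_base:
  fixes G :: "('v::finite, 'k::alg_closed_field) mpolys set"
  assumes n: "n \<ge> 1" and G: "G \<subseteq> forms_upto n"
    and IH: "\<And>m (H :: ('v, 'k) mpolys set) d. n = Suc m \<Longrightarrow> m \<ge> 1 \<Longrightarrow> H \<subseteq> forms_upto m \<Longrightarrow> d \<ge> 1 \<Longrightarrow>
      (m + d) choose m \<le> hdim H m \<Longrightarrow>
      mac_up m (hdim H m) \<le> Suc (hdim H (Suc m)) \<Longrightarrow> \<not> grows_le (d - 1) (hdim H)"
    and c: "n + 1 \<le> hdim G n" "hdim G n < (n + 2) choose 2"
    and up: "mac_up n (hdim G n) \<le> Suc (hdim G (Suc n))"
  shows "\<not> grows_le 0 (hdim G)"
proof -
  let ?c = "hdim G n"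
  obtain s e where se: "s + e \<le> n" "?c = stair n s + e" using stair_exists[OF c(2)] by blast
  have s1: "s \<ge> 1" using se c(1) by (cases s) auto
  have low: "green_low n ?c = s" unfolding se(2) by (rule green_low_stair[OF n se(1)])
  have "mac_up n ?c = ?c + s" unfolding se(2) by (rule mac_up_stair[OF n se(1)])
  then have up': "?c + s \<le> Suc (hdim G (Suc n))" using up by simp
  obtain a where "hdim (insert (lin a) G) n \<le> green_low n ?c"
    using dense_open_hdim_section[OF n, of G] unfolding dense_open_def by blast
  then have cs: "hdim (insert (lin a) G) n \<le> s" using low by simp
  let ?G = "insert (lin a) G"
  let ?c' = "hdim ?G n" and ?p = "hdim ?G (Suc n)" and ?q = "fv.dim (act (lin a) ` prolong n (perp G n))"
  have G': "?G \<subseteq> forms_upto n" by (rule forms_upto_insert_lin[OF n G])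
  have pq: "hdim G (Suc n) = ?p + ?q" and qc: "?q \<le> ?c" by (rule hdim_section(2,3)[OF n G])+
  have small: "mac_up n ?c' = ?c'" using cs se(1) by (intro mac_up_small[OF n]) simp
  have pc: "?p \<le> ?c'" using hdim_section(4)[OF n G'] small by simp
  show ?thesis
  proof (cases "?p = ?c' \<and> ?c' \<ge> 1")
    case True
    then have "\<not> grows_le 0 (hdim ?G)" using small by (intro maximal_growth[OF n G']) simp_all
    then show ?thesis using grows_le_antimono[of G ?G 0] by auto
  next
    case False
    then have cases: "?c' = 0 \<and> s = 1 \<and> ?p = 0 \<or> ?c' = s \<and> Suc ?p = s" and "?c \<le> ?q"
      using cs pc up' pq qc s1 by linarith+
    then have surj: "act (lin a) ` prolong n (perp G n) = perp G n" by (intro image_prolong_eq[OF n])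
    show ?thesis
    proof (cases "?p = 0")
      case True
      then have "?c' \<le> 1" using cases by linarith
      then show ?thesis using point_of_bijective_multiplication[OF n G _ _ True surj] c(1) by simp
    next
      case False
      then have s2: "s \<ge> 2" "?c' = s" using cases by linarith+
      then obtain m where m: "n = Suc m" "m \<ge> 1" using se(1) by (cases n) auto
      show ?thesis
        by (rule submaximal_growth_colon[OF m(2) _ IH[OF m]])
          (use G se s2 surj m in \<open>simp_all del: UN_simps\<close>)
    qed
  qed
qed

text \<open>The outer induction on the degree serves the colon ideal in the base case, the inner one
  on \<open>hdim G n\<close> serves the general section.\<close>

theorem submaximal_growth:
  fixes G :: "('v::finite, 'k::alg_closed_field) mpolys set"
  assumes "n \<ge> 1" "G \<subseteq> forms_upto n" "d \<ge> 1" "(n + d) choose n \<le> hdim G n"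
    and "mac_up n (hdim G n) \<le> Suc (hdim G (Suc n))"
  shows "\<not> grows_le (d - 1) (hdim G)"
  using assms
proof (induction n arbitrary: G d rule: less_induct)
  case (less n)
  note outer = less.IH and n = less.prems(1)
  show ?case
    using less.prems(2-)
  proof (induction "hdim G n" arbitrary: G d rule: less_induct)
    case less
    note G = less.prems(1)
    let ?c = "hdim G n"
    show ?case
    proof (cases "?c < (n + 2) choose n")
      case True
      have "d = 1"
      proof (rule ccontr)
        assume "d \<noteq> 1"
        then have "(n + 2) choose n \<le> (n + d) choose n"
          using less.prems(2) by (intro choose_add_mono) simp
        then show False using less.prems(3) True by simp
      qed
      moreover have "\<not> grows_le 0 (hdim G)"
      proof (rule submaximal_growth_base[OF n G _ _ _ less.prems(4)])
        show "n + 1 \<le> ?c" using less.prems(3) \<open>d = 1\<close> by simp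
        show "?c < (n + 2) choose 2" using True choose_Suc_Suc_2[of n] by simp
        fix m d and H :: "('v, 'k) mpolys set"
        assume "n = Suc m" "m \<ge> 1" "H \<subseteq> forms_upto m" "d \<ge> 1" "(m + d) choose m \<le> hdim H m"
          "mac_up m (hdim H m) \<le> Suc (hdim H (Suc m))"
        then show "\<not> grows_le (d - 1) (hdim H)" by (intro outer) auto
      qed
      ultimately show ?thesis by simp
    next
      case False
      \<comment> \<open>With truncated subtraction \<open>Suc (Suc e)\<close> is the maximum of
        \<open>d\<close> and 2; raising \<open>d\<close> to 2 is allowed because
        \<open>?c \<ge> (n + 2) choose n\<close>.\<close>
      define e where "e = d - 2"
      have "\<not> grows_le (Suc e) (hdim G)"
      proof
        assume gr: "grows_le (Suc e) (hdim G)"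
        obtain A where "dense_open A" "\<And>a. a \<in> A \<Longrightarrow> grows_le e (hdim (insert (lin a) G))"
          using generic_section[OF G gr] by blast
        then obtain a where a: "grows_le e (hdim (insert (lin a) G))"
          "hdim (insert (lin a) G) n \<le> green_low n ?c"
          using dense_open_Int[OF _ dense_open_hdim_section[OF n, of G], of A]
          unfolding dense_open_def by blast
        let ?G = "insert (lin a) G"
        let ?w = "green_low n ?c" and ?c' = "hdim ?G n" and ?h = "hdim ?G (Suc n)"
        have G': "?G \<subseteq> forms_upto n" by (rule forms_upto_insert_lin[OF n G])
        have "mac_up n ?c \<le> Suc (?h + ?c)"
          using hdim_section(2,3)[OF n G, of a] less.prems(4) by linarith
        then have up: "mac_up n ?w \<le> Suc ?h"
          using mac_up_green_low[OF n, of ?c] by linarith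
        have mac: "?h \<le> mac_up n ?c'" by (rule hdim_section(4)[OF n G'])
        have "(n + Suc (Suc e)) choose n \<le> ?c"
        proof (cases "d \<ge> 2")
          case True
          then show ?thesis using less.prems(3) by (simp add: e_def Suc_diff_Suc numeral_2_eq_2)
        next
          case d: False
          then show ?thesis using False by (simp add: e_def)
        qed
        then have "green_low n ((n + Suc (Suc e)) choose n) \<le> ?w" by (rule green_low_mono[OF n])
        then have w: "(n + Suc e) choose n \<le> ?w"
          using green_low_choose[OF n, of "n + Suc (Suc e)"] by simp
        have "0 < (n + Suc e) choose n" by simp
        then have "?w > 0" using w by linarith
        then have wc: "?w < ?c" using green_low_less[OF n, of ?c] by (cases "?c = 0") auto
        have "\<not> grows_le e (hdim ?G)"
        proof (cases "?c' = ?w")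
          case True
          have "\<not> grows_le (Suc e - 1) (hdim ?G)"
            by (rule less.hyps[OF _ G']) (use True wc w up in simp_all)
          then show ?thesis by simp
        next
          case False
          \<comment> \<open>Strict monotonicity of \<open>mac_up n\<close> has two effects: a
            section below Green's bound has maximal growth, and it misses the bound by exactly one.
            Losing one still leaves at least \<open>(n + e) choose n\<close>.\<close>
          then have lt: "?c' < ?w" using a(2) by simp
          have max: "mac_up n ?c' \<le> ?h" using mac_up_strict_mono[OF n lt] up by linarith
          have "\<not> Suc ?c' < ?w"
            using mac_up_strict_mono[OF n, of "Suc ?c'" ?w] mac_up_Suc[OF n, of ?c'] up mac by linarith
          moreover have "0 < (n + e) choose (n - 1)" by simp
          ultimately have "(n + e) choose n \<le> ?c'" using w choose_add_Suc[OF n, of e] by linarith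
          then show ?thesis by (rule maximal_growth[OF n G' _ max])
        qed
        then show False using a(1) by blast
      qed
      moreover have "d - 1 \<le> Suc e" unfolding e_def by arith
      ultimately show ?thesis using grows_le_mono by blast
    qed
  qed
qed

section \<open>The Hilbert function and the dimension of the base locus\<close>

lemma sc_apply: "sc c f x = c * f x"
  by (simp add: sc_def)

lemma act_sum_psc: "act (\<Sum>i\<in>A. psc (c i) (f i)) L m = (\<Sum>i\<in>A. c i * act (f i) L m)"
  by (simp add: act_sum_left act_psc sum_fun_apply sc_apply)

text \<open>\<open>B\<close> has a dual basis in \<open>perp J t\<close>, whose members separate one
  element of \<open>B\<close> from \<open>J\<close> and the remaining elements.\<close>

lemma residue_basis_card:
  fixes J :: "('v::finite, 'k::field) mpolys set"
  assumes J: "homogeneous_ideal J" and B: "residue_basis J t B"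
  shows "card B = hdim J t"
proof -
  have fin: "finite B" and Bf: "B \<subseteq> forms t"
    and ind: "\<And>a. (\<Sum>b\<in>B. psc (a b) b) \<in> J \<Longrightarrow> \<forall>b\<in>B. a b = 0"
    and spn: "\<And>f. f \<in> forms t \<Longrightarrow> \<exists>a. f - (\<Sum>b\<in>B. psc (a b) b) \<in> J"
    using B unfolding residue_basis_def psc_def by blast+
  have sJ: "pv.subspace J" using J by (intro subspace_ideal) (simp add: homogeneous_ideal_iff)
  have dual: "\<exists>L\<in>perp J t. \<forall>b'\<in>B. act b' L 0 = (if b' = b then 1 else 0)" if b: "b \<in> B" for b
  proof -
    let ?W = "pv.span (J \<union> (B - {b}))"
    have "b \<notin> ?W"
    proof
      assume "b \<in> ?W"
      then obtain j y where j: "j \<in> J" "y \<in> pv.span (B - {b})" "b = j + y"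
        unfolding pv.span_Un using pv.span_eq_iff[THEN iffD2, OF sJ] by auto
      then obtain u where u: "y = (\<Sum>v\<in>B - {b}. psc (u v) v)"
        using fin pv.span_finite[of "B - {b}"] by auto
      let ?a = "\<lambda>v. if v = b then 1 else - u v"
      have "(\<Sum>v\<in>B. psc (?a v) v) = psc 1 b + (\<Sum>v\<in>B - {b}. psc (?a v) v)"
        using fin b by (subst sum.remove[of _ b]) auto
      also have "(\<Sum>v\<in>B - {b}. psc (?a v) v) = - y"
        unfolding u sum_negf[symmetric] by (rule sum.cong) auto
      also have "psc 1 b + - y = j" using j(3) by simp
      finally have "(\<Sum>v\<in>B. psc (?a v) v) \<in> J" using j(1) by simp
      then have "?a b = 0" using ind[of ?a] b by blast
      then show False by simp
    qed
    then obtain L where L: "L \<in> dual_forms t" "\<forall>g\<in>?W \<inter> forms t. act g L = 0" "act b L \<noteq> 0"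
      using separate_form[OF pv.subspace_span, of b t] Bf b by blast
    have "g \<in> ?W" if "g \<in> J \<union> (B - {b})" for g using that by (rule pv.span_base)
    then have z: "act g L = 0" if "g \<in> forms t" "g \<in> J \<union> (B - {b})" for g
      using L(2) that by blast
    have LJ: "L \<in> perp J t" unfolding perp_homogeneous[OF J] using L(1) z by (simp add: perp_def)
    have b0: "act b L 0 \<noteq> 0" using L(3) act_dual_forms_same[of b t L] L(1) Bf b by blast
    let ?L = "sc (inverse (act b L 0)) L"
    have "act b' ?L 0 = (if b' = b then 1 else 0)" if "b' \<in> B" for b'
    proof (cases "b' = b")
      case True
      then show ?thesis using b0 by (simp only: act_sc_right sc_apply) simp
    next
      case False
      then have "act b' L = 0" using z[of b'] that Bf by blast
      then show ?thesis using False by (simp add: act_sc_right)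
    qed
    moreover have "?L \<in> perp J t" using LJ by (rule fv.subspace_scale[OF subspace_perp])
    ultimately show ?thesis by blast
  qed
  then obtain l where l: "\<And>b. b \<in> B \<Longrightarrow> l b \<in> perp J t"
    "\<And>b b'. b \<in> B \<Longrightarrow> b' \<in> B \<Longrightarrow> act b' (l b) 0 = (if b' = b then 1 else 0)"
    by metis
  have inj: "inj_on l B"
  proof (rule inj_onI)
    fix x y assume xy: "x \<in> B" "y \<in> B" "l x = l y"
    have "(if x = y then 1 else 0) = (1 :: 'k)"
      using l(2)[OF xy(1,1)] l(2)[OF xy(2,1)] xy(3) by simp
    then show "x = y" by (simp split: if_splits)
  qed
  have "fv.dim (perp J t) = card (l ` B)"
  proof (rule fv.dim_unique[OF _ _ _ refl])
    show "l ` B \<subseteq> perp J t" using l(1) by blast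
    show "fv.independent (l ` B)"
    proof (rule fv.independent_if_scalars_zero)
      fix f x assume s: "(\<Sum>x\<in>l ` B. sc (f x) x) = 0" and "x \<in> l ` B"
      then obtain b where b: "x = l b" "b \<in> B" by blast
      have "0 = act b (\<Sum>x\<in>l ` B. sc (f x) x) 0" by (simp add: s act.zero)
      also have "\<dots> = (\<Sum>c\<in>B. f (l c) * act b (l c) 0)"
        unfolding act.sum using inj by (simp add: sum.reindex act_sc_right sum_fun_apply sc_apply)
      also have "\<dots> = (\<Sum>c\<in>B. if b = c then f (l c) else 0)"
        by (rule sum.cong) (use l(2) b in auto)
      also have "\<dots> = f x" using b fin by (simp add: sum.delta)
      finally show "f x = 0" by simp
    qed (use fin in simp)
    show "perp J t \<subseteq> fv.span (l ` B)"
    proof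
      fix L assume L: "L \<in> perp J t"
      let ?S = "\<Sum>b\<in>B. sc (act b L 0) (l b)"
      have S: "?S \<in> perp J t"
        using l(1) by (intro fv.subspace_sum fv.subspace_scale subspace_perp) auto
      have M: "L - ?S \<in> perp J t" by (rule fv.subspace_diff[OF subspace_perp L S])
      have Sb: "act b ?S 0 = act b L 0" if "b \<in> B" for b
      proof -
        have "act b ?S 0 = (\<Sum>c\<in>B. act c L 0 * act b (l c) 0)"
          unfolding act.sum by (simp add: act_sc_right sum_fun_apply sc_apply)
        also have "\<dots> = (\<Sum>c\<in>B. if b = c then act c L 0 else 0)"
          by (rule sum.cong) (use l(2) that in auto)
        finally show ?thesis using that fin by (simp add: sum.delta)
      qed
      have "(L - ?S) m = 0" for m
      proof (cases "mon_degree m = t")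
        case True
        let ?f = "single m (1 :: 'k)"
        obtain a where a: "?f - (\<Sum>b\<in>B. psc (a b) b) \<in> J"
          using spn[OF forms_single[OF True]] by blast
        then have "act (?f - (\<Sum>b\<in>B. psc (a b) b)) (L - ?S) = 0" using M by (simp add: perp_def)
        then have "act ?f (L - ?S) = act (\<Sum>b\<in>B. psc (a b) b) (L - ?S)"
          by (simp add: act_diff_left)
        moreover have "act ?f K 0 = K m" for K by (simp add: act_single)
        ultimately have "(L - ?S) m = act (\<Sum>b\<in>B. psc (a b) b) (L - ?S) 0" by metis
        also have "\<dots> = (\<Sum>b\<in>B. a b * (act b L 0 - act b ?S 0))"
          unfolding act_sum_psc act.diff by (simp add: right_diff_distrib sum_subtractf)
        also have "\<dots> = 0" using Sb by (intro sum.neutral) auto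
        finally show ?thesis .
      next
        case False
        then show ?thesis using M by (simp add: perp_def dual_forms_def)
      qed
      then have "L - ?S = 0" by (simp add: fun_eq_iff)
      then have "L = ?S" by simp
      moreover have "?S \<in> fv.span (l ` B)"
        by (intro fv.span_sum fv.span_scale fv.span_base imageI)
      ultimately show "L \<in> fv.span (l ` B)" by simp
    qed
  qed
  then show ?thesis using card_image[OF inj] by (simp add: hdim_def)
qed

text \<open>Forms dual to a basis of \<open>perp J t\<close> will do, because a form of degree
  \<open>t\<close> killed by all of \<open>perp J t\<close> lies in \<open>J\<close>.\<close>

lemma residue_basis_exists:
  fixes J :: "('v::finite, 'k::field) mpolys set"
  assumes J: "homogeneous_ideal J"
  shows "\<exists>B. residue_basis J t B"
proof -
  have sJ: "pv.subspace J" using J by (intro subspace_ideal) (simp add: homogeneous_ideal_iff)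
  obtain K where K: "K \<subseteq> perp J t" "fv.independent K" "perp J t \<subseteq> fv.span K" "card K = fv.dim (perp J t)" "finite K"
    using fv.fin_spanned_basis[OF fin_spanned_perp] by metis
  have Kd: "K \<subseteq> dual_forms t" using K(1) perp_subset by blast
  have "\<exists>g\<in>forms t. \<forall>L'\<in>K. act g L' 0 = (if L' = L then 1 else 0)" if L: "L \<in> K" for L
  proof -
    have n: "L \<notin> fv.span (K - {L})" using K(2) L unfolding fv.dependent_def by blast
    have "fv.span (K - {L}) \<subseteq> dual_forms t"
      using Kd by (intro fv.span_minimal subspace_dual_forms) auto
    then obtain g where g: "g \<in> forms t" "\<forall>L'\<in>fv.span (K - {L}). act g L' = 0" "act g L 0 = 1"
      using separate_dual_form[OF fv.subspace_span _ _ n] Kd L by blast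
    have "act g L' = 0" if "L' \<in> K" "L' \<noteq> L" for L'
      using g(2) fv.span_base[of L' "K - {L}"] that by blast
    then show ?thesis using g(1,3) by (intro bexI[of _ g]) auto
  qed
  then obtain f where f: "\<And>L. L \<in> K \<Longrightarrow> f L \<in> forms t"
    "\<And>L L'. L \<in> K \<Longrightarrow> L' \<in> K \<Longrightarrow> act (f L) L' 0 = (if L' = L then 1 else 0)"
    by metis
  have inj: "inj_on f K"
  proof (rule inj_onI)
    fix x y assume xy: "x \<in> K" "y \<in> K" "f x = f y"
    have "(if x = y then 1 else 0) = (1 :: 'k)"
      using f(2)[OF xy(1,1)] f(2)[OF xy(2,1)] xy(3) by simp
    then show "x = y" by (simp split: if_splits)
  qed
  have ev: "act (\<Sum>L'\<in>K. psc (c L') (f L')) L 0 = c L" if "L \<in> K" for c L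
  proof -
    have "act (\<Sum>L'\<in>K. psc (c L') (f L')) L 0 = (\<Sum>L'\<in>K. if L = L' then c L' else 0)"
      unfolding act_sum_psc by (rule sum.cong) (use f(2) that in auto)
    then show ?thesis using that K(5) by (simp add: sum.delta)
  qed
  have "residue_basis J t (f ` K)"
    unfolding residue_basis_def psc_def[symmetric]
  proof (intro conjI allI impI ballI)
    show "finite (f ` K)" using K(5) by simp
    show "f ` K \<subseteq> forms t" using f(1) by blast
  next
    fix a b assume s: "(\<Sum>b\<in>f ` K. psc (a b) b) \<in> J" and "b \<in> f ` K"
    then obtain L where L: "b = f L" "L \<in> K" by blast
    have "(\<Sum>b\<in>f ` K. psc (a b) b) = (\<Sum>L\<in>K. psc (a (f L)) (f L))"
      using inj by (simp add: sum.reindex)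
    then have "act (\<Sum>L\<in>K. psc (a (f L)) (f L)) L = 0"
      using s K(1) L(2) by (auto simp: perp_def)
    then show "a b = 0" using ev[OF L(2), of "\<lambda>L. a (f L)"] L(1) by simp
  next
    fix g :: "('v, 'k) mpolys" assume g: "g \<in> forms t"
    define c where "c L = act g L 0" for L
    let ?h = "g - (\<Sum>L\<in>K. psc (c L) (f L))"
    have hf: "?h \<in> forms t"
      using f(1) by (intro pv.subspace_diff[OF subspace_forms g] forms_sum forms_psc)
    have h0: "act ?h L = 0" if "L \<in> K" for L
    proof -
      have "act ?h L 0 = 0" using ev[OF that, of c] by (simp add: act_diff_left c_def)
      then show ?thesis using act_dual_forms_same[OF hf] Kd that by blast
    qed
    have "fv.subspace {L. act ?h L = 0}"
      by (auto simp: fv.subspace_def act.zero act_add_right act_sc_right)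
    then have "fv.span K \<subseteq> {L. act ?h L = 0}" using h0 by (intro fv.span_minimal) auto
    then have "\<forall>L\<in>perp J t. act ?h L = 0" using K(3) by blast
    then have "?h \<in> J"
      using separate_form[OF sJ hf] unfolding perp_homogeneous[OF J] by (auto simp: perp_def)
    moreover have "(\<Sum>b\<in>f ` K. psc (c (inv_into K f b)) b) = (\<Sum>L\<in>K. psc (c L) (f L))"
      using inj by (simp add: sum.reindex)
    ultimately show "\<exists>a. g - (\<Sum>b\<in>f ` K. psc (a b) b) \<in> J"
      by (intro exI[of _ "\<lambda>b. c (inv_into K f b)"]) simp
  qed
  then show ?thesis by blast
qed

lemma hilbert_function_eq_hdim:
  assumes "homogeneous_ideal J"
  shows "hilbert_function J t = hdim J t"
  unfolding hilbert_function_def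
proof (rule the_equality)
  show "\<exists>B. residue_basis J t B \<and> hdim J t = card B"
    using residue_basis_exists[OF assms, of t] residue_basis_card[OF assms] by metis
next
  fix d assume "\<exists>B. residue_basis J t B \<and> d = card B"
  then show "d = hdim J t" using residue_basis_card[OF assms] by blast
qed

section \<open>Irreducible closed subsets of Proj and prime ideals\<close>

lemma homogeneous_ideal_UNIV: "homogeneous_ideal UNIV"
  by (simp add: homogeneous_ideal_iff idl.subspace_UNIV)

lemma topspace_Proj: "topspace (Proj :: ('v::finite, 'k::field) mpolys set topology) = Proj_points"
proof
  show "topspace (Proj :: ('v, 'k) mpolys set topology) \<subseteq> Proj_points"
    unfolding topspace_def by (auto simp: openin_Proj)
  have "Proj_zeros (UNIV :: ('v, 'k) mpolys set) = {}"
    by (auto simp: Proj_zeros_def Proj_points_def is_prime_ideal_def)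
  then have "openin (Proj :: ('v, 'k) mpolys set topology) Proj_points"
    unfolding openin_Proj by (intro exI[of _ UNIV]) (simp add: homogeneous_ideal_UNIV)
  then show "Proj_points \<subseteq> topspace (Proj :: ('v, 'k) mpolys set topology)"
    by (rule openin_subset)
qed

lemma Proj_zeros_subset: "Proj_zeros I \<subseteq> Proj_points"
  by (auto simp: Proj_zeros_def)

lemma closedin_Proj: "closedin Proj C \<longleftrightarrow> (\<exists>I. homogeneous_ideal I \<and> C = Proj_zeros I)"
proof
  assume "closedin Proj C"
  then have C: "C \<subseteq> Proj_points" "openin Proj (Proj_points - C)"
    by (auto simp: closedin_def topspace_Proj)
  then obtain I where "homogeneous_ideal I" "Proj_points - C = Proj_points - Proj_zeros I"
    by (auto simp: openin_Proj)
  then show "\<exists>I. homogeneous_ideal I \<and> C = Proj_zeros I"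
    using C(1) Proj_zeros_subset by (intro exI[of _ I]) blast
next
  assume "\<exists>I. homogeneous_ideal I \<and> C = Proj_zeros I"
  then show "closedin Proj C"
    unfolding closedin_def topspace_Proj openin_Proj using Proj_zeros_subset by blast
qed

text \<open>\<open>P\<close> is a generic point: a closed subset of the space containing
  \<open>P\<close> contains all of \<open>Proj_zeros P\<close>.\<close>

lemma irreducible_closedin_zeros:
  assumes P: "P \<in> Proj_points" "I \<subseteq> P"
  shows "irreducible_closedin (subtopology Proj (Proj_zeros I)) (Proj_zeros P)"
proof -
  have hP: "homogeneous_ideal P" using P(1) by (simp add: Proj_points_def)
  have PZ: "P \<in> Proj_zeros P" using P(1) by (simp add: Proj_zeros_def)
  have sub: "Proj_zeros P \<subseteq> Proj_zeros I" using P(2) by (auto simp: Proj_zeros_def)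
  have "closedin Proj (Proj_zeros P)" using hP closedin_Proj by blast
  then have cl: "closedin (subtopology Proj (Proj_zeros I)) (Proj_zeros P)"
    using sub by (rule closedin_subset_topspace)
  have gen: "A = Proj_zeros P"
    if A: "closedin (subtopology Proj (Proj_zeros I)) A" "A \<subseteq> Proj_zeros P" "P \<in> A" for A
  proof -
    obtain T where "closedin Proj T \<and> A = T \<inter> Proj_zeros I"
      using A(1) unfolding closedin_subtopology ..
    then have T: "closedin Proj T" "A = T \<inter> Proj_zeros I" by simp_all
    obtain I' where I': "T = Proj_zeros I'" using T(1) by (auto simp: closedin_Proj)
    have "I' \<subseteq> P" using A(3) T(2) I' by (auto simp: Proj_zeros_def)
    then have "Proj_zeros P \<subseteq> A" unfolding T(2) I' using sub by (auto simp: Proj_zeros_def)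
    then show ?thesis using A(2) by blast
  qed
  show ?thesis
    unfolding irreducible_closedin_def
  proof (intro conjI allI impI)
    show "Proj_zeros P \<noteq> {}" using PZ by blast
    fix A B
    assume AB: "closedin (subtopology Proj (Proj_zeros I)) A \<and>
      closedin (subtopology Proj (Proj_zeros I)) B \<and> Proj_zeros P = A \<union> B"
    then have "P \<in> A \<or> P \<in> B" using PZ by blast
    then show "Proj_zeros P = A \<or> Proj_zeros P = B" using gen[of A] gen[of B] AB by blast
  qed (rule cl)
qed

text \<open>\<open>\<Inter>Z\<close> is the vanishing ideal of \<open>Z\<close>. If it contains a
  product of two forms, the zeros of the factors cover \<open>Z\<close> by two closed subsets, so
  one factor vanishes on \<open>Z\<close>; for homogeneous ideals this test suffices for
  primality.\<close>

lemma irreducible_closedin_prime: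
  fixes Z :: "('v::finite, 'k::field) mpolys set set"
  assumes Z: "irreducible_closedin (subtopology Proj (Proj_zeros I)) Z"
  shows "\<Inter>Z \<in> Proj_points" "I \<subseteq> \<Inter>Z" "Z = Proj_zeros (\<Inter>Z)"
proof -
  let ?X = "subtopology Proj (Proj_zeros I)"
  have cl: "closedin ?X Z" and ne: "Z \<noteq> {}" using Z by (auto simp: irreducible_closedin_def)
  obtain I' where I': "Z = Proj_zeros I' \<inter> Proj_zeros I"
    using cl by (auto simp: closedin_subtopology closedin_Proj)
  have pts: "P \<in> Proj_points" if "P \<in> Z" for P using that I' Proj_zeros_subset by blast
  show IZ: "I \<subseteq> \<Inter>Z" using I' by (auto simp: Proj_zeros_def)
  have I'Z: "I' \<subseteq> \<Inter>Z" using I' by (auto simp: Proj_zeros_def)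
  show ZZ: "Z = Proj_zeros (\<Inter>Z)"
  proof
    show "Z \<subseteq> Proj_zeros (\<Inter>Z)" using pts by (auto simp: Proj_zeros_def)
    show "Proj_zeros (\<Inter>Z) \<subseteq> Z"
    proof
      fix P assume "P \<in> Proj_zeros (\<Inter>Z)"
      then have "P \<in> Proj_points" "\<Inter>Z \<subseteq> P" by (auto simp: Proj_zeros_def)
      then show "P \<in> Z" unfolding I' using IZ I'Z by (auto simp: Proj_zeros_def simp flip: I')
    qed
  qed
  have hom: "is_ideal P \<and> (\<forall>f\<in>P. \<forall>t. hcomp t f \<in> P)" if "P \<in> Z" for P
    using pts[OF that] by (simp add: Proj_points_def flip: homogeneous_ideal_iff)
  have "is_ideal (\<Inter>Z)" using hom by (intro idl.subspace_Inter) blast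
  then have hZ: "homogeneous_ideal (\<Inter>Z)" unfolding homogeneous_ideal_iff using hom by blast
  obtain P where P: "P \<in> Z" using ne by blast
  have P': "P \<noteq> UNIV" "\<not> (\<Union>t\<in>{1..}. forms t) \<subseteq> P"
    using pts[OF P] by (auto simp: Proj_points_def is_prime_ideal_def)
  have sP: "\<Inter>Z \<subseteq> P" using P by blast
  have "is_prime_ideal (\<Inter>Z)"
  proof (rule is_prime_ideal_homogeneous[OF hZ])
    show "\<Inter>Z \<noteq> UNIV" using sP P'(1) by blast
    fix f g :: "('v, 'k) mpolys" and s t assume fg: "f \<in> forms s" "g \<in> forms t" "f * g \<in> \<Inter>Z"
    have clf: "closedin ?X (Z \<inter> Proj_zeros {h})" if "h \<in> forms u" for h and u
    proof -
      have "homogeneous_ideal (ideal_generated {h})"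
        unfolding homogeneous_ideal_def using that by (intro exI[of _ "{h}"]) auto
      then have "closedin Proj (Proj_zeros {h})"
        unfolding closedin_Proj by (metis Proj_zeros_ideal_generated)
      then have "closedin ?X (Proj_zeros {h} \<inter> Proj_zeros I)"
        by (rule closedin_subtopology_Int_closed[THEN back_subst[of "closedin ?X"]]) (rule Int_commute)
      then have "closedin ?X (Z \<inter> (Proj_zeros {h} \<inter> Proj_zeros I))"
        by (rule closedin_Int[OF cl])
      moreover have "Z \<inter> (Proj_zeros {h} \<inter> Proj_zeros I) = Z \<inter> Proj_zeros {h}"
        using I' by blast
      ultimately show ?thesis by simp
    qed
    have "Z = (Z \<inter> Proj_zeros {f}) \<union> (Z \<inter> Proj_zeros {g})"
    proof -
      have "Q \<in> Proj_zeros {f} \<or> Q \<in> Proj_zeros {g}" if "Q \<in> Z" for Q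
      proof -
        have "f * g \<in> Q" using fg(3) that by blast
        moreover have "is_prime_ideal Q" using pts[OF that] by (simp add: Proj_points_def)
        ultimately have "f \<in> Q \<or> g \<in> Q" by (simp add: is_prime_ideal_def)
        then show ?thesis using pts[OF that] by (auto simp: Proj_zeros_def)
      qed
      then show ?thesis by blast
    qed
    then have "Z = Z \<inter> Proj_zeros {f} \<or> Z = Z \<inter> Proj_zeros {g}"
      using Z clf[OF fg(1)] clf[OF fg(2)] unfolding irreducible_closedin_def by blast
    then show "f \<in> \<Inter>Z \<or> g \<in> \<Inter>Z" by (auto simp: Proj_zeros_def)
  qed
  then show "\<Inter>Z \<in> Proj_points" unfolding Proj_points_def using hZ sP P'(2) by blast
qed

text \<open>Vanishing ideals reverse inclusions, whence the index \<open>e - i\<close>; they stay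
  distinct because each \<open>Z i\<close> is recovered from its ideal.\<close>

lemma chain_of_primes_if_chain_of_closed:
  fixes Z :: "nat \<Rightarrow> ('v::finite, 'k::field) mpolys set set"
  assumes Z: "\<forall>i\<le>e. irreducible_closedin (subtopology Proj (Proj_zeros I)) (Z i)" "\<forall>i<e. Z i \<subset> Z (Suc i)"
  shows "\<not> grows_le e (hdim I)"
proof -
  define P where "P i = \<Inter>(Z (e - i))" for i
  have pr: "\<Inter>(Z i) \<in> Proj_points" "I \<subseteq> \<Inter>(Z i)" "Z i = Proj_zeros (\<Inter>(Z i))" if "i \<le> e" for i
    by (rule irreducible_closedin_prime[OF Z(1)[rule_format, OF that]])+
  have "P i \<subset> P (Suc i)" if "i < e" for i
  proof -
    let ?j = "e - Suc i"
    have j: "e - i = Suc ?j" "?j < e" using that by auto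
    have ss: "Z ?j \<subset> Z (Suc ?j)" using Z(2) j(2) by blast
    then have "\<Inter>(Z (Suc ?j)) \<subseteq> \<Inter>(Z ?j)" by blast
    moreover have "\<Inter>(Z (Suc ?j)) \<noteq> \<Inter>(Z ?j)"
    proof
      assume eq: "\<Inter>(Z (Suc ?j)) = \<Inter>(Z ?j)"
      have "Z (Suc ?j) = Proj_zeros (\<Inter>(Z (Suc ?j)))" using j(2) by (intro pr(3)) simp
      also have "\<dots> = Z ?j" unfolding eq using j(2) by (intro pr(3)[symmetric]) simp
      finally show False using ss by blast
    qed
    ultimately show ?thesis unfolding P_def j(1) by blast
  qed
  moreover have "P i \<in> Proj_points" if "i \<le> e" for i unfolding P_def by (rule pr(1)) simp
  ultimately have "\<not> grows_le e (hdim (P 0))" by (intro growth_of_prime_chain)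
  moreover have "I \<subseteq> P 0" unfolding P_def by (rule pr(2)) simp
  ultimately show ?thesis using grows_le_antimono by blast
qed

lemma chain_of_closed_if_growth:
  fixes I :: "('v::finite, 'k::field) mpolys set"
  assumes "homogeneous_ideal I" "\<not> grows_le k (hdim I)"
  shows "\<exists>Z. (\<forall>i\<le>k. irreducible_closedin (subtopology Proj (Proj_zeros I)) (Z i)) \<and> (\<forall>i<k. Z i \<subset> Z (Suc i))"
proof -
  obtain P where P: "\<And>i. i \<le> k \<Longrightarrow> P i \<in> Proj_points" "\<And>i. i \<le> k \<Longrightarrow> I \<subseteq> P i" "\<And>i. i < k \<Longrightarrow> P i \<subset> P (Suc i)"
    using prime_chain_of_growth[OF assms] by blast
  show ?thesis
  proof (intro exI[of _ "\<lambda>i. Proj_zeros (P (k - i))"] conjI allI impI)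
    fix i
    show "irreducible_closedin (subtopology Proj (Proj_zeros I)) (Proj_zeros (P (k - i)))"
      by (rule irreducible_closedin_zeros[OF P(1,2)]) simp_all
  next
    fix i assume i: "i < k"
    let ?j = "k - Suc i"
    have j: "k - i = Suc ?j" "?j < k" using i by auto
    have "P ?j \<in> Proj_zeros (P ?j)" using P(1)[of ?j] by (simp add: Proj_zeros_def)
    moreover have "P ?j \<notin> Proj_zeros (P (Suc ?j))"
      using P(3)[OF j(2)] by (auto simp: Proj_zeros_def)
    moreover have "Proj_zeros (P (Suc ?j)) \<subseteq> Proj_zeros (P ?j)"
      using P(3)[OF j(2)] by (auto simp: Proj_zeros_def)
    ultimately show "Proj_zeros (P (k - i)) \<subset> Proj_zeros (P (k - Suc i))"
      unfolding j(1) by blast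
  qed
qed

text \<open>The lower growth bound provides a chain of length \<open>k\<close>, and the upper one
  excludes chains longer than \<open>Suc k\<close>; the supremum depends on whether length
  \<open>Suc k\<close> occurs.\<close>

lemma krull_dim_zeros:
  fixes I :: "('v::finite, 'k::field) mpolys set"
  assumes "homogeneous_ideal I" "\<not> grows_le k (hdim I)" "grows_le (Suc (Suc k)) (hdim I)"
  shows "krull_dim (subtopology Proj (Proj_zeros I)) = ereal (real k) \<or>
    krull_dim (subtopology Proj (Proj_zeros I)) = ereal (real (Suc k))"
proof -
  let ?chain = "\<lambda>n. \<exists>Z. (\<forall>i\<le>n. irreducible_closedin (subtopology Proj (Proj_zeros I)) (Z i)) \<and> (\<forall>i<n. Z i \<subset> Z (Suc i))"
  let ?S = "{ereal (real n) | n. ?chain n}"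
  have kd: "krull_dim (subtopology Proj (Proj_zeros I)) = Sup ?S" by (simp add: krull_dim_def)
  have k: "?chain k" by (rule chain_of_closed_if_growth[OF assms(1,2)])
  have le: "n \<le> Suc k" if "?chain n" for n
  proof (rule ccontr)
    assume "\<not> n \<le> Suc k"
    then have "grows_le n (hdim I)" using grows_le_mono[OF assms(3)] by simp
    then show False using chain_of_primes_if_chain_of_closed that by blast
  qed
  show ?thesis
  proof (cases "?chain (Suc k)")
    case True
    have "Sup ?S = ereal (real (Suc k))"
    proof (rule Sup_eqI)
      fix y assume "y \<in> ?S"
      then obtain n where "y = ereal (real n)" "?chain n" by blast
      then show "y \<le> ereal (real (Suc k))" using le[of n] by simp
    next
      fix y assume "\<And>z. z \<in> ?S \<Longrightarrow> z \<le> y"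
      then show "ereal (real (Suc k)) \<le> y" using True by blast
    qed
    then show ?thesis using kd by simp
  next
    case False
    have le': "n \<le> k" if "?chain n" for n
      using le[OF that] False that by (metis le_SucE)
    have "Sup ?S = ereal (real k)"
    proof (rule Sup_eqI)
      fix y assume "y \<in> ?S"
      then obtain n where "y = ereal (real n)" "?chain n" by blast
      then show "y \<le> ereal (real k)" using le'[of n] by simp
    next
      fix y assume "\<And>z. z \<in> ?S \<Longrightarrow> z \<le> y"
      then show "ereal (real k) \<le> y" using k by blast
    qed
    then show ?thesis using kd by simp
  qed
qed

theorem theorem3p4:
  fixes J :: "('v::finite, 'k::alg_closed_field) mpolys set" and n :: nat
  assumes "n \<ge> 1"
    and "homogeneous_ideal J"
    and "hilbert_function J n \<ge> (n + 2) choose 2"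
    and "int (hilbert_function J (n + 1)) = int (macaulay_up (hilbert_function J n) n) - 1"
  shows "krull_dim (base_locus J n) = ereal (of_int (MG (hilbert_function J n) n - 1)) \<or>
         krull_dim (base_locus J n) = ereal (of_int (MG (hilbert_function J n) n))"
proof -
  \<comment> \<open>Discarding generators of other degrees leaves the Hilbert function in degree
    \<open>n\<close> unchanged and can only raise it in degree \<open>n + 1\<close>, so the growth
    of \<open>G\<close> is still at most one below the maximum.\<close>
  define G where "G = J \<inter> forms n"
  have G: "G \<subseteq> forms_upto n" unfolding G_def using forms_subset_upto[of n n] by blast
  let ?c = "hilbert_function J n"
  have c: "?c = hdim G n"
    unfolding hilbert_function_eq_hdim[OF assms(2)] hdim_def G_def perp_homogeneous[OF assms(2), of n] ..
  have c': "hilbert_function J (n + 1) \<le> hdim G (Suc n)"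
    unfolding hilbert_function_eq_hdim[OF assms(2)]
    using hdim_antimono[of G J "Suc n"] by (simp add: G_def)
  have "0 < (n + 2) choose 2" by simp
  then have pos: "?c \<ge> 1" using assms(3) by linarith
  obtain k j where kj: "binomial_expansion n ?c k j"
    using binomial_expansion_exists[of ?c n] pos assms(1) by auto
  have b: "k n choose n \<le> ?c" "?c < Suc (k n) choose n"
    using binomial_expansion_bounds[OF kj] by auto
  have "n + 2 \<le> k n"
  proof (rule ccontr)
    assume "\<not> n + 2 \<le> k n"
    then have "Suc (k n) choose n \<le> (n + 2) choose n" by (intro binomial_right_mono) simp
    then show False using b(2) assms(3) choose_Suc_Suc_2[of n] by simp
  qed
  \<comment> \<open>Thus \<open>e\<close> is the MG-dimension minus one. Growth beyond order
    \<open>e\<close> and at most of order \<open>e + 2\<close> gives dimension \<open>e\<close> or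
    \<open>e + 1\<close>.\<close>
  define e where "e = k n - n - 1"
  have ke: "k n = n + Suc e" and e1: "Suc e \<ge> 1"
    using \<open>n + 2 \<le> k n\<close> by (simp_all add: e_def)
  have MG: "MG ?c n = int (Suc e)" unfolding MG_eq[OF kj] ke by simp
  have "mac_up n ?c \<le> Suc (hdim G (Suc n))"
    using assms(4) c' macaulay_up_eq_mac_up[OF assms(1) pos] by linarith
  then have "\<not> grows_le (Suc e - 1) (hdim G)"
    using submaximal_growth[OF assms(1) G e1] b(1) unfolding c ke by blast
  then have low: "\<not> grows_le e (hdim (ideal_generated G))" by (simp add: hdim_ideal_generated)
  have "hdim G n < (n + Suc (Suc e)) choose n" using b(2) unfolding c ke by simp
  then have up: "grows_le (Suc (Suc e)) (hdim (ideal_generated G))"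
    unfolding hdim_ideal_generated by (rule growth_upper_bound[OF assms(1) G])
  have "homogeneous_ideal (ideal_generated G)"
    unfolding homogeneous_ideal_def G_def by (intro exI[of _ "J \<inter> forms n"]) auto
  from krull_dim_zeros[OF this low up] show ?thesis
    unfolding base_locus_def G_def[symmetric] MG by auto
qed

end
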